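(* Let $1\le p\le n-2$ and let $f_1,\dots,f_{p+1}$ be homogeneous polynomials on $\mathbb{C}^{n+1}$ such that the divisor $f_1\cdots f_{p+1}=0$ has strictly ordinary singularities outside $0\in\mathbb{C}^{n+1}$. If $\eta\in\mathcal{L}^p_{\mathcal{F}}(f_1,\dots,f_{p+1})$ then the foliation $\mathcal{F}_\eta$ defined by $\eta$ on $\mathbb{P}^n$ is a rational fibration of codimension $p$ on $\mathbb{P}^n$. In other words, $\mathcal{F}_\eta$ has a rational first integral $F:\mathbb{P}^n\dashrightarrow\mathbb{P}^p$ that in homogeneous coordinates can be written as $$F=\left(f_1^{k_1},\dots,f_{p+1}^{k_{p+1}}\right),$$ where $k_1,\dots,k_{p+1}$ are positive integers with $k_1\deg(f_1)=\dots=k_{p+1}\deg(f_{p+1})$ and $\gcd(k_1,\dots,k_{p+1})=1$.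
   Context: A hypersurface $(f_1\cdots f_r=0)\subset\mathbb{C}^{N}$ ($N=n+1$; $f_1\cdots f_r$ reduced, $f_i(0)=0$) has strictly ordinary singularities outside $0$ if for all $1\le i_1<\dots<i_k\le r$: if $k\ge N$ then $(f_{i_1}=\dots=f_{i_k}=0)=\{0\}$; if $1\le k<N$ then $df_{i_1}(z)\wedge\dots\wedge df_{i_k}(z)\neq0$ for all $z\in(f_{i_1}=\dots=f_{i_k}=0)\setminus\{0\}$. $\mathcal{L}^p_{\mathcal{F}}(f_1,\dots,f_r)$ is the set (up to non-zero scalars) of non-zero $p$-forms $\eta=\sum_{1\le i_1<\dots<i_p\le r}\lambda_{i_1\dots i_p}\frac{df_{i_1}}{f_{i_1}}\wedge\dots\wedge\frac{df_{i_p}}{f_{i_p}}$ on $\mathbb{C}^{n+1}$, $\lambda_{i_1\dots i_p}\in\mathbb{C}$, such that $i_R\eta=0$ ($R$ the radial vector field) and $\eta$ is integrable, i.e. outside its poles and zeros it is locally a product $\omega_1\wedge\dots\wedge\omega_p$ of holomorphic $1$-forms with $d\omega_j\wedge\omega_1\wedge\dots\wedge\omega_p=0$ for all $j$. Such an $\eta$ defines a singular codimension $p$ foliation $\mathcal{F}_\eta$ on $\mathbb{P}^n$, whose tangent spaces, lifted to $\mathbb{C}^{n+1}$, are the kernels of $\eta$ at generic points. A rational first integral is a rational map that is constant along the leaves, with generic fibres of codimension $p$. *)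

theory Defs
  imports
    "HOL-Analysis.Analysis"
    "HOL-Library.Poly_Mapping"
    "HOL-Computational_Algebra.Squarefree"
begin

section \<open>Complex polynomials in several variables\<close>

type_synonym 'v cpoly = "('v \<Rightarrow>\<^sub>0 nat) \<Rightarrow>\<^sub>0 complex"

definition monom_degree :: "('v \<Rightarrow>\<^sub>0 nat) \<Rightarrow> nat" where
  "monom_degree m = (\<Sum>v\<in>Poly_Mapping.keys m. Poly_Mapping.lookup m v)"

definition total_degree :: "'v cpoly \<Rightarrow> nat" where
  "total_degree P = Max (insert 0 (monom_degree ` Poly_Mapping.keys P))"

definition homogeneous_of_degree :: "nat \<Rightarrow> 'v cpoly \<Rightarrow> bool" where
  "homogeneous_of_degree d P \<longleftrightarrow> (\<forall>m\<in>Poly_Mapping.keys P. monom_degree m = d)"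

definition homogeneous :: "'v cpoly \<Rightarrow> bool" where
  "homogeneous P \<longleftrightarrow> (\<exists>d. homogeneous_of_degree d P)"

definition poly_vars :: "'v cpoly \<Rightarrow> 'v set" where
  "poly_vars P = (\<Union>m\<in>Poly_Mapping.keys P. Poly_Mapping.keys m)"

definition poly_eval :: "'v cpoly \<Rightarrow> ('v \<Rightarrow> complex) \<Rightarrow> complex" where
  "poly_eval P x = (\<Sum>m\<in>Poly_Mapping.keys P.
     Poly_Mapping.lookup P m * (\<Prod>v\<in>Poly_Mapping.keys m. x v ^ Poly_Mapping.lookup m v))"

definition poly_fun :: "'n cpoly \<Rightarrow> complex ^ 'n \<Rightarrow> complex" where
  "poly_fun P z = poly_eval P (\<lambda>i. z $ i)"


section \<open>Holomorphic functions and forms on open subsets of complex vector space\<close>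

abbreviation complex_linear :: "(complex ^ 'n::finite \<Rightarrow> complex) \<Rightarrow> bool" where
  "complex_linear \<phi> \<equiv> Vector_Spaces.linear (*s) (*) \<phi>"

definition holomorphic_fun :: "(complex ^ 'n::finite) set \<Rightarrow> (complex ^ 'n \<Rightarrow> complex) \<Rightarrow> bool" where
  "holomorphic_fun U g \<longleftrightarrow>
     (\<forall>z\<in>U. \<exists>g'. (g has_derivative g') (at z) \<and> complex_linear g')"

text \<open>
  A \<open>k\<close>-form at a point is a function of a sequence of tangent vectors that depends only on the
  entries \<open>0, \<dots>, k - 1\<close> and is multilinear and alternating in them. One-forms are also
  written simply as functions of a single vector.
\<close>

type_synonym 'n form = "(nat \<Rightarrow> complex ^ 'n) \<Rightarrow> complex"

definition alternating_form :: "nat \<Rightarrow> 'n::finite form \<Rightarrow> bool" where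
  "alternating_form k \<phi> \<longleftrightarrow>
     (\<forall>v w. (\<forall>i<k. v i = w i) \<longrightarrow> \<phi> v = \<phi> w) \<and>
     (\<forall>v. \<forall>i<k. complex_linear (\<lambda>x. \<phi> (v(i := x)))) \<and>
     (\<forall>v. \<forall>i<k. \<forall>j<k. i \<noteq> j \<longrightarrow> v i = v j \<longrightarrow> \<phi> v = 0)"

definition holomorphic_form ::
    "nat \<Rightarrow> (complex ^ 'n::finite) set \<Rightarrow> (complex ^ 'n \<Rightarrow> 'n form) \<Rightarrow> bool" where
  "holomorphic_form k U \<theta> \<longleftrightarrow>
     (\<forall>z\<in>U. alternating_form k (\<theta> z)) \<and> (\<forall>v. holomorphic_fun U (\<lambda>z. \<theta> z v))"

definition holomorphic_1form ::
    "(complex ^ 'n::finite) set \<Rightarrow> (complex ^ 'n \<Rightarrow> complex ^ 'n \<Rightarrow> complex) \<Rightarrow> bool" where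
  "holomorphic_1form U \<omega> \<longleftrightarrow>
     (\<forall>z\<in>U. complex_linear (\<omega> z)) \<and> (\<forall>u. holomorphic_fun U (\<lambda>z. \<omega> z u))"

abbreviation differential ::
    "(complex ^ 'n::finite \<Rightarrow> complex) \<Rightarrow> complex ^ 'n \<Rightarrow> complex ^ 'n \<Rightarrow> complex" where
  "differential g z \<equiv> frechet_derivative g (at z)"

text \<open>The product of the covectors \<open>\<alpha> 0, \<dots>, \<alpha> (k - 1)\<close>, as a determinant.\<close>

definition wedge_covectors :: "nat \<Rightarrow> (nat \<Rightarrow> complex ^ 'n \<Rightarrow> complex) \<Rightarrow> 'n form" where
  "wedge_covectors k \<alpha> = (\<lambda>v.
     \<Sum>\<sigma> | \<sigma> permutes {..<k}. of_int (sign \<sigma>) * (\<Prod>j<k. \<alpha> j (v (\<sigma> j))))"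

definition wedge :: "nat \<Rightarrow> nat \<Rightarrow> 'n form \<Rightarrow> 'n form \<Rightarrow> 'n form" where
  "wedge k l \<phi> \<psi> = (\<lambda>v.
     (\<Sum>\<sigma> | \<sigma> permutes {..<k + l}.
        of_int (sign \<sigma>) * \<phi> (\<lambda>i. v (\<sigma> i)) * \<psi> (\<lambda>i. v (\<sigma> (k + i)))) / (fact k * fact l))"

text \<open>The exterior derivative of a one-form.\<close>

definition ext_deriv ::
    "(complex ^ 'n::finite \<Rightarrow> complex ^ 'n \<Rightarrow> complex) \<Rightarrow> complex ^ 'n \<Rightarrow> 'n form" where
  "ext_deriv \<omega> z = (\<lambda>v.
     differential (\<lambda>x. \<omega> x (v 1)) z (v 0) - differential (\<lambda>x. \<omega> x (v 0)) z (v 1))"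

definition contract :: "complex ^ 'n \<Rightarrow> 'n form \<Rightarrow> 'n form" where
  "contract u \<phi> = (\<lambda>v. \<phi> (case_nat u v))"


section \<open>Strictly ordinary singularities\<close>

text \<open>
  The families \<open>f\<close> are indexed by \<open>1, \<dots>, r\<close>, and a set \<open>I\<close> of indices stands for the increasing
  sequence of its elements.
\<close>

definition divisor :: "nat \<Rightarrow> (nat \<Rightarrow> 'n cpoly) \<Rightarrow> (complex ^ 'n) set" where
  "divisor r f = {z. poly_fun (\<Prod>i\<in>{1..r}. f i) z = 0}"

definition strictly_ordinary :: "nat \<Rightarrow> (nat \<Rightarrow> 'n::finite cpoly) \<Rightarrow> bool" where
  "strictly_ordinary r f \<longleftrightarrow>
     squarefree (\<Prod>i\<in>{1..r}. f i) \<and>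
     (\<forall>i\<in>{1..r}. poly_fun (f i) 0 = 0) \<and>
     (\<forall>I. I \<subseteq> {1..r} \<and> I \<noteq> {} \<longrightarrow>
        (CARD('n) \<le> card I \<longrightarrow> {z. \<forall>i\<in>I. poly_fun (f i) z = 0} = {0}) \<and>
        (card I < CARD('n) \<longrightarrow>
           (\<forall>z \<in> {z. \<forall>i\<in>I. poly_fun (f i) z = 0} - {0}.
              wedge_covectors (card I)
                (\<lambda>j. differential (poly_fun (f (sorted_list_of_set I ! j))) z) \<noteq> (\<lambda>v. 0))))"


section \<open>Integrable logarithmic forms\<close>

text \<open>Only the values outside \<open>divisor r f\<close> are meaningful; elsewhere the formula divides by zero.\<close>

definition log_form ::
    "nat \<Rightarrow> nat \<Rightarrow> (nat \<Rightarrow> 'n::finite cpoly) \<Rightarrow> (nat set \<Rightarrow> complex) \<Rightarrow> complex ^ 'n \<Rightarrow> 'n form" where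
  "log_form p r f lam z = (\<lambda>v.
     \<Sum>I | I \<subseteq> {1..r} \<and> card I = p.
       lam I * wedge_covectors p
         (\<lambda>j u. differential (poly_fun (f (sorted_list_of_set I ! j))) z u
                / poly_fun (f (sorted_list_of_set I ! j)) z) v)"

text \<open>
  A form \<open>\<eta>\<close> given off a nowhere dense set \<open>D\<close> is integrable if it is locally a product of
  holomorphic one-forms as required near every point that is neither a pole nor a zero. A point
  of \<open>D\<close> is not a pole if \<open>\<eta>\<close> extends holomorphically across it, so the quantification is over
  the local holomorphic extensions \<open>\<theta>\<close> of \<open>\<eta>\<close>.
\<close>

definition integrable_form ::
    "nat \<Rightarrow> (complex ^ 'n::finite) set \<Rightarrow> (complex ^ 'n \<Rightarrow> 'n form) \<Rightarrow> bool" where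
  "integrable_form p D \<eta> \<longleftrightarrow>
     (\<forall>U \<theta>. open U \<and> holomorphic_form p U \<theta> \<and> (\<forall>x\<in>U - D. \<theta> x = \<eta> x) \<longrightarrow>
        (\<forall>z\<in>U. \<theta> z \<noteq> (\<lambda>v. 0) \<longrightarrow>
           (\<exists>V \<omega>. open V \<and> z \<in> V \<and> V \<subseteq> U \<and>
              (\<forall>j<p. holomorphic_1form V (\<omega> j)) \<and>
              (\<forall>x\<in>V. \<theta> x = wedge_covectors p (\<lambda>j. \<omega> j x)) \<and>
              (\<forall>x\<in>V. \<forall>j<p.
                 wedge 2 p (ext_deriv (\<omega> j) x) (wedge_covectors p (\<lambda>i. \<omega> i x)) = (\<lambda>v. 0)))))"

text \<open>The radial vector field takes the value \<open>z\<close> at the point \<open>z\<close>.\<close>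

definition log_foliation_forms ::
    "nat \<Rightarrow> nat \<Rightarrow> (nat \<Rightarrow> 'n::finite cpoly) \<Rightarrow> (complex ^ 'n \<Rightarrow> 'n form) set" where
  "log_foliation_forms p r f = {\<eta>.
     (\<exists>lam. \<eta> = log_form p r f lam) \<and>
     (\<exists>z. z \<notin> divisor r f \<and> \<eta> z \<noteq> (\<lambda>v. 0)) \<and>
     (\<forall>z. z \<notin> divisor r f \<longrightarrow> contract z (\<eta> z) = (\<lambda>v. 0)) \<and>
     integrable_form p (divisor r f) \<eta>}"


section \<open>The induced foliation on projective space\<close>

text \<open>
  Subsets of projective space are represented by the cones over them in the complement of the
  origin, and the foliation by its lift to that complement. The form \<open>\<eta>\<close> is given off a
  nowhere dense set \<open>D\<close>. The foliation is regular at \<open>z\<close> if near \<open>z\<close> it is defined by a nowhere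
  vanishing holomorphic form \<open>\<theta>\<close> proportional to \<open>\<eta>\<close>, and its tangent space at \<open>z\<close> is then the
  kernel of \<open>\<theta> z\<close>, which does not depend on \<open>\<theta>\<close> because \<open>D\<close> is nowhere dense.
\<close>

definition local_generator ::
    "nat \<Rightarrow> (complex ^ 'n::finite) set \<Rightarrow> (complex ^ 'n \<Rightarrow> 'n form) \<Rightarrow>
     (complex ^ 'n) set \<Rightarrow> (complex ^ 'n \<Rightarrow> 'n form) \<Rightarrow> bool" where
  "local_generator p D \<eta> U \<theta> \<longleftrightarrow>
     open U \<and> holomorphic_form p U \<theta> \<and> (\<forall>x\<in>U. \<theta> x \<noteq> (\<lambda>v. 0)) \<and>
     (\<forall>x\<in>U - D. \<exists>c. \<forall>v. \<theta> x v = c * \<eta> x v)"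

definition regular_points ::
    "nat \<Rightarrow> (complex ^ 'n::finite) set \<Rightarrow> (complex ^ 'n \<Rightarrow> 'n form) \<Rightarrow> (complex ^ 'n) set" where
  "regular_points p D \<eta> = {z. z \<noteq> 0 \<and> (\<exists>U \<theta>. local_generator p D \<eta> U \<theta> \<and> z \<in> U)}"

definition foliation_tangent ::
    "nat \<Rightarrow> (complex ^ 'n::finite) set \<Rightarrow> (complex ^ 'n \<Rightarrow> 'n form) \<Rightarrow>
     complex ^ 'n \<Rightarrow> (complex ^ 'n) set" where
  "foliation_tangent p D \<eta> z =
     {u. \<exists>U \<theta>. local_generator p D \<eta> U \<theta> \<and> z \<in> U \<and> contract u (\<theta> z) = (\<lambda>v. 0)}"

text \<open>
  The leaf through a regular point consists of the points that can be joined to it by a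
  piecewise continuously differentiable path of regular points tangent to the foliation.
\<close>

definition tangent_path ::
    "nat \<Rightarrow> (complex ^ 'n::finite) set \<Rightarrow> (complex ^ 'n \<Rightarrow> 'n form) \<Rightarrow>
     (real \<Rightarrow> complex ^ 'n) \<Rightarrow> bool" where
  "tangent_path p D \<eta> \<gamma> \<longleftrightarrow>
     path \<gamma> \<and> path_image \<gamma> \<subseteq> regular_points p D \<eta> \<and>
     (\<exists>S. finite S \<and> \<gamma> C1_differentiable_on ({0..1} - S) \<and>
        (\<forall>t\<in>{0..1} - S. vector_derivative \<gamma> (at t) \<in> foliation_tangent p D \<eta> (\<gamma> t)))"

definition leaf ::
    "nat \<Rightarrow> (complex ^ 'n::finite) set \<Rightarrow> (complex ^ 'n \<Rightarrow> 'n form) \<Rightarrow>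
     complex ^ 'n \<Rightarrow> (complex ^ 'n) set" where
  "leaf p D \<eta> z = {w. \<exists>\<gamma>. tangent_path p D \<eta> \<gamma> \<and> pathstart \<gamma> = z \<and> pathfinish \<gamma> = w}"


section \<open>Codimension\<close>

definition complex_submanifold :: "nat \<Rightarrow> (complex ^ 'n::finite) set \<Rightarrow> bool" where
  "complex_submanifold c M \<longleftrightarrow>
     (\<forall>z\<in>M. \<exists>U g. open U \<and> z \<in> U \<and> (\<forall>i<c. holomorphic_fun U (g i)) \<and>
        (\<forall>x\<in>U. wedge_covectors c (\<lambda>i. differential (g i) x) \<noteq> (\<lambda>v. 0)) \<and>
        M \<inter> U = {x\<in>U. \<forall>i<c. g i x = 0})"

text \<open>
  The dimension of a locally closed analytic set is the largest dimension of a non-empty complex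
  submanifold contained in it. Passing to the cone over a subset of projective space preserves
  the codimension.
\<close>

definition has_codimension :: "nat \<Rightarrow> (complex ^ 'n::finite) set \<Rightarrow> bool" where
  "has_codimension c A \<longleftrightarrow>
     (\<exists>M. M \<noteq> {} \<and> M \<subseteq> A \<and> complex_submanifold c M) \<and>
     (\<forall>c'<c. \<not> (\<exists>M. M \<noteq> {} \<and> M \<subseteq> A \<and> complex_submanifold c' M))"


section \<open>Rational first integrals\<close>

text \<open>
  A rational map to projective \<open>m\<close>-space is given by homogeneous coordinates
  \<open>G 1, \<dots>, G (m + 1)\<close>, homogeneous polynomials of the same degree that are not all zero and have
  no non-constant common factor, so that it is defined exactly where they do not all vanish.
\<close>

definition rational_map :: "nat \<Rightarrow> (nat \<Rightarrow> 'n cpoly) \<Rightarrow> bool" where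
  "rational_map m G \<longleftrightarrow>
     (\<exists>d. \<forall>i\<in>{1..m + 1}. homogeneous_of_degree d (G i)) \<and>
     (\<exists>i\<in>{1..m + 1}. G i \<noteq> 0) \<and>
     (\<forall>h. (\<forall>i\<in>{1..m + 1}. h dvd G i) \<longrightarrow> h dvd 1)"

definition rational_map_domain :: "nat \<Rightarrow> (nat \<Rightarrow> 'n cpoly) \<Rightarrow> (complex ^ 'n) set" where
  "rational_map_domain m G = {z. z \<noteq> 0 \<and> (\<exists>i\<in>{1..m + 1}. poly_fun (G i) z \<noteq> 0)}"

definition same_point :: "nat \<Rightarrow> (nat \<Rightarrow> complex) \<Rightarrow> (nat \<Rightarrow> complex) \<Rightarrow> bool" where
  "same_point m a b \<longleftrightarrow> (\<exists>c. c \<noteq> 0 \<and> (\<forall>i\<in>{1..m + 1}. a i = c * b i))"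

definition rational_map_fibre ::
    "nat \<Rightarrow> (nat \<Rightarrow> 'n cpoly) \<Rightarrow> (nat \<Rightarrow> complex) \<Rightarrow> (complex ^ 'n) set" where
  "rational_map_fibre m G q =
     {z \<in> rational_map_domain m G. same_point m (\<lambda>i. poly_fun (G i) z) q}"

text \<open>
  Generic points \<open>q\<close> of the target are those of a non-empty Zariski open subset, which may be
  taken to be the complement of a hypersurface \<open>H = 0\<close>.
\<close>

definition rational_first_integral ::
    "nat \<Rightarrow> (complex ^ 'n::finite) set \<Rightarrow> (complex ^ 'n \<Rightarrow> 'n form) \<Rightarrow>
     (nat \<Rightarrow> 'n cpoly) \<Rightarrow> bool" where
  "rational_first_integral p D \<eta> G \<longleftrightarrow>
     rational_map p G \<and>
     (\<forall>x \<in> regular_points p D \<eta>.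
        \<forall>z \<in> leaf p D \<eta> x \<inter> rational_map_domain p G.
        \<forall>w \<in> leaf p D \<eta> x \<inter> rational_map_domain p G.
          same_point p (\<lambda>i. poly_fun (G i) z) (\<lambda>i. poly_fun (G i) w)) \<and>
     (\<exists>H :: nat cpoly. H \<noteq> 0 \<and> homogeneous H \<and> poly_vars H \<subseteq> {1..p + 1} \<and>
        (\<forall>q. (\<exists>i\<in>{1..p + 1}. q i \<noteq> 0) \<and> poly_eval H q \<noteq> 0 \<longrightarrow>
             has_codimension p (rational_map_fibre p G q)))"

end

theory Submission
  imports
    Defs
    "HOL-Complex_Analysis.Conformal_Mappings"
    "HOL-Computational_Algebra.Fundamental_Theorem_Algebra"
begin

text \<open>
  Let \<open>u i = f i ^ k i\<close>, where the exponents make all the \<open>u i\<close> homogeneous of one degree \<open>\<delta>\<close>.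

  \<^emph>\<open>The map is constant along the leaves.\<close> Off the divisor, \<open>\<eta>\<close> is the pullback under
  \<open>(f 1, \<dots>, f (p + 1))\<close> of a \<open>p\<close>-form in \<open>p + 1\<close> logarithmic variables, and it is annihilated by the
  radial field. A non-zero \<open>p\<close>-form in \<open>p + 1\<close> variables has a kernel of dimension one, so a vector
  annihilated by \<open>\<eta>\<close> has the same logarithmic derivatives, up to a common factor, as the radial
  vector. By Euler's identity this says that the one-forms
  \<open>\<tau> i j = deg (f j) f j df i - deg (f i) f i df j\<close>, which are proportional to the differentials of the
  quotients \<open>u i / u j\<close>, vanish on that vector. The relation \<open>\<tau> i j \<and> \<eta> = 0\<close> persists for every local
  generator of the foliation by continuity, also at points of the divisor
  (\<open>generator_wedge\<close>, \<open>\<tau>_tangent\<close>). At a base point, where all the \<open>f i\<close> vanish, the \<open>f i\<close> are part of a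
  coordinate system, and blowing up the same relation in different directions shows that
  no local generator exists (\<open>regular_point_not_base\<close>). Hence a path in a leaf never meets the base
  locus, and along it all the quotients are locally constant.

  \<^emph>\<open>The generic fibres have codimension \<open>p\<close>.\<close> Base points exist, since fewer homogeneous equations
  than variables have a common non-trivial zero. Near one of them the \<open>f i\<close> take all small values at
  points where their differentials are independent, so every fibre over a point with non-zero
  coordinates contains a submanifold of codimension \<open>p\<close>. A submanifold of smaller codimension in a
  fibre can only consist of points where the differentials of the \<open>f i\<close> are dependent. These critical
  points form a closed cone, which meets \<open>f 1 = \<dots> = f p = 0\<close> only in the origin, because the
  singularities are strictly ordinary. So \<open>p\<close> homogeneous polynomials suffice to cut it down to the
  origin; its coordinate ring then grows at most like a polynomial of degree \<open>p\<close>, and the \<open>p + 1\<close>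
  functions \<open>u i\<close> satisfy a homogeneous relation on it (\<open>homogeneous_relation\<close>). This relation
  is the equation of a hypersurface that contains all the critical values.

  \<^emph>\<open>The coordinates have no common factor.\<close> A non-constant common factor would vanish at a point other
  than the origin where \<open>f 1 = f 2 = 0\<close>. There \<open>f 1\<close> and \<open>f 2\<close> are part of a coordinate system, so the
  factor would have an isolated zero on a two-dimensional slice, which is impossible for a
  holomorphic function (\<open>common_divisor_is_unit\<close>).

  The dimension count and the existence of base points rest on Hilbert's Nullstellensatz, which over
  the complex numbers follows from the uncountability of the field.
\<close>

section \<open>Dual vectors, determinants and alternating forms\<close>

text \<open>
  This elimination argument is the only dimension theory of vector spaces used below: every
  appeal to the rank of a finite family is phrased as a non-trivial solution of such a system.
\<close>

lemma underdetermined_system: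
  fixes a :: "'i \<Rightarrow> 'j \<Rightarrow> 'a::field"
  assumes "finite A" "finite B" "card A < card B"
  shows "\<exists>y. (\<exists>j\<in>B. y j \<noteq> 0) \<and> (\<forall>i\<in>A. (\<Sum>j\<in>B. a i j * y j) = 0)"
  using assms
proof (induction A arbitrary: B a rule: finite_induct)
  case empty
  then obtain j where "j \<in> B" by fastforce
  thus ?case by (intro exI[of _ "\<lambda>_. 1"]) auto
next
  case (insert i0 A)
  show ?case
  proof (cases "\<forall>j\<in>B. a i0 j = 0")
    case True
    have "card A < card B" using insert by simp
    from insert.IH[OF insert.prems(1) this, of a] True show ?thesis by auto
  next
    case False
    then obtain j0 where j0: "j0 \<in> B" "a i0 j0 \<noteq> 0" by auto
    let ?B = "B - {j0}"
    have "finite ?B" "card A < card ?B" using insert j0 by auto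
    then obtain y where y: "\<exists>j\<in>?B. y j \<noteq> 0"
      "\<forall>i\<in>A. (\<Sum>j\<in>?B. (a i j - a i j0 * a i0 j / a i0 j0) * y j) = 0"
      using insert.IH[of ?B "\<lambda>i j. a i j - a i j0 * a i0 j / a i0 j0"] by auto
    define s where "s = (\<Sum>j\<in>?B. a i0 j * y j)"
    define y' where "y' = y(j0 := - s / a i0 j0)"
    have sum: "(\<Sum>j\<in>B. a i j * y' j) = (\<Sum>j\<in>?B. a i j * y j) - a i j0 * s / a i0 j0" for i
      using j0 insert.prems(1)
      by (subst sum.remove[OF _ j0(1)]) (auto simp: y'_def intro!: sum.cong)
    have "(\<Sum>j\<in>B. a i j * y' j) = 0" if "i \<in> A" for i
    proof -
      have "(\<Sum>j\<in>?B. (a i j - a i j0 * a i0 j / a i0 j0) * y j)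
          = (\<Sum>j\<in>?B. a i j * y j) - a i j0 / a i0 j0 * s"
        unfolding s_def by (simp add: sum_subtractf sum_distrib_left algebra_simps)
      thus ?thesis using y(2) that by (simp add: sum)
    qed
    moreover have "(\<Sum>j\<in>B. a i0 j * y' j) = 0"
      using j0 by (simp add: sum s_def)
    moreover have "\<exists>j\<in>B. y' j \<noteq> 0" using y(1) by (auto simp: y'_def)
    ultimately show ?thesis by (intro exI[of _ y']) auto
  qed
qed

lemma complex_linear_iff:
  "complex_linear \<phi> \<longleftrightarrow> (\<forall>x y. \<phi> (x + y) = \<phi> x + \<phi> y) \<and> (\<forall>c x. \<phi> (c *s x) = c * \<phi> x)"
  for \<phi> :: "complex ^ 'n::finite \<Rightarrow> complex"
proof -
  have 1: "vector_space ((*s) :: complex \<Rightarrow> complex ^ 'n \<Rightarrow> _)"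
    by unfold_locales (auto simp: vector_add_ldistrib vector_sadd_rdistrib vector_smult_assoc)
  have 2: "vector_space ((*) :: complex \<Rightarrow> _)"
    by unfold_locales (auto simp: algebra_simps)
  show ?thesis
    using 1 2 unfolding Vector_Spaces.linear_def module_hom_def module_hom_axioms_def vector_space_def module_def
    by (auto simp: algebra_simps)
qed

lemma complex_linear_simps:
  fixes \<phi> :: "complex ^ 'n::finite \<Rightarrow> complex"
  assumes "complex_linear \<phi>"
  shows "\<phi> (x + y) = \<phi> x + \<phi> y" "\<phi> (c *s x) = c * \<phi> x" "\<phi> 0 = 0"
    "\<phi> (x - y) = \<phi> x - \<phi> y" "\<phi> (- x) = - \<phi> x" "\<phi> (\<Sum>i\<in>A. c' i *s v i) = (\<Sum>i\<in>A. c' i * \<phi> (v i))"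
proof -
  have add: "\<phi> (x + y) = \<phi> x + \<phi> y" and sc: "\<phi> (c *s x) = c * \<phi> x" for x y c
    using assms by (auto simp: complex_linear_iff)
  show 0: "\<phi> 0 = 0" using sc[of 0 0] by simp
  show m: "\<phi> (- x) = - \<phi> x" for x
    using add[of x "- x"] 0 by (simp add: eq_neg_iff_add_eq_0 add.commute)
  show "\<phi> (x - y) = \<phi> x - \<phi> y" using add[of x "- y"] m[of y] by simp
  show "\<phi> (\<Sum>i\<in>A. c' i *s v i) = (\<Sum>i\<in>A. c' i * \<phi> (v i))"
    by (induction A rule: infinite_finite_induct) (auto simp: 0 add sc)
qed (use assms in \<open>auto simp: complex_linear_iff\<close>)

lemma complex_linear_sum:
  assumes "\<And>i. i \<in> A \<Longrightarrow> complex_linear (\<beta> i)"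
  shows "complex_linear (\<lambda>x. \<Sum>i\<in>A. c i * \<beta> i x)"
  using assms by (auto simp: complex_linear_iff sum.distrib sum_distrib_left algebra_simps intro!: sum.cong)

definition dual_vectors ::
    "'i set \<Rightarrow> ('i \<Rightarrow> complex ^ 'n \<Rightarrow> complex) \<Rightarrow> ('i \<Rightarrow> complex ^ 'n) \<Rightarrow> bool" where
  "dual_vectors A \<beta> v \<longleftrightarrow> (\<forall>i\<in>A. \<forall>j\<in>A. \<beta> i (v j) = (if i = j then 1 else 0))"

text \<open>
  Induction on the family, as in Gram-Schmidt: a functional that is not a combination of the
  others is non-zero on the common kernel of the others.
\<close>

lemma dual_vectors_of_independent:
  fixes \<beta> :: "'i \<Rightarrow> complex ^ 'n::finite \<Rightarrow> complex"
  assumes "finite A" "\<And>i. i \<in> A \<Longrightarrow> complex_linear (\<beta> i)"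
    and "\<And>y. (\<forall>x. (\<Sum>i\<in>A. y i * \<beta> i x) = 0) \<Longrightarrow> \<forall>i\<in>A. y i = 0"
  shows "\<exists>v. dual_vectors A \<beta> v"
  using assms
proof (induction A rule: finite_induct)
  case empty
  thus ?case by (auto simp: dual_vectors_def)
next
  case (insert l A)
  have "\<forall>i\<in>A. y i = 0" if "\<forall>x. (\<Sum>i\<in>A. y i * \<beta> i x) = 0" for y
  proof -
    have "(\<Sum>i\<in>insert l A. (y(l := 0)) i * \<beta> i x) = 0" for x
    proof -
      have "(\<Sum>i\<in>A. (y(l := 0)) i * \<beta> i x) = (\<Sum>i\<in>A. y i * \<beta> i x)"
        using insert.hyps by (intro sum.cong) auto
      thus ?thesis using that insert.hyps by simp
    qed
    hence "\<forall>i\<in>insert l A. (y(l := 0)) i = 0" using insert.prems(2)[of "y(l := 0)"] by blast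
    thus ?thesis using insert.hyps by (metis fun_upd_other insertCI)
  qed
  with insert.IH insert.prems(1) obtain v where v: "dual_vectors A \<beta> v" by blast
  have lin: "complex_linear (\<beta> i)" if "i \<in> insert l A" for i by (rule insert.prems(1)[OF that])
  define \<gamma> where "\<gamma> x = \<beta> l x - (\<Sum>j\<in>A. \<beta> l (v j) * \<beta> j x)" for x
  have "\<exists>x. \<gamma> x \<noteq> 0"
  proof (rule ccontr)
    assume *: "\<nexists>x. \<gamma> x \<noteq> 0"
    have "(\<Sum>i\<in>insert l A. (if i = l then 1 else - \<beta> l (v i)) * \<beta> i x) = \<gamma> x" for x
    proof -
      have "(\<Sum>i\<in>A. (if i = l then 1 else - \<beta> l (v i)) * \<beta> i x) = (\<Sum>i\<in>A. - (\<beta> l (v i) * \<beta> i x))"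
        using insert.hyps by (intro sum.cong) auto
      thus ?thesis using insert.hyps by (simp add: \<gamma>_def sum_negf)
    qed
    hence "\<forall>i\<in>insert l A. (if i = l then 1 else - \<beta> l (v i)) = 0"
      using * by (intro insert.prems(2)) auto
    thus False by auto
  qed
  then obtain x0 where x0: "\<gamma> x0 \<noteq> 0" by blast
  define w where "w = (1 / \<gamma> x0) *s (x0 - (\<Sum>j\<in>A. \<beta> j x0 *s v j))"
  have w0: "\<beta> i w = 0" if "i \<in> A" for i
  proof -
    have "(\<Sum>j\<in>A. \<beta> j x0 * \<beta> i (v j)) = (\<Sum>j\<in>A. if i = j then \<beta> j x0 else 0)"
      using v that by (intro sum.cong) (auto simp: dual_vectors_def)
    also have "\<dots> = \<beta> i x0" using that insert.hyps by simp
    finally show ?thesis using that by (simp add: w_def complex_linear_simps[OF lin])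
  qed
  have wl: "\<beta> l w = 1"
    using x0 by (simp add: w_def complex_linear_simps[OF lin] \<gamma>_def mult.commute diff_divide_distrib[symmetric])
  define v' where "v' i = (if i = l then w else v i - \<beta> l (v i) *s w)" for i
  have "dual_vectors (insert l A) \<beta> v'"
    using v w0 wl insert.hyps
    by (auto simp: dual_vectors_def v'_def complex_linear_simps[OF lin])
  thus ?case by blast
qed

lemma independent_of_dual_vectors:
  assumes "dual_vectors A \<beta> v" "finite A" "\<forall>x. (\<Sum>i\<in>A. y i * \<beta> i x) = 0" "j \<in> A"
  shows "y j = 0"
proof -
  have "0 = (\<Sum>i\<in>A. y i * \<beta> i (v j))" using assms(3) by simp
  also have "\<dots> = (\<Sum>i\<in>A. if i = j then y i else 0)"
    using assms(1,4) by (intro sum.cong) (auto simp: dual_vectors_def)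
  finally show ?thesis using assms by simp
qed

text \<open>
  The determinant of the leading \<open>k \<times> k\<close> block of a matrix; the products of covectors are such
  determinants, so their alternation comes from that of \<open>pdet\<close>.
\<close>

definition pdet :: "nat \<Rightarrow> (nat \<Rightarrow> nat \<Rightarrow> complex) \<Rightarrow> complex" where
  "pdet k A = (\<Sum>\<sigma> | \<sigma> permutes {..<k}. of_int (sign \<sigma>) * (\<Prod>j<k. A j (\<sigma> j)))"

lemma wedge_covectors_eq_pdet: "wedge_covectors k \<beta> v = pdet k (\<lambda>j i. \<beta> j (v i))"
  by (simp add: wedge_covectors_def pdet_def)

text \<open>
  Composing with the transposition of the two equal rows changes the sign of every summand.
\<close>

lemma pdet_identical_rows:
  assumes "l < k" "m < k" "l \<noteq> m" "\<And>i. A l i = A m i"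
  shows "pdet k A = 0"
proof -
  let ?t = "Transposition.transpose l m"
  have t: "?t permutes {..<k}" using assms by (intro permutes_swap_id) auto
  have "pdet k A = (\<Sum>\<sigma> | \<sigma> permutes {..<k}. of_int (sign (\<sigma> \<circ> ?t)) * (\<Prod>j<k. A j ((\<sigma> \<circ> ?t) j)))"
    unfolding pdet_def by (rule sum_permutations_compose_right[OF t])
  also have "\<dots> = (\<Sum>\<sigma> | \<sigma> permutes {..<k}. - (of_int (sign \<sigma>) * (\<Prod>j<k. A j (\<sigma> j))))"
  proof (intro sum.cong refl)
    fix \<sigma> assume "\<sigma> \<in> {\<sigma>. \<sigma> permutes {..<k}}"
    hence s: "\<sigma> permutes {..<k}" by simp
    have "sign (\<sigma> \<circ> ?t) = - sign \<sigma>"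
    proof -
      have "permutation \<sigma>" "permutation ?t" using s t permutation_permutes by blast+
      thus ?thesis using assms(3) by (simp add: sign_compose sign_swap_id)
    qed
    moreover have "(\<Prod>j<k. A j ((\<sigma> \<circ> ?t) j)) = (\<Prod>j<k. A j (\<sigma> j))"
    proof -
      have "(\<Prod>j<k. A j (\<sigma> j)) = (\<Prod>j<k. A (?t j) (\<sigma> (?t j)))"
        using prod.permute[OF t, of "\<lambda>j. A j (\<sigma> j)"] by simp
      also have "\<dots> = (\<Prod>j<k. A j (\<sigma> (?t j)))"
        by (intro prod.cong) (auto simp: Transposition.transpose_def assms(4))
      finally show ?thesis by simp
    qed
    ultimately show "of_int (sign (\<sigma> \<circ> ?t)) * (\<Prod>j<k. A j ((\<sigma> \<circ> ?t) j))
        = - (of_int (sign \<sigma>) * (\<Prod>j<k. A j (\<sigma> j)))" by simp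
  qed
  also have "\<dots> = - pdet k A" by (simp add: pdet_def sum_negf)
  finally show ?thesis by simp
qed

lemma pdet_row_combination:
  assumes "l < k"
  shows "pdet k (A(l := \<lambda>i. \<Sum>m\<in>M. y m * B m i)) = (\<Sum>m\<in>M. y m * pdet k (A(l := B m)))"
proof -
  have "(\<Prod>j<k. (A(l := f)) j (\<sigma> j)) = f (\<sigma> l) * (\<Prod>j\<in>{..<k} - {l}. A j (\<sigma> j))" for f \<sigma>
    using assms by (subst prod.remove[of _ l]) (auto intro!: prod.cong)
  thus ?thesis
    unfolding pdet_def
    by (simp add: sum_distrib_left sum_distrib_right sum.swap[of _ M] mult_ac)
qed

lemma pdet_transpose: "pdet k (\<lambda>i j. A j i) = pdet k A"
proof -
  have "pdet k (\<lambda>i j. A j i) = (\<Sum>\<sigma> | \<sigma> permutes {..<k}. of_int (sign (inv \<sigma>)) * (\<Prod>j<k. A (inv \<sigma> j) j))"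
    unfolding pdet_def by (subst sum_permutations_inverse) simp
  also have "\<dots> = pdet k A"
    unfolding pdet_def
  proof (intro sum.cong refl)
    fix \<sigma> assume "\<sigma> \<in> {\<sigma>. \<sigma> permutes {..<k}}"
    hence s: "\<sigma> permutes {..<k}" by simp
    have "(\<Prod>j<k. A (inv \<sigma> j) j) = (\<Prod>j<k. A (inv \<sigma> (\<sigma> j)) (\<sigma> j))"
      using prod.permute[OF s, of "\<lambda>j. A (inv \<sigma> j) j"] by simp
    also have "\<dots> = (\<Prod>j<k. A j (\<sigma> j))" by (simp add: permutes_inverses[OF s])
    finally have pr: "(\<Prod>j<k. A (inv \<sigma> j) j) = (\<Prod>j<k. A j (\<sigma> j))" .
    have "permutation \<sigma>" using s permutation_permutes by blast
    thus "of_int (sign (inv \<sigma>)) * (\<Prod>j<k. A (inv \<sigma> j) j) = of_int (sign \<sigma>) * (\<Prod>j<k. A j (\<sigma> j))"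
      unfolding pr by (simp add: sign_inverse)
  qed
  finally show ?thesis .
qed

lemma pdet_identity: "pdet k (\<lambda>i j. if i = j then 1 else 0) = 1"
proof -
  have "(\<Prod>j<k. if j = \<sigma> j then 1 else 0) = (0::complex)" if "\<sigma> permutes {..<k}" "\<sigma> \<noteq> id" for \<sigma>
  proof -
    from that obtain j where "\<sigma> j \<noteq> j" by (auto simp: fun_eq_iff)
    moreover from this that have "j < k" by (metis lessThan_iff permutes_def)
    ultimately show ?thesis by (intro prod_zero bexI[of _ j]) auto
  qed
  hence "pdet k (\<lambda>i j. if i = j then 1 else 0) = (\<Sum>\<sigma> | \<sigma> permutes {..<k}. if \<sigma> = id then 1 else 0)"
    unfolding pdet_def by (intro sum.cong) auto
  also have "\<dots> = 1" by (simp add: finite_permutations permutes_id)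
  finally show ?thesis .
qed

text \<open>
  Together with the converse \<open>wedge_of_dual_vectors\<close> this replaces the non-vanishing of a
  product of covectors by the existence of dual vectors, which is how independence is
  used throughout.
\<close>

lemma dual_vectors_of_wedge:
  fixes \<beta> :: "nat \<Rightarrow> complex ^ 'n::finite \<Rightarrow> complex"
  assumes lin: "\<And>i. i < k \<Longrightarrow> complex_linear (\<beta> i)" and ne: "wedge_covectors k \<beta> \<noteq> (\<lambda>v. 0)"
  shows "\<exists>v. dual_vectors {..<k} \<beta> v"
proof (rule dual_vectors_of_independent)
  fix y assume rel: "\<forall>x. (\<Sum>i<k. y i * \<beta> i x) = 0"
  show "\<forall>i\<in>{..<k}. y i = 0"
  proof (rule ccontr)
    assume "\<not> ?thesis"
    then obtain l where l: "l < k" "y l \<noteq> 0" by auto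
    have "wedge_covectors k \<beta> v = 0" for v
    proof -
      let ?A = "\<lambda>j i. \<beta> j (v i)"
      have b: "\<beta> l x = (\<Sum>m\<in>{..<k} - {l}. (- y m / y l) * \<beta> m x)" for x
      proof -
        have "0 = y l * \<beta> l x + (\<Sum>m\<in>{..<k} - {l}. y m * \<beta> m x)"
          using rel[rule_format, of x] l by (subst (asm) sum.remove[of _ l]) auto
        hence "\<beta> l x = - (\<Sum>m\<in>{..<k} - {l}. y m * \<beta> m x) / y l"
          using l(2) by (simp add: field_simps add_eq_0_iff)
        thus ?thesis by (simp add: sum_divide_distrib sum_negf)
      qed
      have eq: "?A = ?A(l := \<lambda>i. \<Sum>m\<in>{..<k} - {l}. (- y m / y l) * \<beta> m (v i))"
        using b by (auto simp: fun_eq_iff)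
      have "pdet k ?A = (\<Sum>m\<in>{..<k} - {l}. (- y m / y l) * pdet k (?A(l := \<lambda>i. \<beta> m (v i))))"
        by (subst eq, rule pdet_row_combination) (use l in auto)
      also have "\<dots> = 0"
      proof (intro sum.neutral ballI)
        fix m assume "m \<in> {..<k} - {l}"
        hence "pdet k (?A(l := \<lambda>i. \<beta> m (v i))) = 0"
          using l by (intro pdet_identical_rows[of l _ m]) auto
        thus "(- y m / y l) * pdet k (?A(l := \<lambda>i. \<beta> m (v i))) = 0" by simp
      qed
      finally show ?thesis by (simp add: wedge_covectors_eq_pdet)
    qed
    thus False using ne by auto
  qed
qed (use lin in auto)

lemma wedge_of_dual_vectors:
  assumes "dual_vectors {..<k} \<beta> v"
  shows "wedge_covectors k \<beta> v = 1"
proof -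
  have "pdet k (\<lambda>j i. \<beta> j (v i)) = pdet k (\<lambda>i j. if i = j then 1 else 0)"
    unfolding pdet_def
  proof (intro sum.cong refl arg_cong2[where f = "(*)"] prod.cong)
    fix \<sigma> j assume "\<sigma> \<in> {\<sigma>. \<sigma> permutes {..<k}}" "j \<in> {..<k}"
    thus "\<beta> j (v (\<sigma> j)) = (if j = \<sigma> j then 1 else 0)"
      using assms permutes_in_image[of \<sigma> "{..<k}" j] unfolding dual_vectors_def by auto
  qed
  thus ?thesis by (simp add: wedge_covectors_eq_pdet pdet_identity)
qed

lemma alternating_wedge_covectors:
  fixes \<beta> :: "nat \<Rightarrow> complex ^ 'n::finite \<Rightarrow> complex"
  assumes lin: "\<And>j. j < k \<Longrightarrow> complex_linear (\<beta> j)"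
  shows "alternating_form k (wedge_covectors k \<beta>)"
  unfolding alternating_form_def
proof (intro conjI allI impI)
  fix v w :: "nat \<Rightarrow> complex ^ 'n" assume "\<forall>i<k. v i = w i"
  thus "wedge_covectors k \<beta> v = wedge_covectors k \<beta> w"
    unfolding wedge_covectors_def
    by (intro sum.cong refl arg_cong2[where f = "(*)"] prod.cong)
       (metis lessThan_iff mem_Collect_eq permutes_in_image)
next
  fix v :: "nat \<Rightarrow> complex ^ 'n" and i assume i: "i < k"
  have "(\<Prod>j<k. \<beta> j ((v(i := x)) (\<sigma> j))) =
      (\<Prod>j\<in>{..<k} - {inv \<sigma> i}. \<beta> j (v (\<sigma> j))) * \<beta> (inv \<sigma> i) x" if s: "\<sigma> permutes {..<k}" for \<sigma> x
  proof -
    have "inv \<sigma> i < k" using s i by (metis lessThan_iff permutes_in_image permutes_inv)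
    moreover have "\<sigma> (inv \<sigma> i) = i" using s by (simp add: permutes_inverses)
    moreover have "\<sigma> j \<noteq> i" if "j \<noteq> inv \<sigma> i" for j using s that by (metis permutes_inverses(2))
    ultimately show ?thesis
      by (subst prod.remove[of _ "inv \<sigma> i"]) (auto intro!: prod.cong simp: mult.commute)
  qed
  hence "wedge_covectors k \<beta> (v(i := x)) =
     (\<Sum>\<sigma> | \<sigma> permutes {..<k}. (of_int (sign \<sigma>) * (\<Prod>j\<in>{..<k} - {inv \<sigma> i}. \<beta> j (v (\<sigma> j)))) * \<beta> (inv \<sigma> i) x)" for x
    unfolding wedge_covectors_def by (intro sum.cong) auto
  moreover have "complex_linear (\<lambda>x. \<Sum>\<sigma> | \<sigma> permutes {..<k}.
      (of_int (sign \<sigma>) * (\<Prod>j\<in>{..<k} - {inv \<sigma> i}. \<beta> j (v (\<sigma> j)))) * \<beta> (inv \<sigma> i) x)"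
  proof (rule complex_linear_sum)
    fix \<sigma> assume "\<sigma> \<in> {\<sigma>. \<sigma> permutes {..<k}}"
    hence "inv \<sigma> i < k" using i by (metis lessThan_iff mem_Collect_eq permutes_in_image permutes_inv)
    thus "complex_linear (\<beta> (inv \<sigma> i))" by (rule lin)
  qed
  ultimately show "complex_linear (\<lambda>x. wedge_covectors k \<beta> (v(i := x)))" by simp
next
  fix v :: "nat \<Rightarrow> complex ^ 'n" and i j assume "i < k" "j < k" "i \<noteq> j" "v i = v j"
  thus "wedge_covectors k \<beta> v = 0"
    unfolding wedge_covectors_eq_pdet
    by (subst pdet_transpose[symmetric]) (auto intro: pdet_identical_rows)
qed

lemma alternating_form_linear:
  assumes "alternating_form k \<phi>" "i < k"
  shows "complex_linear (\<lambda>x. \<phi> (v(i := x)))"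
  using assms by (auto simp: alternating_form_def)

lemma alternating_form_zero:
  assumes "alternating_form k \<phi>" "i < k" "j < k" "i \<noteq> j" "v i = v j"
  shows "\<phi> v = 0"
  using assms unfolding alternating_form_def by blast

lemma alternating_form_cong:
  assumes "alternating_form k \<phi>" "\<forall>i<k. v i = w i"
  shows "\<phi> v = \<phi> w"
proof -
  have "\<forall>v w. (\<forall>i<k. v i = w i) \<longrightarrow> \<phi> v = \<phi> w"
    using assms(1) unfolding alternating_form_def by (rule conjunct1)
  thus ?thesis using assms(2) by blast
qed

text \<open>
  Contraction inserts its vector in the first slot. Moving it to another slot only changes the
  sign, which is irrelevant for vanishing.
\<close>

lemma alternating_form_contract_slot:
  fixes \<phi> :: "'n::finite form"
  assumes alt: "alternating_form k \<phi>" and c: "contract u \<phi> = (\<lambda>v. 0)" and l: "l < k"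
  shows "\<phi> (v(l := u)) = 0"
proof -
  have zero: "\<phi> w = 0" if "w 0 = u" for w
  proof -
    have "case_nat u (\<lambda>i. w (Suc i)) = w" using that by (auto simp: fun_eq_iff split: nat.splits)
    thus ?thesis using fun_cong[OF c, of "\<lambda>i. w (Suc i)"] by (simp add: contract_def)
  qed
  show ?thesis
  proof (cases "l = 0")
    case True
    thus ?thesis by (intro zero) auto
  next
    case False
    define w where "w x y = (v(l := x))(0 := y)" for x y
    have l1: "complex_linear (\<lambda>x. \<phi> (w x y))" for y
    proof -
      have "w x y = (v(0 := y))(l := x)" for x using False by (auto simp: w_def fun_eq_iff)
      thus ?thesis using alternating_form_linear[OF alt l] by simp
    qed
    have l2: "complex_linear (\<lambda>y. \<phi> (w x y))" for x
      using alternating_form_linear[OF alt, of 0] l by (simp add: w_def)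
    have z: "\<phi> (w x x) = 0" for x
      using alternating_form_zero[OF alt l, of 0] False l by (simp add: w_def)
    let ?a = "v 0"
    have "0 = \<phi> (w (u + ?a) (u + ?a))" using z by simp
    also have "\<dots> = \<phi> (w u u) + \<phi> (w ?a u) + (\<phi> (w u ?a) + \<phi> (w ?a ?a))"
      by (simp add: complex_linear_simps(1)[OF l1] complex_linear_simps(1)[OF l2])
    also have "\<dots> = \<phi> (w u ?a)" using z zero[of "w ?a u"] by (simp add: w_def)
    also have "w u ?a = v(l := u)" using False by (auto simp: w_def fun_eq_iff)
    finally show ?thesis by (rule sym)
  qed
qed

section \<open>Polynomials as functions\<close>

abbreviation "keys \<equiv> Poly_Mapping.keys"
abbreviation "lookup \<equiv> Poly_Mapping.lookup"
abbreviation "single \<equiv> Poly_Mapping.single"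

definition mon_eval :: "('v \<Rightarrow>\<^sub>0 nat) \<Rightarrow> ('v \<Rightarrow> complex) \<Rightarrow> complex" where
  "mon_eval m x = (\<Prod>v\<in>keys m. x v ^ lookup m v)"

abbreviation Const :: "complex \<Rightarrow> 'v cpoly" where
  "Const c \<equiv> single 0 c"

abbreviation Var :: "'v \<Rightarrow> 'v cpoly" where
  "Var v \<equiv> single (single v 1) 1"

lemma mon_eval_superset:
  assumes "finite V" "keys m \<subseteq> V"
  shows "mon_eval m x = (\<Prod>v\<in>V. x v ^ lookup m v)"
  unfolding mon_eval_def using assms
  by (intro prod.mono_neutral_left) (auto simp: in_keys_iff)

lemma mon_eval_0 [simp]: "mon_eval 0 x = 1"
  by (simp add: mon_eval_def)

lemma mon_eval_single [simp]: "mon_eval (single v k) x = x v ^ k"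
  by (simp add: mon_eval_def)

lemma mon_eval_add: "mon_eval (m + m') x = mon_eval m x * mon_eval m' x"
proof -
  let ?V = "keys m \<union> keys m'"
  have "mon_eval (m + m') x = (\<Prod>v\<in>?V. x v ^ lookup (m + m') v)"
    using keys_add[of m m'] by (intro mon_eval_superset) auto
  also have "\<dots> = (\<Prod>v\<in>?V. x v ^ lookup m v) * (\<Prod>v\<in>?V. x v ^ lookup m' v)"
    by (simp add: lookup_add power_add prod.distrib)
  also have "\<dots> = mon_eval m x * mon_eval m' x"
    by (simp add: mon_eval_superset[of ?V m] mon_eval_superset[of ?V m'])
  finally show ?thesis .
qed

lemma mon_eval_sum: "mon_eval (\<Sum>i\<in>A. m i) x = (\<Prod>i\<in>A. mon_eval (m i) x)"
  by (induction A rule: infinite_finite_induct) (auto simp: mon_eval_add)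

lemma poly_eval_superset:
  assumes "finite M" "keys P \<subseteq> M"
  shows "poly_eval P x = (\<Sum>m\<in>M. lookup P m * mon_eval m x)"
  unfolding poly_eval_def mon_eval_def using assms
  by (intro sum.mono_neutral_left) (auto simp: in_keys_iff)

lemma poly_eval_0 [simp]: "poly_eval 0 x = 0"
  by (simp add: poly_eval_def)

lemma poly_eval_single [simp]: "poly_eval (single m c) x = c * mon_eval m x"
  by (subst poly_eval_superset[of "{m}"]) auto

lemma poly_eval_add [simp]: "poly_eval (P + Q) x = poly_eval P x + poly_eval Q x"
proof -
  let ?M = "keys P \<union> keys Q"
  have "poly_eval (P + Q) x = (\<Sum>m\<in>?M. lookup (P + Q) m * mon_eval m x)"
    using keys_add[of P Q] by (intro poly_eval_superset) auto
  thus ?thesis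
    by (simp add: poly_eval_superset[of ?M P] poly_eval_superset[of ?M Q] lookup_add
        algebra_simps sum.distrib)
qed

lemma poly_eval_sum [simp]: "poly_eval (\<Sum>i\<in>A. P i) x = (\<Sum>i\<in>A. poly_eval (P i) x)"
  by (induction A rule: infinite_finite_induct) auto

lemma poly_mapping_sum_singles:
  "P = (\<Sum>m\<in>keys P. single m (lookup P m))"
proof (rule poly_mapping_eqI)
  fix k
  show "lookup P k =
      lookup (\<Sum>m\<in>keys P. single m (lookup P m)) k"
    by (auto simp: lookup_sum lookup_single when_def in_keys_iff)
qed

lemma poly_eval_mult [simp]: "poly_eval (P * Q) x = poly_eval P x * poly_eval Q x"
proof -
  let ?s = "\<lambda>P::'a cpoly. \<Sum>m\<in>keys P. single m (lookup P m)"
  have "poly_eval (P * Q) x = poly_eval (?s P * ?s Q) x"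
    using poly_mapping_sum_singles[of P] poly_mapping_sum_singles[of Q] by simp
  also have "\<dots> = poly_eval (?s P) x * poly_eval (?s Q) x"
    by (simp add: sum_product mult_single mon_eval_add mult_ac)
  also have "\<dots> = poly_eval P x * poly_eval Q x"
    using poly_mapping_sum_singles[of P] poly_mapping_sum_singles[of Q] by simp
  finally show ?thesis .
qed

lemma poly_eval_1 [simp]: "poly_eval 1 x = 1"
  using poly_eval_single[of 0 1 x] by simp

lemma poly_fun_simps [simp]:
  "poly_fun 0 z = 0" "poly_fun 1 z = 1"
  "poly_fun (P + Q) z = poly_fun P z + poly_fun Q z"
  "poly_fun (P * Q) z = poly_fun P z * poly_fun Q z"
  "poly_fun (single m c) z = c * mon_eval m (\<lambda>i. z $ i)"
  "poly_fun (\<Sum>i\<in>A. R i) z = (\<Sum>i\<in>A. poly_fun (R i) z)"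
  by (simp_all add: poly_fun_def)

lemma poly_fun_power [simp]: "poly_fun (P ^ k) z = poly_fun P z ^ k"
  by (induction k) auto

lemma poly_fun_prod [simp]: "poly_fun (\<Prod>i\<in>A. R i) z = (\<Prod>i\<in>A. poly_fun (R i) z)"
  by (induction A rule: infinite_finite_induct) auto

lemma single_sum_prod:
  "single (\<Sum>i\<in>A. m i) (1::complex) = (\<Prod>i\<in>A. single (m i) 1)"
proof (induction A rule: infinite_finite_induct)
  case (insert a A)
  thus ?case using mult_single[of "m a" "1::complex" "\<Sum>i\<in>A. m i" 1] by simp
qed auto

lemma single_single_power: "single (single v k) 1 = Var v ^ k"
proof (induction k)
  case (Suc k)
  have "single (single v (Suc k)) 1
      = single (single v 1 + single v k) (1 * 1 :: complex)"
    by (simp flip: single_add)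
  also have "\<dots> = Var v * single (single v k) 1"
    by (rule mult_single[symmetric])
  finally show ?case using Suc by simp
qed auto

text \<open>
  Polynomials are generated as a ring by the constants and the variables.
\<close>

lemma cpoly_induct [case_names Const Var add mult]:
  fixes P :: "'v cpoly"
  assumes C: "\<And>c. Q (Const c)" and V: "\<And>v. Q (Var v)"
    and A: "\<And>P P'. Q P \<Longrightarrow> Q P' \<Longrightarrow> Q (P + P')" and M: "\<And>P P'. Q P \<Longrightarrow> Q P' \<Longrightarrow> Q (P * P')"
  shows "Q P"
proof -
  have one: "Q 1" using C[of 1] by simp
  have zero: "Q 0" using C[of 0] by simp
  have pow: "Q (R ^ k)" if "Q R" for R k by (induction k) (auto intro: one M that)
  have vark: "Q (single (single v k) 1)" for v k
    by (subst single_single_power) (rule pow[OF V])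
  have mon: "Q (single m 1)" for m
  proof -
    have "Q (\<Prod>v\<in>A. single (single v (lookup m v)) 1)" for A
      by (induction A rule: infinite_finite_induct) (auto intro: one M vark)
    thus ?thesis
      using single_sum_prod[of "\<lambda>v. single v (lookup m v)" "keys m"]
      by (subst poly_mapping_sum_singles) metis
  qed
  have "Q (single m c)" for m c
    using M[OF C[of c] mon[of m]] by (simp add: mult_single)
  hence "Q (\<Sum>m\<in>A. single m (lookup P m))" for A
    by (induction A rule: infinite_finite_induct) (auto intro: zero A)
  thus ?thesis by (subst poly_mapping_sum_singles)
qed

section \<open>Polynomial functions and their differentials\<close>

definition cpoly_function :: "(complex ^ 'n \<Rightarrow> complex) \<Rightarrow> bool" where
  "cpoly_function g \<longleftrightarrow> g \<in> range poly_fun"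

lemma cpoly_function_poly_fun [intro]: "cpoly_function (poly_fun P)"
  by (simp add: cpoly_function_def)

lemma cpoly_functionI: "(\<And>z. g z = poly_fun P z) \<Longrightarrow> cpoly_function g"
  by (auto simp: cpoly_function_def fun_eq_iff image_iff)

lemma cpoly_function_const [intro]: "cpoly_function (\<lambda>z. c)"
  by (rule cpoly_functionI[of _ "Const c"]) simp

lemma cpoly_function_add [intro]:
  "cpoly_function g \<Longrightarrow> cpoly_function h \<Longrightarrow> cpoly_function (\<lambda>z. g z + h z)"
proof -
  assume "cpoly_function g" "cpoly_function h"
  then obtain P Q where "g = poly_fun P" "h = poly_fun Q" by (auto simp: cpoly_function_def)
  thus ?thesis by (intro cpoly_functionI[of _ "P + Q"]) simp
qed

lemma cpoly_function_mult [intro]: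
  "cpoly_function g \<Longrightarrow> cpoly_function h \<Longrightarrow> cpoly_function (\<lambda>z. g z * h z)"
proof -
  assume "cpoly_function g" "cpoly_function h"
  then obtain P Q where "g = poly_fun P" "h = poly_fun Q" by (auto simp: cpoly_function_def)
  thus ?thesis by (intro cpoly_functionI[of _ "P * Q"]) simp
qed

lemma cpoly_function_sum [intro]:
  "(\<And>i. i \<in> A \<Longrightarrow> cpoly_function (g i)) \<Longrightarrow> cpoly_function (\<lambda>z. \<Sum>i\<in>A. g i z)"
  by (induction A rule: infinite_finite_induct) auto

lemma cpoly_function_prod [intro]:
  "(\<And>i. i \<in> A \<Longrightarrow> cpoly_function (g i)) \<Longrightarrow> cpoly_function (\<lambda>z. \<Prod>i\<in>A. g i z)"
  by (induction A rule: infinite_finite_induct) auto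

text \<open>
  The partial derivatives are again polynomials; only their existence matters, so they are built by
  induction along the ring operations.
\<close>

lemma poly_fun_has_partials:
  fixes P :: "'n::finite cpoly"
  shows "\<exists>Q. \<forall>z. (poly_fun P has_derivative (\<lambda>u. \<Sum>i\<in>UNIV. poly_fun (Q i) z * u $ i)) (at z)"
proof (induction P rule: cpoly_induct)
  case (Const c)
  show ?case
  proof (intro exI allI)
    fix z :: "complex ^ 'n"
    have "poly_fun (Const c) = (\<lambda>z :: complex ^ 'n. c)" by (auto simp: fun_eq_iff)
    thus "(poly_fun (Const c) has_derivative (\<lambda>u. \<Sum>i\<in>UNIV. poly_fun ((\<lambda>_. 0) i) z * u $ i)) (at z)"
      by simp
  qed
next
  case (Var v)
  show ?case
  proof (intro exI allI)
    fix z :: "complex ^ 'n"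
    have "poly_fun (Var v) = (\<lambda>z :: complex ^ 'n. z $ v)" by (auto simp: fun_eq_iff)
    moreover have "(\<lambda>u. \<Sum>i\<in>UNIV. poly_fun (if i = v then 1 else 0) z * u $ i) = (\<lambda>u. u $ v)"
      by (simp add: if_distrib[of "\<lambda>P. poly_fun P z"] if_distrib[of "\<lambda>c. c * _"] cong: if_cong)
    ultimately show "(poly_fun (Var v) has_derivative
        (\<lambda>u. \<Sum>i\<in>UNIV. poly_fun ((\<lambda>i. if i = v then 1 else 0) i) z * u $ i)) (at z)"
      by (simp add: bounded_linear.has_derivative[OF bounded_linear_vec_nth has_derivative_ident])
  qed
next
  case (add P P')
  then obtain Q Q' where
    "\<And>z. (poly_fun P has_derivative (\<lambda>u. \<Sum>i\<in>UNIV. poly_fun (Q i) z * u $ i)) (at z)"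
    "\<And>z. (poly_fun P' has_derivative (\<lambda>u. \<Sum>i\<in>UNIV. poly_fun (Q' i) z * u $ i)) (at z)" by blast
  hence "((\<lambda>z. poly_fun P z + poly_fun P' z) has_derivative
      (\<lambda>u. \<Sum>i\<in>UNIV. poly_fun (Q i + Q' i) z * u $ i)) (at z)" for z
    by (auto intro!: derivative_eq_intros simp: sum.distrib algebra_simps)
  moreover have "poly_fun (P + P') = (\<lambda>z. poly_fun P z + poly_fun P' z)" by (auto simp: fun_eq_iff)
  ultimately show ?case by (auto intro!: exI[of _ "\<lambda>i. Q i + Q' i"])
next
  case (mult P P')
  then obtain Q Q' where
    "\<And>z. (poly_fun P has_derivative (\<lambda>u. \<Sum>i\<in>UNIV. poly_fun (Q i) z * u $ i)) (at z)"
    "\<And>z. (poly_fun P' has_derivative (\<lambda>u. \<Sum>i\<in>UNIV. poly_fun (Q' i) z * u $ i)) (at z)" by blast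
  hence "((\<lambda>z. poly_fun P z * poly_fun P' z) has_derivative
      (\<lambda>u. \<Sum>i\<in>UNIV. poly_fun (P * Q' i + Q i * P') z * u $ i)) (at z)" for z
    by (auto intro!: derivative_eq_intros simp: sum.distrib sum_distrib_left sum_distrib_right algebra_simps)
  moreover have "poly_fun (P * P') = (\<lambda>z. poly_fun P z * poly_fun P' z)" by (auto simp: fun_eq_iff)
  ultimately show ?case by (auto intro!: exI[of _ "\<lambda>i. P * Q' i + Q i * P'"])
qed

lemma poly_fun_derivative:
  fixes P :: "'n::finite cpoly"
  shows "(poly_fun P has_derivative differential (poly_fun P) z) (at z)"
    and "complex_linear (differential (poly_fun P) z)"
    and "cpoly_function (\<lambda>z. differential (poly_fun P) z u)"
proof -
  obtain Q where Q: "\<And>z. (poly_fun P has_derivative (\<lambda>u. \<Sum>i\<in>UNIV. poly_fun (Q i) z * u $ i)) (at z)"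
    using poly_fun_has_partials by blast
  hence d: "differential (poly_fun P) z = (\<lambda>u. \<Sum>i\<in>UNIV. poly_fun (Q i) z * u $ i)" for z
    using frechet_derivative_at[OF Q[of z]] by simp
  show "(poly_fun P has_derivative differential (poly_fun P) z) (at z)"
    unfolding d by (rule Q)
  show "complex_linear (differential (poly_fun P) z)"
    unfolding d complex_linear_iff by (simp add: sum.distrib sum_distrib_left algebra_simps)
  show "cpoly_function (\<lambda>z. differential (poly_fun P) z u)"
    unfolding d by (intro cpoly_function_sum cpoly_function_mult cpoly_function_const) auto
qed

lemma isCont_cpoly_function:
  assumes "cpoly_function (g :: complex ^ 'n::finite \<Rightarrow> complex)"
  shows "isCont g z"
  using assms has_derivative_continuous[OF poly_fun_derivative(1)]
  by (auto simp: cpoly_function_def)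

lemma holomorphic_fun_poly_fun: "holomorphic_fun U (poly_fun P)"
  unfolding holomorphic_fun_def using poly_fun_derivative by blast

text \<open>
  Restriction to a line reduces questions on zeros to one variable.
\<close>

lemma cpoly_function_on_line:
  fixes P :: "'n::finite cpoly"
  shows "\<exists>q. \<forall>s. poly_fun P (z + s *s a) = poly q s"
proof (induction P rule: cpoly_induct)
  case (Const c)
  show ?case by (intro exI[of _ "[:c:]"]) simp
next
  case (Var v)
  show ?case by (intro exI[of _ "[:z $ v, a $ v:]"]) simp
next
  case (add P P')
  thus ?case by (metis poly_fun_simps(3) poly_add)
next
  case (mult P P')
  thus ?case by (metis poly_fun_simps(4) poly_mult)
qed

section \<open>Homogeneous polynomials\<close>

lemma monom_degree_superset:
  assumes "finite V" "keys m \<subseteq> V"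
  shows "monom_degree m = (\<Sum>v\<in>V. lookup m v)"
  unfolding monom_degree_def using assms
  by (intro sum.mono_neutral_left) (auto simp: in_keys_iff)

lemma monom_degree_0 [simp]: "monom_degree 0 = 0"
  by (simp add: monom_degree_def)

lemma monom_degree_single [simp]: "monom_degree (single v k) = k"
  by (simp add: monom_degree_def)

lemma monom_degree_add: "monom_degree (m + m') = monom_degree m + monom_degree m'"
proof -
  let ?V = "keys m \<union> keys m'"
  have "monom_degree (m + m') = (\<Sum>v\<in>?V. lookup (m + m') v)"
    using keys_add[of m m'] by (intro monom_degree_superset) auto
  thus ?thesis
    by (simp add: monom_degree_superset[of ?V m] monom_degree_superset[of ?V m'] lookup_add sum.distrib)
qed

lemma monom_degree_sum: "monom_degree (\<Sum>i\<in>A. m i) = (\<Sum>i\<in>A. monom_degree (m i))"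
  by (induction A rule: infinite_finite_induct) (auto simp: monom_degree_add)

lemma homogeneous_of_degree_mult:
  assumes "homogeneous_of_degree d P" "homogeneous_of_degree e Q"
  shows "homogeneous_of_degree (d + e) (P * Q)"
  using assms keys_mult[of P Q] unfolding homogeneous_of_degree_def
  by (fastforce simp: monom_degree_add)

lemma homogeneous_of_degree_one: "homogeneous_of_degree 0 1"
  by (simp add: homogeneous_of_degree_def)

lemma homogeneous_of_degree_power:
  assumes "homogeneous_of_degree d P"
  shows "homogeneous_of_degree (k * d) (P ^ k)"
  by (induction k) (auto intro: homogeneous_of_degree_one homogeneous_of_degree_mult assms)

lemma homogeneous_of_degree_prod:
  assumes "\<And>i. i \<in> A \<Longrightarrow> homogeneous_of_degree (d i) (P i)"
  shows "homogeneous_of_degree (\<Sum>i\<in>A. d i) (\<Prod>i\<in>A. P i)"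
  using assms
  by (induction A rule: infinite_finite_induct)
     (auto intro: homogeneous_of_degree_one homogeneous_of_degree_mult)

lemma homogeneous_of_degree_Var: "homogeneous_of_degree 1 (Var v)"
  by (simp add: homogeneous_of_degree_def)

lemma mon_eval_scale: "mon_eval m (\<lambda>i. t * x i) = t ^ monom_degree m * mon_eval m x"
  by (simp add: mon_eval_def monom_degree_def power_mult_distrib prod.distrib power_sum)

definition hom_component :: "nat \<Rightarrow> 'v cpoly \<Rightarrow> 'v cpoly" where
  "hom_component d P = (\<Sum>m | m \<in> keys P \<and> monom_degree m = d.
     single m (lookup P m))"

lemma homogeneous_hom_component: "homogeneous_of_degree d (hom_component d P)"
proof -
  let ?M = "{m. m \<in> keys P \<and> monom_degree m = d}"
  have "keys (hom_component d P) \<subseteq>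
      (\<Union>m\<in>?M. keys (single m (lookup P m)))"
    unfolding hom_component_def by (rule keys_sum)
  thus ?thesis unfolding homogeneous_of_degree_def by (auto split: if_splits)
qed

text \<open>
  The polynomial \<open>t \<mapsto> P (t z)\<close>: it turns statements about homogeneous components on a cone into
  statements about coefficients.
\<close>

definition ray :: "'n cpoly \<Rightarrow> complex ^ 'n \<Rightarrow> complex poly" where
  "ray P z = (\<Sum>m\<in>keys P.
     monom (lookup P m * mon_eval m (\<lambda>i. z $ i)) (monom_degree m))"

lemma poly_ray: "poly (ray P z) t = poly_fun P (t *s z)"
  by (simp add: ray_def poly_sum poly_monom poly_fun_def poly_eval_superset[of "keys P" P]
      mon_eval_scale mult_ac)

lemma coeff_ray: "coeff (ray P z) d = poly_fun (hom_component d P) z"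
proof -
  have "coeff (ray P z) d = (\<Sum>m\<in>keys P. if monom_degree m = d
      then lookup P m * mon_eval m (\<lambda>i. z $ i) else 0)"
    by (auto simp: ray_def coeff_sum intro!: sum.cong)
  also have "\<dots> = (\<Sum>m | m \<in> keys P \<and> monom_degree m = d.
      lookup P m * mon_eval m (\<lambda>i. z $ i))"
    by (subst sum.inter_filter[symmetric]) auto
  finally show ?thesis by (simp add: hom_component_def)
qed

lemma ray_homogeneous:
  assumes "homogeneous_of_degree d P"
  shows "ray P z = monom (poly_fun P z) d"
proof -
  have "ray P z = (\<Sum>m\<in>keys P. monom (lookup P m * mon_eval m (\<lambda>i. z $ i)) d)"
    using assms by (auto simp: ray_def homogeneous_of_degree_def intro!: sum.cong)
  also have "\<dots> = monom (poly_fun P z) d"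
    by (simp add: poly_fun_def poly_eval_superset[of "keys P" P] monom_sum)
  finally show ?thesis .
qed

lemma poly_fun_scale:
  assumes "homogeneous_of_degree d P"
  shows "poly_fun P (t *s z) = t ^ d * poly_fun P z"
  using poly_ray[of P z t] by (simp add: ray_homogeneous[OF assms] poly_monom mult.commute)

lemma poly_eqI_nonzero:
  fixes p q :: "complex poly"
  assumes "\<And>t. t \<noteq> 0 \<Longrightarrow> poly p t = poly q t"
  shows "p = q"
proof (rule ccontr)
  assume "p \<noteq> q"
  hence "finite {t. poly (p - q) t = 0}" by (intro poly_roots_finite) auto
  moreover have "UNIV - {0} \<subseteq> {t. poly (p - q) t = 0}" using assms by auto
  ultimately have "finite (UNIV - {0::complex})" by (rule finite_subset[rotated])
  thus False by (simp add: infinite_UNIV_char_0)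
qed

lemma bounded_linear_smult: "bounded_linear (\<lambda>s::complex. s *s (a :: complex ^ 'n::finite))"
  by (rule linear_conv_bounded_linear[THEN iffD1], rule linearI)
     (auto simp: vec_eq_iff algebra_simps)

lemma norm_smult: "norm (s *s a) = cmod s * norm a" for a :: "complex ^ 'n::finite"
  by (simp add: norm_vec_def L2_set_def norm_mult power_mult_distrib real_sqrt_mult
      flip: sum_distrib_left)

lemma has_derivative_along_line:
  fixes P :: "'n::finite cpoly"
  shows "((\<lambda>s. poly_fun P (z + s *s a)) has_field_derivative differential (poly_fun P) (z + s *s a) a) (at s)"
proof -
  have "((\<lambda>s. z + s *s a) has_derivative (\<lambda>s. s *s a)) (at s)"
    using has_derivative_add[OF has_derivative_const bounded_linear.has_derivative[OF bounded_linear_smult has_derivative_ident]]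
    by simp
  from has_derivative_compose[OF this poly_fun_derivative(1)]
  show ?thesis
    by (simp add: has_field_derivative_def complex_linear_simps[OF poly_fun_derivative(2)] mult.commute[of _ "differential _ _ _"])
qed

text \<open>Euler's identity: differentiate \<open>P (s z) = s ^ d P z\<close> at \<open>s = 1\<close>.\<close>

lemma differential_radial:
  fixes P :: "'n::finite cpoly"
  assumes "homogeneous_of_degree d P"
  shows "differential (poly_fun P) z z = of_nat d * poly_fun P z"
proof -
  have "((\<lambda>s. poly_fun P (0 + s *s z)) has_field_derivative differential (poly_fun P) z z) (at 1)"
    using has_derivative_along_line[of P 0 z 1] by simp
  moreover have "((\<lambda>s. poly_fun P (0 + s *s z)) has_field_derivative of_nat d * poly_fun P z) (at 1)"
    by (auto simp: poly_fun_scale[OF assms] intro!: derivative_eq_intros)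
  ultimately show ?thesis by (rule DERIV_unique)
qed

lemma differential_scale:
  fixes P :: "'n::finite cpoly"
  assumes "homogeneous_of_degree d P" "t \<noteq> 0"
  shows "t * differential (poly_fun P) (t *s z) u = t ^ d * differential (poly_fun P) z u"
proof -
  have "((\<lambda>s. poly_fun P (t *s z + s *s (t *s u))) has_field_derivative
      differential (poly_fun P) (t *s z) (t *s u)) (at 0)"
    using has_derivative_along_line[of P "t *s z" "t *s u" 0] by simp
  moreover have "((\<lambda>s. t ^ d * poly_fun P (z + s *s u)) has_field_derivative
      t ^ d * differential (poly_fun P) z u) (at 0)"
    using DERIV_cmult[OF has_derivative_along_line[of P z u 0]] by simp
  moreover have "poly_fun P (t *s z + s *s (t *s u)) = t ^ d * poly_fun P (z + s *s u)" for s
    by (subst poly_fun_scale[OF assms(1), symmetric])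
       (simp add: vector_add_ldistrib vector_smult_assoc mult.commute)
  ultimately have "differential (poly_fun P) (t *s z) (t *s u) = t ^ d * differential (poly_fun P) z u"
    by (auto intro: DERIV_unique)
  thus ?thesis by (simp add: complex_linear_simps[OF poly_fun_derivative(2)])
qed

abbreviation exponents :: "'j set \<Rightarrow> nat \<Rightarrow> ('j \<Rightarrow> nat) set" where
  "exponents A E \<equiv> \<Pi>\<^sub>E j\<in>A. {..<E}"

text \<open>
  A polynomial that vanishes as a function is zero. The induction splits off one variable and reads
  the sum as a polynomial in it.
\<close>

lemma monomials_independent:
  fixes c :: "('j \<Rightarrow> nat) \<Rightarrow> complex"
  assumes "finite A" "\<And>x. (\<Sum>a\<in>exponents A E. c a * (\<Prod>j\<in>A. x j ^ a j)) = 0"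
    and "a \<in> exponents A E"
  shows "c a = 0"
  using assms
proof (induction A arbitrary: c a rule: finite_induct)
  case empty
  thus ?case by auto
next
  case (insert l A)
  let ?S = "exponents A E"
  have inj: "inj_on (\<lambda>(y, g). g(l := y)) ({..<E} \<times> ?S)"
    using insert.hyps(2) by (rule inj_combinator)
  have split: "(\<Sum>a\<in>exponents (insert l A) E. h a) = (\<Sum>y<E. \<Sum>g\<in>?S. h (g(l := y)))" for h :: "_ \<Rightarrow> complex"
    unfolding PiE_insert_eq by (subst sum.reindex[OF inj]) (simp add: sum.cartesian_product case_prod_unfold)
  have ins: "(\<Prod>j\<in>insert l A. x j ^ (g(l := y)) j) = x l ^ y * (\<Prod>j\<in>A. x j ^ g j)" for x :: "'j \<Rightarrow> complex" and g y
    using insert.hyps by (simp add: prod.insert) (intro disjI2 prod.cong, auto)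
  have *: "(\<Sum>g\<in>?S. c (g(l := y)) * (\<Prod>j\<in>A. x j ^ g j)) = 0" if "y < E" for x y
  proof -
    define q where "q = (\<Sum>y<E. monom (\<Sum>g\<in>?S. c (g(l := y)) * (\<Prod>j\<in>A. x j ^ g j)) y)"
    have "poly q t = 0" for t
    proof -
      have "0 = (\<Sum>y<E. \<Sum>g\<in>?S. c (g(l := y)) * (\<Prod>j\<in>insert l A. (x(l := t)) j ^ (g(l := y)) j))"
        using insert.prems(1)[of "x(l := t)"] unfolding split by simp
      also have "\<dots> = (\<Sum>y<E. \<Sum>g\<in>?S. c (g(l := y)) * (t ^ y * (\<Prod>j\<in>A. x j ^ g j)))"
      proof (intro sum.cong refl)
        fix y g
        have "(\<Prod>j\<in>A. (x(l := t)) j ^ g j) = (\<Prod>j\<in>A. x j ^ g j)"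
          using insert.hyps by (intro prod.cong) auto
        thus "c (g(l := y)) * (\<Prod>j\<in>insert l A. (x(l := t)) j ^ (g(l := y)) j) =
            c (g(l := y)) * (t ^ y * (\<Prod>j\<in>A. x j ^ g j))"
          by (simp only: ins fun_upd_same)
      qed
      also have "\<dots> = poly q t"
        by (simp add: q_def poly_sum poly_monom sum_distrib_left mult_ac)
      finally show ?thesis by simp
    qed
    hence "q = 0" using poly_eqI_nonzero[of q 0] by simp
    hence "coeff q y = 0" by simp
    moreover have "coeff q y = (\<Sum>g\<in>?S. c (g(l := y)) * (\<Prod>j\<in>A. x j ^ g j))"
      using that by (simp add: q_def coeff_sum)
    ultimately show ?thesis by simp
  qed
  obtain y g where a: "a = g(l := y)" "y < E" "g \<in> ?S"
    using insert.prems(2) unfolding PiE_insert_eq by auto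
  have "c (g(l := y)) = 0"
    by (rule insert.IH[of "\<lambda>g. c (g(l := y))" g]) (use * a in auto)
  thus ?case using a(1) by (simp only:)
qed

section \<open>Hilbert's Nullstellensatz over the complex numbers\<close>

definition ring_ideal :: "'a::comm_ring_1 set \<Rightarrow> bool" where
  "ring_ideal I \<longleftrightarrow> 0 \<in> I \<and> (\<forall>x\<in>I. \<forall>y\<in>I. x + y \<in> I) \<and> (\<forall>r. \<forall>x\<in>I. r * x \<in> I)"

lemma ring_idealD:
  assumes "ring_ideal I"
  shows "0 \<in> I" "x \<in> I \<Longrightarrow> y \<in> I \<Longrightarrow> x + y \<in> I" "x \<in> I \<Longrightarrow> r * x \<in> I" "x \<in> I \<Longrightarrow> x * r \<in> I"
    "x \<in> I \<Longrightarrow> y \<in> I \<Longrightarrow> x - y \<in> I"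
proof -
  show "x - y \<in> I" if "x \<in> I" "y \<in> I"
  proof -
    have "x + (- 1) * y \<in> I" using assms that unfolding ring_ideal_def by blast
    thus ?thesis by simp
  qed
qed (use assms in \<open>auto simp: ring_ideal_def mult.commute[of x]\<close>)

lemma ring_ideal_sum:
  assumes "ring_ideal I" "\<And>a. a \<in> A \<Longrightarrow> g a \<in> I"
  shows "(\<Sum>a\<in>A. g a) \<in> I"
  using assms(2) by (induction A rule: infinite_finite_induct) (auto intro: ring_idealD[OF assms(1)])

text \<open>
  An ideal maximal among those avoiding the powers of \<open>s\<close> is prime, and modulo it every element outside
  divides a power of \<open>s\<close>: after inverting \<open>s\<close> the quotient is a field.
\<close>

lemma prime_ideal_avoiding_powers:
  fixes I :: "'a::comm_ring_1 set"
  assumes I: "ring_ideal I" and s: "\<And>k. s ^ k \<notin> I"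
  shows "\<exists>P. ring_ideal P \<and> I \<subseteq> P \<and> (\<forall>k. s ^ k \<notin> P) \<and>
    (\<forall>x. x \<notin> P \<longrightarrow> (\<exists>k r. s ^ k - r * x \<in> P)) \<and> (\<forall>x y. x * y \<in> P \<longrightarrow> x \<in> P \<or> y \<in> P)"
proof -
  define \<A> where "\<A> = {J. ring_ideal J \<and> I \<subseteq> J \<and> (\<forall>k. s ^ k \<notin> J)}"
  have "\<exists>P\<in>\<A>. \<forall>X\<in>\<A>. P \<subseteq> X \<longrightarrow> X = P"
  proof (rule subset_Zorn_nonempty)
    show "\<A> \<noteq> {}" using I s by (auto simp: \<A>_def)
  next
    fix \<C> assume ne: "\<C> \<noteq> {}" and ch: "subset.chain \<A> \<C>"
    have sub: "\<C> \<subseteq> \<A>" and lin: "\<And>X Y. X \<in> \<C> \<Longrightarrow> Y \<in> \<C> \<Longrightarrow> X \<subseteq> Y \<or> Y \<subseteq> X"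
      using ch by (auto simp: subset.chain_def)
    have id: "ring_ideal X" if "X \<in> \<C>" for X using sub that by (auto simp: \<A>_def)
    have "ring_ideal (\<Union>\<C>)"
      unfolding ring_ideal_def
    proof (intro conjI ballI allI)
      show "0 \<in> \<Union>\<C>" using ne id ring_idealD(1) by blast
      show "r * x \<in> \<Union>\<C>" if "x \<in> \<Union>\<C>" for r x using that id ring_idealD(3) by blast
      show "x + y \<in> \<Union>\<C>" if "x \<in> \<Union>\<C>" "y \<in> \<Union>\<C>" for x y
      proof -
        from that obtain X Y where "X \<in> \<C>" "x \<in> X" "Y \<in> \<C>" "y \<in> Y" by blast
        with lin obtain Z where "Z \<in> \<C>" "x \<in> Z" "y \<in> Z" by blast
        thus ?thesis using id ring_idealD(2) by blast
      qed
    qed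
    thus "\<Union>\<C> \<in> \<A>" using ne sub by (auto simp: \<A>_def)
  qed
  then obtain P where P: "P \<in> \<A>" and max: "\<And>X. X \<in> \<A> \<Longrightarrow> P \<subseteq> X \<Longrightarrow> X = P" by blast
  have id: "ring_ideal P" and IP: "I \<subseteq> P" and sP: "\<And>k. s ^ k \<notin> P" using P by (auto simp: \<A>_def)
  note D = ring_idealD[OF id]
  have unit: "\<exists>k r. s ^ k - r * x \<in> P" if x: "x \<notin> P" for x
  proof -
    define J where "J = {p + r * x | p r. p \<in> P}"
    have mem: "p + r * x \<in> J" if "p \<in> P" for p r using that by (auto simp: J_def)
    have "ring_ideal J"
      unfolding ring_ideal_def
    proof (intro conjI ballI allI)
      show "0 \<in> J" using mem[OF D(1), of 0] by simp
      fix a assume "a \<in> J"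
      then obtain p r where a: "a = p + r * x" "p \<in> P" by (auto simp: J_def)
      show "q * a \<in> J" for q using mem[OF D(3)[OF a(2)], of q "q * r"] by (simp add: a algebra_simps)
      fix b assume "b \<in> J"
      then obtain p' r' where b: "b = p' + r' * x" "p' \<in> P" by (auto simp: J_def)
      show "a + b \<in> J" using mem[OF D(2)[OF a(2) b(2)], of "r + r'"] by (simp add: a b algebra_simps)
    qed
    moreover have PJ: "P \<subseteq> J" using mem[of _ 0] by auto
    moreover have "x \<in> J" using mem[OF D(1), of 1] by simp
    ultimately have "J \<notin> \<A>" using max[of J] x by auto
    then obtain k where "s ^ k \<in> J" using \<open>ring_ideal J\<close> PJ IP by (auto simp: \<A>_def)
    then obtain p r where "s ^ k = p + r * x" "p \<in> P" by (auto simp: J_def)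
    hence "s ^ k - r * x \<in> P" by simp
    thus ?thesis by blast
  qed
  have "x \<in> P \<or> y \<in> P" if xy: "x * y \<in> P" for x y
  proof (rule ccontr)
    assume "\<not> ?thesis"
    with unit obtain k r l q where k: "s ^ k - r * x \<in> P" and l: "s ^ l - q * y \<in> P" by metis
    have "(s ^ k - r * x) * s ^ l + (r * x) * (s ^ l - q * y) + (r * q) * (x * y) \<in> P"
      by (intro D(2) D(4)[OF k] D(3)[OF l] D(3)[OF xy])
    also have "(s ^ k - r * x) * s ^ l + (r * x) * (s ^ l - q * y) + (r * q) * (x * y) = s ^ (k + l)"
      by (simp add: power_add algebra_simps)
    finally show False using sP by blast
  qed
  thus ?thesis using id IP sP unit by blast
qed

text \<open>
  Let \<open>P\<close> be the prime ideal of the previous lemma. If an element \<open>t\<close> were congruent to no constant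
  modulo \<open>P\<close>, each \<open>t - c a\<close> would divide a power of \<open>s\<close> modulo \<open>P\<close>. There are uncountably many
  \<open>a\<close>, so infinitely many of the cofactors belong to the same power of \<open>s\<close> and to the same
  finite-dimensional piece of the ring, and finitely many of these satisfy a linear relation.
  Clearing denominators turns it into a polynomial equation for \<open>t\<close> modulo \<open>P\<close>; as the complex
  numbers are algebraically closed and \<open>P\<close> is prime, \<open>t\<close> is congruent to a root after all.
\<close>

lemma countable_dimension_nullstellensatz:
  fixes c :: "complex \<Rightarrow> 'a::comm_ring_1" and B :: "nat \<Rightarrow> 'a set"
  assumes c_add: "\<And>a b. c (a + b) = c a + c b" and c_mult: "\<And>a b. c (a * b) = c a * c b"
    and c_1: "c 1 = 1"
    and B: "\<And>D. finite (B D)" "\<And>x. \<exists>D y. x = (\<Sum>b\<in>B D. c (y b) * b)"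
    and I: "ring_ideal I" and s: "\<And>k. s ^ k \<notin> I"
  shows "\<exists>\<phi>. (\<forall>x y. \<phi> (x + y) = \<phi> x + \<phi> y) \<and> (\<forall>x y. \<phi> (x * y) = \<phi> x * \<phi> y) \<and>
    (\<forall>a. \<phi> (c a) = a) \<and> (\<forall>x\<in>I. \<phi> x = 0) \<and> \<phi> s \<noteq> (0::complex)"
proof -
  have c_0: "c 0 = 0" using c_add[of 0 0] by simp
  have c_minus: "c (- a) = - c a" for a using c_add[of a "- a"] c_0 by (simp add: eq_neg_iff_add_eq_0 add.commute)
  have c_diff: "c (a - b) = c a - c b" for a b using c_add[of a "- b"] c_minus by simp
  have c_sum: "c (\<Sum>i\<in>A. g i) = (\<Sum>i\<in>A. c (g i))" for g and A :: "complex set"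
    by (induction A rule: infinite_finite_induct) (auto simp: c_0 c_add)
  obtain P where P: "ring_ideal P" "I \<subseteq> P" "\<And>k. s ^ k \<notin> P"
    and unit: "\<And>x. x \<notin> P \<Longrightarrow> \<exists>k r. s ^ k - r * x \<in> P"
    and prime: "\<And>x y. x * y \<in> P \<Longrightarrow> x \<in> P \<or> y \<in> P"
    using prime_ideal_avoiding_powers[OF I s] by blast
  note D = ring_idealD[OF P(1)]
  have one: "1 \<notin> P" using P(3)[of 0] by simp
  have const: "a = 0" if "c a \<in> P" for a
  proof (rule ccontr)
    assume "a \<noteq> 0"
    hence "c (1 / a) * c a = 1" by (simp flip: c_mult add: c_1)
    thus False using D(3)[OF that, of "c (1 / a)"] one by simp
  qed
  have residue: "\<exists>a. t - c a \<in> P" for t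
  proof (rule ccontr)
    assume no: "\<nexists>a. t - c a \<in> P"
    hence "\<forall>a. \<exists>k r. s ^ k - r * (t - c a) \<in> P" using unit by blast
    then obtain kf rf where kr: "\<And>a. s ^ kf a - rf a * (t - c a) \<in> P" by metis
    have "\<forall>a. \<exists>D y. rf a = (\<Sum>b\<in>B D. c (y b) * b)" using B(2) by blast
    then obtain Df yf where Dy: "\<And>a. rf a = (\<Sum>b\<in>B (Df a). c (yf a b) * b)" by metis
    have "\<exists>k D. infinite {a. kf a = k \<and> Df a = D}"
    proof (rule ccontr)
      assume "\<not> ?thesis"
      hence "countable (\<Union>k. \<Union>D. {a. kf a = k \<and> Df a = D})" by (intro countable_UN) (auto intro: countable_finite)
      moreover have "(\<Union>k. \<Union>D. {a. kf a = k \<and> Df a = D}) = UNIV" by auto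
      ultimately show False using uncountable_UNIV_complex by simp
    qed
    then obtain k D where inf: "infinite {a. kf a = k \<and> Df a = D}" by blast
    obtain A where A: "A \<subseteq> {a. kf a = k \<and> Df a = D}" "finite A" "card A = Suc (card (B D))"
      using infinite_arbitrarily_large[OF inf] by blast
    obtain w where w: "\<exists>a\<in>A. w a \<noteq> 0" "\<forall>b\<in>B D. (\<Sum>a\<in>A. yf a b * w a) = 0"
      using underdetermined_system[OF B(1)[of D] A(2), of "\<lambda>b a. yf a b"] A(3) by auto
    have rel: "(\<Sum>a\<in>A. c (w a) * rf a) = 0"
    proof -
      have "(\<Sum>a\<in>A. c (w a) * rf a) = (\<Sum>a\<in>A. \<Sum>b\<in>B D. c (yf a b * w a) * b)"
        using A(1) by (intro sum.cong) (auto simp: Dy sum_distrib_left c_mult mult_ac)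
      also have "\<dots> = (\<Sum>b\<in>B D. c (\<Sum>a\<in>A. yf a b * w a) * b)"
        by (subst sum.swap) (simp add: c_sum sum_distrib_right)
      finally show ?thesis using w(2) by (simp add: c_0)
    qed
    define \<pi> where "\<pi> a = (\<Prod>a'\<in>A - {a}. t - c a')" for a
    have "(\<Sum>a\<in>A. (c (w a) * \<pi> a) * (s ^ k - rf a * (t - c a))) \<in> P"
    proof (rule ring_ideal_sum[OF P(1)])
      fix a assume "a \<in> A"
      hence "s ^ k - rf a * (t - c a) \<in> P" using kr[of a] A(1) by auto
      thus "(c (w a) * \<pi> a) * (s ^ k - rf a * (t - c a)) \<in> P" by (rule D(3))
    qed
    also have "(\<Sum>a\<in>A. (c (w a) * \<pi> a) * (s ^ k - rf a * (t - c a)))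
        = s ^ k * (\<Sum>a\<in>A. c (w a) * \<pi> a) - (\<Sum>a\<in>A. c (w a) * rf a) * (\<Prod>a'\<in>A. t - c a')"
    proof -
      have "\<pi> a * (t - c a) = (\<Prod>a'\<in>A. t - c a')" if "a \<in> A" for a
        using A(2) that by (simp add: \<pi>_def prod.remove[of A a] mult.commute)
      hence "(\<Sum>a\<in>A. c (w a) * rf a * (\<pi> a * (t - c a))) = (\<Sum>a\<in>A. c (w a) * rf a) * (\<Prod>a'\<in>A. t - c a')"
        by (simp add: sum_distrib_right)
      thus ?thesis by (simp add: right_diff_distrib sum_subtractf sum_distrib_left mult_ac)
    qed
    finally have "s ^ k * (\<Sum>a\<in>A. c (w a) * \<pi> a) \<in> P" using rel by simp
    hence E: "(\<Sum>a\<in>A. c (w a) * \<pi> a) \<in> P" using prime P(3) by blast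
    define ev where "ev p = poly (map_poly c p) t" for p
    have ev_pCons: "ev (pCons a p) = c a + t * ev p" for a p
      by (simp add: ev_def map_poly_pCons c_0)
    have ev_0: "ev 0 = 0" by (simp add: ev_def)
    have ev_add: "ev (p + q) = ev p + ev q" for p q
      by (induction p q rule: poly_induct2) (auto simp: ev_0 ev_pCons c_add algebra_simps)
    have ev_smult: "ev (smult a p) = c a * ev p" for a p
      by (induction p) (auto simp: ev_0 ev_pCons c_mult algebra_simps)
    have ev_mult: "ev (p * q) = ev p * ev q" for p q
      by (induction p) (auto simp: ev_0 ev_pCons ev_add ev_smult c_0 algebra_simps)
    have ev_sum: "ev (\<Sum>a\<in>A. g a) = (\<Sum>a\<in>A. ev (g a))" for g and A :: "complex set"
      by (induction A rule: infinite_finite_induct) (auto simp: ev_0 ev_add)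
    have ev_prod: "ev (\<Prod>a\<in>A. g a) = (\<Prod>a\<in>A. ev (g a))" if "finite A" for g and A :: "complex set"
      using that by (induction A rule: finite_induct) (auto simp: ev_mult ev_pCons ev_0 c_1 one_pCons)
    have noroot: "ev p \<notin> P" if "p \<noteq> 0" for p
      using that
    proof (induction "degree p" arbitrary: p)
      case 0
      from "0.hyps"[symmetric] obtain a where p: "p = [:a:]" by (rule degree_eq_zeroE)
      thus ?case using const[of a] 0 by (auto simp: ev_pCons ev_0)
    next
      case (Suc d)
      have "0 < degree p" using Suc.hyps(2) by simp
      from alg_closed_imp_poly_has_root[OF this] obtain r where "poly p r = 0" by (rule exE)
      hence "[:- r, 1:] dvd p" by (simp add: poly_eq_0_iff_dvd)
      then obtain q where pq: "p = [:- r, 1:] * q" by (rule dvdE)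
      have q0: "q \<noteq> 0" using Suc.prems pq by auto
      hence "d = degree q" using Suc.hyps(2) unfolding pq by (subst (asm) degree_mult_eq) auto
      hence "ev q \<notin> P" using Suc.hyps(1) q0 by blast
      moreover have "ev p = (t - c r) * ev q" by (simp add: pq ev_mult ev_pCons ev_0 c_minus c_1 del: mult_pCons_left)
      ultimately show ?case using prime no by metis
    qed
    define Q where "Q = (\<Sum>a\<in>A. smult (w a) (\<Prod>a'\<in>A - {a}. [:- a', 1:]))"
    have "ev Q = (\<Sum>a\<in>A. c (w a) * \<pi> a)"
      using A(2) by (simp add: Q_def ev_sum ev_smult ev_prod \<pi>_def ev_pCons ev_0 c_minus c_1)
    moreover have "Q \<noteq> 0"
    proof -
      obtain a where a: "a \<in> A" "w a \<noteq> 0" using w(1) by blast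
      have "poly Q a = (\<Sum>b\<in>A. if b = a then w b * (\<Prod>a'\<in>A - {b}. a - a') else 0)"
        unfolding Q_def poly_sum
      proof (intro sum.cong refl)
        fix b assume b: "b \<in> A"
        show "poly (smult (w b) (\<Prod>a'\<in>A - {b}. [:- a', 1:])) a
            = (if b = a then w b * (\<Prod>a'\<in>A - {b}. a - a') else 0)"
          using A(2) a(1) by (auto simp: poly_prod)
      qed
      also have "\<dots> = w a * (\<Prod>a'\<in>A - {a}. a - a')" using A(2) a by simp
      also have "\<dots> \<noteq> 0" using A(2) a by auto
      finally show ?thesis by auto
    qed
    ultimately show False using noroot[of Q] E by simp
  qed
  then obtain \<phi> where \<phi>: "\<And>t. t - c (\<phi> t) \<in> P" by metis
  have uniq: "\<phi> t = a" if "t - c a \<in> P" for t a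
  proof -
    have "(t - c a) - (t - c (\<phi> t)) \<in> P" using D(5)[OF that \<phi>] .
    hence "c (\<phi> t - a) \<in> P" by (simp add: c_diff)
    hence "\<phi> t - a = 0" by (rule const)
    thus ?thesis by simp
  qed
  have "\<phi> (x + y) = \<phi> x + \<phi> y" for x y
    using D(2)[OF \<phi>[of x] \<phi>[of y]] by (intro uniq) (simp add: c_add algebra_simps)
  moreover have "\<phi> (x * y) = \<phi> x * \<phi> y" for x y
    using D(2)[OF D(4)[OF \<phi>[of x], of y] D(3)[OF \<phi>[of y], of "c (\<phi> x)"]]
    by (intro uniq) (simp add: c_mult algebra_simps)
  moreover have "\<phi> (c a) = a" for a using D(1) by (intro uniq) simp
  moreover have "\<phi> x = 0" if "x \<in> I" for x using that P(2) by (intro uniq) (auto simp: c_0)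
  moreover have "\<phi> s \<noteq> 0"
    using \<phi>[of s] P(3)[of 1] by (auto simp: c_0)
  ultimately show ?thesis by blast
qed

lemma finite_monomials_of_bounded_degree: "finite {m :: 'n::finite \<Rightarrow>\<^sub>0 nat. monom_degree m \<le> D}"
proof (rule finite_imageD)
  have "lookup m v \<le> monom_degree m" for m :: "'n \<Rightarrow>\<^sub>0 nat" and v
    by (subst monom_degree_superset[of UNIV]) (auto intro: member_le_sum)
  hence "lookup ` {m :: 'n \<Rightarrow>\<^sub>0 nat. monom_degree m \<le> D} \<subseteq> (\<Pi>\<^sub>E i\<in>UNIV. {..D})"
    by (auto intro: order_trans)
  thus "finite (lookup ` {m :: 'n \<Rightarrow>\<^sub>0 nat. monom_degree m \<le> D})"
    by (rule finite_subset) (auto intro: finite_PiE)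
  show "inj_on lookup {m :: 'n \<Rightarrow>\<^sub>0 nat. monom_degree m \<le> D}"
    by (intro inj_onI poly_mapping_eqI) (simp only:)
qed

lemma single_one_inject:
  "single m (1::complex) = single m' 1 \<longleftrightarrow> m = m'"
proof
  assume "single m (1::complex) = single m' 1"
  hence "lookup (single m (1::complex)) m = lookup (single m' 1) m"
    by (rule arg_cong)
  thus "m = m'" by (auto simp: lookup_single when_def split: if_splits)
qed auto

text \<open>
  A homomorphism to the complex numbers is the evaluation at the point formed by the images of the
  variables.
\<close>

theorem nullstellensatz:
  fixes I :: "'n::finite cpoly set"
  assumes I: "ring_ideal I"
    and zeros: "\<And>z. (\<And>P. P \<in> I \<Longrightarrow> poly_fun P z = 0) \<Longrightarrow> poly_fun S z = 0"
  shows "\<exists>k. S ^ k \<in> I"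
proof (rule ccontr)
  assume no: "\<nexists>k. S ^ k \<in> I"
  let ?B = "\<lambda>D. (\<lambda>m. single m (1::complex)) ` {m :: 'n \<Rightarrow>\<^sub>0 nat. monom_degree m \<le> D}"
  have span: "\<exists>D y. P = (\<Sum>b\<in>?B D. Const (y b) * b)" for P :: "'n cpoly"
  proof -
    define D where "D = Max (insert 0 (monom_degree ` keys P))"
    define y where "y b = lookup P (THE m. b = single m (1::complex))" for b
    have y: "y (single m 1) = lookup P m" for m
      by (simp add: y_def single_one_inject)
    have inj: "inj_on (\<lambda>m. single m (1::complex)) M" for M :: "('n \<Rightarrow>\<^sub>0 nat) set"
      by (simp add: inj_on_def single_one_inject)
    have "(\<Sum>b\<in>?B D. Const (y b) * b) = (\<Sum>m | monom_degree m \<le> D. single m (lookup P m))"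
      by (subst sum.reindex[OF inj]) (simp add: y mult_single)
    also have "\<dots> = (\<Sum>m\<in>keys P. single m (lookup P m))"
      by (intro sum.mono_neutral_right finite_monomials_of_bounded_degree)
         (auto simp: in_keys_iff D_def)
    also have "\<dots> = P" by (rule poly_mapping_sum_singles[symmetric])
    finally have "P = (\<Sum>b\<in>?B D. Const (y b) * b)" by (rule sym)
    thus ?thesis by (intro exI)
  qed
  have "\<exists>\<phi>. (\<forall>x y. \<phi> (x + y) = \<phi> x + \<phi> y) \<and> (\<forall>x y. \<phi> (x * y) = \<phi> x * \<phi> y) \<and>
    (\<forall>a. \<phi> (Const a) = a) \<and> (\<forall>x\<in>I. \<phi> x = 0) \<and> \<phi> S \<noteq> (0::complex)"
  proof (rule countable_dimension_nullstellensatz[where B = ?B, OF _ _ _ _ span I])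
    show "finite (?B D)" for D by (intro finite_imageI finite_monomials_of_bounded_degree)
    show "S ^ k \<notin> I" for k using no by blast
  qed (simp_all add: single_add mult_single)
  then obtain \<phi> :: "'n cpoly \<Rightarrow> complex" where \<phi>: "\<And>x y. \<phi> (x + y) = \<phi> x + \<phi> y" "\<And>x y. \<phi> (x * y) = \<phi> x * \<phi> y"
    "\<And>a. \<phi> (Const a) = a" "\<And>x. x \<in> I \<Longrightarrow> \<phi> x = 0" "\<phi> S \<noteq> 0" by blast
  define z where "z = (\<chi> i. \<phi> (Var i))"
  have "\<phi> P = poly_fun P z" for P
    by (induction P rule: cpoly_induct) (auto simp: \<phi> z_def)
  thus False using zeros[of z] \<phi>(4,5) by auto
qed

section \<open>Homogeneous relations by counting dimensions\<close>

definition span_on :: "('a \<Rightarrow> complex) set \<Rightarrow> 'a set \<Rightarrow> ('a \<Rightarrow> complex) set" where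
  "span_on T C = {g. \<exists>y. \<forall>z\<in>C. g z = (\<Sum>t\<in>T. y t * t z)}"

lemma span_on_base:
  assumes "finite T" "t \<in> T"
  shows "t \<in> span_on T C"
proof -
  have "t z = (\<Sum>t'\<in>T. (if t' = t then 1 else 0) * t' z)" for z
    using assms by (simp add: if_distrib[of "\<lambda>c. c * _"] cong: if_cong)
  thus ?thesis by (auto simp: span_on_def intro!: exI[of _ "\<lambda>t'. if t' = t then 1 else 0"])
qed

lemma span_on_cong:
  assumes "g \<in> span_on T C" "\<And>z. z \<in> C \<Longrightarrow> g' z = g z"
  shows "g' \<in> span_on T C"
  using assms by (simp add: span_on_def)

lemma span_on_combination:
  assumes "\<And>i. i \<in> S \<Longrightarrow> g i \<in> span_on T C"
  shows "(\<lambda>z. \<Sum>i\<in>S. c i * g i z) \<in> span_on T C"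
proof -
  from assms have "\<forall>i\<in>S. \<exists>y. \<forall>z\<in>C. g i z = (\<Sum>t\<in>T. y t * t z)" by (simp add: span_on_def)
  then obtain y where y: "\<And>i z. i \<in> S \<Longrightarrow> z \<in> C \<Longrightarrow> g i z = (\<Sum>t\<in>T. y i t * t z)" by metis
  have "(\<Sum>i\<in>S. c i * g i z) = (\<Sum>t\<in>T. (\<Sum>i\<in>S. c i * y i t) * t z)" if "z \<in> C" for z
  proof -
    have "(\<Sum>i\<in>S. c i * g i z) = (\<Sum>i\<in>S. \<Sum>t\<in>T. c i * y i t * t z)"
      using that by (simp add: y sum_distrib_left mult_ac)
    thus ?thesis by (subst (asm) sum.swap) (simp add: sum_distrib_right)
  qed
  thus ?thesis by (auto simp: span_on_def intro!: exI[of _ "\<lambda>t. \<Sum>i\<in>S. c i * y i t"])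
qed

lemma span_on_mult:
  assumes "g \<in> span_on T C" "\<And>t. t \<in> T \<Longrightarrow> (\<lambda>z. v z * t z) \<in> span_on T' C"
  shows "(\<lambda>z. v z * g z) \<in> span_on T' C"
proof -
  obtain y where y: "\<forall>z\<in>C. g z = (\<Sum>t\<in>T. y t * t z)" using assms(1) by (auto simp: span_on_def)
  have "(\<lambda>z. \<Sum>t\<in>T. y t * (v z * t z)) \<in> span_on T' C"
    using span_on_combination[of T "\<lambda>t z. v z * t z" T' C y] assms(2) by simp
  thus ?thesis
    by (rule span_on_cong) (use y in \<open>simp add: sum_distrib_left mult_ac\<close>)
qed

lemma span_on_mono:
  assumes "g \<in> span_on T C" "T \<subseteq> T'" "finite T'"
  shows "g \<in> span_on T' C"
  using span_on_mult[OF assms(1), of "\<lambda>_. 1" T'] assms(2,3) span_on_base[of T'] by auto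

text \<open>
  By the Nullstellensatz, the ideal generated by the \<open>u i\<close> and the polynomials vanishing on \<open>C\<close> contains
  a power of every variable, hence all monomials of large degree. The degrees of the cofactors are
  controlled by passing to homogeneous components, which is possible because \<open>C\<close> is a cone.
\<close>

lemma reduce_modulo_parameters:
  fixes C :: "(complex ^ 'n::finite) set" and u :: "'i \<Rightarrow> 'n cpoly"
  assumes cone: "\<And>z t. z \<in> C \<Longrightarrow> t \<noteq> 0 \<Longrightarrow> t *s z \<in> C"
    and closed: "\<And>z. z \<notin> C \<Longrightarrow> \<exists>Q. (\<forall>w\<in>C. poly_fun Q w = 0) \<and> poly_fun Q z \<noteq> 0"
    and A: "finite A" and hom: "\<And>i. i \<in> A \<Longrightarrow> homogeneous_of_degree \<delta> (u i)"
    and zeros: "\<And>z. z \<in> C \<Longrightarrow> (\<forall>i\<in>A. poly_fun (u i) z = 0) \<Longrightarrow> z = 0"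
  shows "\<exists>D\<ge>\<delta>. \<forall>d\<ge>D. \<forall>g. homogeneous_of_degree d g \<longrightarrow>
    (\<exists>h. (\<forall>i\<in>A. homogeneous_of_degree (d - \<delta>) (h i)) \<and>
         (\<forall>z\<in>C. poly_fun g z = (\<Sum>i\<in>A. poly_fun (u i) z * poly_fun (h i) z)))"
proof -
  define I where "I = {Q + (\<Sum>i\<in>A. u i * h i) | Q h. \<forall>z\<in>C. poly_fun Q z = 0}"
  have mem: "Q + (\<Sum>i\<in>A. u i * h i) \<in> I" if "\<forall>z\<in>C. poly_fun Q z = 0" for Q h
    using that by (auto simp: I_def)
  have I: "ring_ideal I"
    unfolding ring_ideal_def
  proof (intro conjI ballI allI)
    show "0 \<in> I" using mem[of 0 "\<lambda>_. 0"] by simp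
    fix P assume "P \<in> I"
    then obtain Q h where P: "P = Q + (\<Sum>i\<in>A. u i * h i)" "\<forall>z\<in>C. poly_fun Q z = 0" by (auto simp: I_def)
    show "r * P \<in> I" for r
      using mem[of "r * Q" "\<lambda>i. r * h i"] P(2)
      by (simp add: P(1) distrib_left sum_distrib_left mult.left_commute)
    fix P' assume "P' \<in> I"
    then obtain Q' h' where P': "P' = Q' + (\<Sum>i\<in>A. u i * h' i)" "\<forall>z\<in>C. poly_fun Q' z = 0" by (auto simp: I_def)
    show "P + P' \<in> I"
      using mem[of "Q + Q'" "\<lambda>i. h i + h' i"] P(2) P'(2)
      by (simp add: P(1) P'(1) distrib_left sum.distrib add_ac)
  qed
  have "\<exists>k. Var j ^ k \<in> I" for j
  proof (rule nullstellensatz[OF I])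
    fix z assume z: "\<And>P. P \<in> I \<Longrightarrow> poly_fun P z = 0"
    have "z \<in> C"
    proof (rule ccontr)
      assume "z \<notin> C"
      then obtain Q where "\<forall>w\<in>C. poly_fun Q w = 0" "poly_fun Q z \<noteq> 0" using closed by blast
      thus False using z[OF mem[of Q "\<lambda>_. 0"]] by simp
    qed
    moreover have "poly_fun (u i) z = 0" if "i \<in> A" for i
    proof -
      have "(\<Sum>j\<in>A. u j * (if j = i then 1 else 0)) = u i"
        using that A by (simp add: if_distrib[of "\<lambda>c. _ * c"] cong: if_cong)
      thus ?thesis using z[OF mem[of 0 "\<lambda>j. if j = i then 1 else 0"]] by simp
    qed
    ultimately have "z = 0" using zeros by blast
    thus "poly_fun (Var j) z = 0" by simp
  qed
  then obtain k where k: "\<And>j. Var j ^ k j \<in> I" by metis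
  define D where "D = \<delta> + (\<Sum>j\<in>UNIV. k j) + 1"
  have single: "single m 1 \<in> I" if m: "D \<le> monom_degree m" for m
  proof -
    have "\<exists>j. k j \<le> lookup m j"
    proof (rule ccontr)
      assume "\<not> ?thesis"
      hence "(\<Sum>j\<in>UNIV. lookup m j) \<le> (\<Sum>j\<in>UNIV. k j)"
        by (intro sum_mono) (simp add: not_le less_imp_le)
      thus False using m by (simp add: D_def monom_degree_superset[of UNIV m])
    qed
    then obtain j where j: "k j \<le> lookup m j" by blast
    have "m = (m - single j (k j)) + single j (k j)"
      using j by (intro poly_mapping_eqI) (auto simp: lookup_add lookup_minus lookup_single when_def)
    hence "single m (1::complex) =
        single (m - single j (k j)) 1 * single (single j (k j)) 1"
      by (simp add: mult_single)
    thus ?thesis using ring_idealD(3)[OF I k[of j]] by (simp add: single_single_power[of j "k j"])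
  qed
  have "\<exists>h. (\<forall>i\<in>A. homogeneous_of_degree (d - \<delta>) (h i)) \<and>
         (\<forall>z\<in>C. poly_fun g z = (\<Sum>i\<in>A. poly_fun (u i) z * poly_fun (h i) z))"
    if d: "D \<le> d" and g: "homogeneous_of_degree d g" for d g
  proof -
    have "(\<Sum>m\<in>keys g. Const (lookup g m) * single m 1) \<in> I"
      using d g by (intro ring_ideal_sum[OF I] ring_idealD(3)[OF I] single) (auto simp: homogeneous_of_degree_def)
    hence "g \<in> I" by (simp add: mult_single flip: poly_mapping_sum_singles)
    then obtain Q h where Qh: "g = Q + (\<Sum>i\<in>A. u i * h i)" "\<forall>z\<in>C. poly_fun Q z = 0" by (auto simp: I_def)
    have "poly_fun g z = (\<Sum>i\<in>A. poly_fun (u i) z * poly_fun (hom_component (d - \<delta>) (h i)) z)" if z: "z \<in> C" for z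
    proof -
      have "ray g z = (\<Sum>i\<in>A. monom (poly_fun (u i) z) \<delta> * ray (h i) z)"
      proof (rule poly_eqI_nonzero)
        fix t :: complex assume "t \<noteq> 0"
        hence "poly_fun Q (t *s z) = 0" using Qh(2) cone[OF z] by blast
        moreover have "(\<Sum>i\<in>A. poly_fun (u i) (t *s z) * poly_fun (h i) (t *s z))
            = (\<Sum>i\<in>A. poly_fun (u i) z * t ^ \<delta> * poly_fun (h i) (t *s z))"
          by (intro sum.cong refl) (simp add: poly_fun_scale[OF hom])
        ultimately show "poly (ray g z) t = poly (\<Sum>i\<in>A. monom (poly_fun (u i) z) \<delta> * ray (h i) z) t"
          by (simp add: poly_ray poly_sum poly_monom Qh(1))
      qed
      hence "coeff (ray g z) d = (\<Sum>i\<in>A. poly_fun (u i) z * coeff (ray (h i) z) (d - \<delta>))"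
        using d by (simp add: coeff_sum coeff_monom_mult D_def)
      thus ?thesis using ray_homogeneous[OF g, of z] by (simp add: coeff_ray)
    qed
    thus ?thesis by (intro exI[of _ "\<lambda>i. hom_component (d - \<delta>) (h i)"]) (auto simp: homogeneous_hom_component)
  qed
  thus ?thesis by (intro exI[of _ D]) (auto simp: D_def)
qed

text \<open>
  Reducing repeatedly modulo the \<open>u i\<close>, every homogeneous polynomial of degree \<open>d\<close> becomes on \<open>C\<close> a
  combination of products of finitely many monomials with monomials in the \<open>u i\<close> with exponents at
  most \<open>d\<close>. There are \<open>O(d ^ card A)\<close> of these. The monomials in the \<open>w j\<close> with exponents less
  than \<open>E\<close> number \<open>E ^ card A'\<close> and have degree \<open>O(E)\<close>, so for large \<open>E\<close> they are dependent on \<open>C\<close>.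
  Because \<open>C\<close> is a cone, the homogeneous components of a relation are relations.
\<close>

theorem homogeneous_relation:
  fixes C :: "(complex ^ 'n::finite) set" and u :: "'i \<Rightarrow> 'n cpoly" and w :: "'j \<Rightarrow> 'n cpoly"
  assumes cone: "\<And>z t. z \<in> C \<Longrightarrow> t \<noteq> 0 \<Longrightarrow> t *s z \<in> C"
    and closed: "\<And>z. z \<notin> C \<Longrightarrow> \<exists>Q. (\<forall>w\<in>C. poly_fun Q w = 0) \<and> poly_fun Q z \<noteq> 0"
    and A: "finite A" and hom: "\<And>i. i \<in> A \<Longrightarrow> homogeneous_of_degree \<delta> (u i)" and \<delta>: "0 < \<delta>"
    and zeros: "\<And>z. z \<in> C \<Longrightarrow> (\<forall>i\<in>A. poly_fun (u i) z = 0) \<Longrightarrow> z = 0"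
    and A': "finite A'" "card A < card A'"
    and hom': "\<And>j. j \<in> A' \<Longrightarrow> homogeneous_of_degree \<epsilon> (w j)" and \<epsilon>: "0 < \<epsilon>"
  shows "\<exists>E c e. (\<exists>a\<in>exponents A' E. c a \<noteq> 0) \<and>
    (\<forall>a\<in>exponents A' E. c a \<noteq> 0 \<longrightarrow> (\<Sum>j\<in>A'. a j) = e) \<and>
    (\<forall>z\<in>C. (\<Sum>a\<in>exponents A' E. c a * (\<Prod>j\<in>A'. poly_fun (w j) z ^ a j)) = 0)"
proof -
  have "\<exists>D\<ge>\<delta>. \<forall>d\<ge>D. \<forall>g. homogeneous_of_degree d g \<longrightarrow>
    (\<exists>h. (\<forall>i\<in>A. homogeneous_of_degree (d - \<delta>) (h i)) \<and>
         (\<forall>z\<in>C. poly_fun g z = (\<Sum>i\<in>A. poly_fun (u i) z * poly_fun (h i) z)))"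
    (is "\<exists>D\<ge>\<delta>. ?P D")
    by (rule reduce_modulo_parameters[OF cone closed A hom zeros])
  then obtain D where D: "\<delta> \<le> D" "?P D" by blast
  define M where "M = {m :: 'n \<Rightarrow>\<^sub>0 nat. monom_degree m \<le> D}"
  have M: "finite M" unfolding M_def by (rule finite_monomials_of_bounded_degree)
  define tf where "tf m \<alpha> z = mon_eval m (\<lambda>i. z $ i) * (\<Prod>i\<in>A. poly_fun (u i) z ^ \<alpha> i)" for m \<alpha> and z :: "complex ^ 'n"
  define T where "T d = (\<lambda>(m, \<alpha>). tf m \<alpha>) ` (M \<times> (\<Pi>\<^sub>E i\<in>A. {..d}))" for d
  have fT: "finite (T d)" for d unfolding T_def using M A by (auto intro: finite_PiE)
  have T_mono: "T d \<subseteq> T d'" if "d \<le> d'" for d d'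
    unfolding T_def using that by (intro image_mono Sigma_mono PiE_mono) auto
  have span: "poly_fun g \<in> span_on (T d) C" if "homogeneous_of_degree d g" for d g
    using that
  proof (induction d arbitrary: g rule: less_induct)
    case (less d)
    show ?case
    proof (cases "d < D")
      case True
      have "(\<lambda>z. \<Sum>m\<in>keys g. lookup g m * mon_eval m (\<lambda>i. z $ i)) \<in> span_on (T d) C"
      proof (rule span_on_combination)
        fix m assume "m \<in> keys g"
        hence "m \<in> M" using True less.prems by (auto simp: M_def homogeneous_of_degree_def)
        hence "tf m (restrict (\<lambda>_. 0) A) \<in> T d" by (auto simp: T_def)
        moreover have "tf m (restrict (\<lambda>_. 0) A) = (\<lambda>z. mon_eval m (\<lambda>i. z $ i))"
          by (auto simp: tf_def fun_eq_iff)
        ultimately show "(\<lambda>z. mon_eval m (\<lambda>i. z $ i)) \<in> span_on (T d) C"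
          using span_on_base[OF fT] by metis
      qed
      thus ?thesis
        by (rule span_on_cong) (simp add: poly_fun_def poly_eval_superset[of "keys g" g])
    next
      case False
      then obtain h where h: "\<forall>i\<in>A. homogeneous_of_degree (d - \<delta>) (h i)"
         "\<forall>z\<in>C. poly_fun g z = (\<Sum>i\<in>A. poly_fun (u i) z * poly_fun (h i) z)"
        using D(2) less.prems by (meson not_less)
      have lt: "d - \<delta> < d" using False D(1) \<delta> by auto
      have "(\<lambda>z. poly_fun (u i) z * poly_fun (h i) z) \<in> span_on (T d) C" if i: "i \<in> A" for i
      proof (rule span_on_mult)
        show "poly_fun (h i) \<in> span_on (T (d - \<delta>)) C" using h(1) i lt by (intro less.IH) auto
        fix t assume "t \<in> T (d - \<delta>)"
        then obtain m \<alpha> where t: "t = tf m \<alpha>" "m \<in> M" "\<alpha> \<in> (\<Pi>\<^sub>E i\<in>A. {..d - \<delta>})" by (auto simp: T_def)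
        have "(\<lambda>z. poly_fun (u i) z * t z) = tf m (\<alpha>(i := Suc (\<alpha> i)))"
          using A i by (auto simp: t(1) tf_def fun_eq_iff prod.remove[of A i] intro!: prod.cong)
        moreover have "\<alpha>(i := Suc (\<alpha> i)) \<in> (\<Pi>\<^sub>E i\<in>A. {..d})"
        proof (rule PiE_I)
          fix j assume "j \<in> A"
          hence "\<alpha> j \<le> d - \<delta>" using t(3) by auto
          thus "(\<alpha>(i := Suc (\<alpha> i))) j \<in> {..d}" using lt by auto
        next
          fix j assume "j \<notin> A"
          thus "(\<alpha>(i := Suc (\<alpha> i))) j = undefined" using i t(3) by (auto simp: PiE_def extensional_def)
        qed
        ultimately show "(\<lambda>z. poly_fun (u i) z * t z) \<in> span_on (T d) C"
          using t(2) by (intro span_on_base fT) (auto simp: T_def)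
      qed
      hence "(\<lambda>z. \<Sum>i\<in>A. 1 * (poly_fun (u i) z * poly_fun (h i) z)) \<in> span_on (T d) C"
        by (rule span_on_combination)
      thus ?thesis by (rule span_on_cong) (simp add: h(2)[rule_format])
    qed
  qed
  \<comment> \<open>With \<open>d + 1 \<le> X E\<close>, the estimate \<open>card M (X E) ^ card A < E ^ (card A + 1)\<close> holds as soon as
    \<open>E\<close> exceeds \<open>card M X ^ card A\<close>.\<close>
  define X where "X = \<epsilon> * card A' + 1"
  define E where "E = card M * X ^ card A + 1"
  define d where "d = \<epsilon> * card A' * E"
  let ?S = "exponents A' E"
  have "card (T d) \<le> card (M \<times> (\<Pi>\<^sub>E i\<in>A. {..d}))"
    unfolding T_def using M A by (intro card_image_le) (auto intro: finite_PiE)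
  also have "\<dots> = card M * (d + 1) ^ card A" using A by (simp add: card_cartesian_product card_PiE)
  also have "\<dots> \<le> card M * (X * E) ^ card A"
    by (intro mult_left_mono power_mono) (auto simp: d_def X_def E_def)
  also have "\<dots> = (card M * X ^ card A) * E ^ card A"
    by (simp add: power_mult_distrib)
  also have "\<dots> < E * E ^ card A"
    by (rule mult_strict_right_mono) (auto simp: E_def)
  also have "\<dots> \<le> E ^ card A'"
    using A'(2) power_increasing[of "Suc (card A)" "card A'" E] by (simp add: E_def)
  also have "\<dots> = card ?S" using A' by (simp add: card_PiE)
  finally have card: "card (T d) < card ?S" .
  have fS: "finite ?S" using A' by (auto intro: finite_PiE)
  let ?W = "\<lambda>a z. \<Prod>j\<in>A'. poly_fun (w j) z ^ a j"
  have "?W a \<in> span_on (T d) C" if a: "a \<in> ?S" for a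
  proof -
    have "homogeneous_of_degree (\<Sum>j\<in>A'. a j * \<epsilon>) (\<Prod>j\<in>A'. w j ^ a j)"
      using hom' by (intro homogeneous_of_degree_prod homogeneous_of_degree_power)
    from span[OF this] have "?W a \<in> span_on (T (\<Sum>j\<in>A'. a j * \<epsilon>)) C" by (rule span_on_cong) simp
    moreover have "(\<Sum>j\<in>A'. a j * \<epsilon>) \<le> (\<Sum>j\<in>A'. E * \<epsilon>)"
      using a by (intro sum_mono mult_right_mono) (auto simp: less_imp_le PiE_iff)
    hence "(\<Sum>j\<in>A'. a j * \<epsilon>) \<le> d" by (simp add: d_def mult_ac)
    ultimately show ?thesis by (rule span_on_mono[OF _ T_mono fT])
  qed
  hence "\<forall>a\<in>?S. \<exists>y. \<forall>z\<in>C. ?W a z = (\<Sum>t\<in>T d. y t * t z)" by (simp add: span_on_def)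
  hence "\<exists>y. \<forall>a\<in>?S. \<forall>z\<in>C. ?W a z = (\<Sum>t\<in>T d. y a t * t z)" by (rule bchoice)
  then obtain y where y: "\<And>a z. a \<in> ?S \<Longrightarrow> z \<in> C \<Longrightarrow> ?W a z = (\<Sum>t\<in>T d. y a t * t z)"
    by (auto simp only:)
  obtain c where c: "\<exists>a\<in>?S. c a \<noteq> 0" "\<forall>t\<in>T d. (\<Sum>a\<in>?S. y a t * c a) = 0"
    using underdetermined_system[OF fT[of d] fS card, of "\<lambda>t a. y a t"] by auto
  have rel: "(\<Sum>a\<in>?S. c a * ?W a z) = 0" if z: "z \<in> C" for z
  proof -
    have "(\<Sum>a\<in>?S. c a * ?W a z) = (\<Sum>a\<in>?S. \<Sum>t\<in>T d. y a t * c a * t z)"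
      using z by (intro sum.cong) (simp_all add: y sum_distrib_left mult_ac)
    also have "\<dots> = (\<Sum>t\<in>T d. (\<Sum>a\<in>?S. y a t * c a) * t z)"
      by (subst sum.swap) (simp add: sum_distrib_right)
    finally show ?thesis using c(2) by simp
  qed
  \<comment> \<open>Only the component of the relation in the degree of one monomial that occurs is kept.\<close>
  obtain a0 where a0: "a0 \<in> ?S" "c a0 \<noteq> 0" using c(1) by blast
  define e where "e = (\<Sum>j\<in>A'. a0 j)"
  define c' where "c' a = (if (\<Sum>j\<in>A'. a j) = e then c a else 0)" for a
  have "(\<Sum>a\<in>?S. c' a * ?W a z) = 0" if z: "z \<in> C" for z
  proof -
    define q where "q = (\<Sum>a\<in>?S. monom (c a * ?W a z) (\<epsilon> * (\<Sum>j\<in>A'. a j)))"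
    have "q = 0"
    proof (rule poly_eqI_nonzero)
      fix t :: complex assume t: "t \<noteq> 0"
      have "?W a (t *s z) = t ^ (\<epsilon> * (\<Sum>j\<in>A'. a j)) * ?W a z" for a
      proof -
        have "?W a (t *s z) = (\<Prod>j\<in>A'. t ^ (\<epsilon> * a j) * poly_fun (w j) z ^ a j)"
          by (intro prod.cong refl) (simp add: poly_fun_scale[OF hom'] power_mult_distrib power_mult)
        thus ?thesis by (simp add: prod.distrib power_sum sum_distrib_left)
      qed
      hence "poly q t = (\<Sum>a\<in>?S. c a * ?W a (t *s z))"
        by (simp add: q_def poly_sum poly_monom mult_ac)
      thus "poly q t = poly 0 t" using rel[OF cone[OF z t]] by simp
    qed
    moreover have "coeff q (\<epsilon> * e) = (\<Sum>a\<in>?S. c' a * ?W a z)"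
      using \<epsilon> by (auto simp: q_def coeff_sum c'_def intro!: sum.cong)
    ultimately show ?thesis by simp
  qed
  moreover have "\<exists>a\<in>?S. c' a \<noteq> 0" using a0 by (auto simp: c'_def e_def)
  ultimately show ?thesis by (intro exI[of _ E] exI[of _ c'] exI[of _ e]) (auto simp: c'_def)
qed

text \<open>
  Otherwise the coordinates, which are more numerous than the equations, would satisfy a non-trivial
  relation on the whole space.
\<close>

theorem common_zero_exists:
  fixes u :: "'i \<Rightarrow> 'n::finite cpoly"
  assumes "finite A" "\<And>i. i \<in> A \<Longrightarrow> homogeneous_of_degree \<delta> (u i)" "0 < \<delta>" "card A < CARD('n)"
  shows "\<exists>z. z \<noteq> 0 \<and> (\<forall>i\<in>A. poly_fun (u i) z = 0)"
proof (rule ccontr)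
  assume no: "\<nexists>z. z \<noteq> 0 \<and> (\<forall>i\<in>A. poly_fun (u i) z = 0)"
  have "\<exists>E c e. (\<exists>a\<in>exponents (UNIV :: 'n set) E. c a \<noteq> 0) \<and>
    (\<forall>a\<in>exponents (UNIV :: 'n set) E. c a \<noteq> 0 \<longrightarrow> (\<Sum>j\<in>UNIV. a j) = e) \<and>
    (\<forall>z\<in>UNIV :: (complex ^ 'n) set. (\<Sum>a\<in>exponents UNIV E. c a * (\<Prod>j\<in>UNIV. poly_fun (Var j) z ^ a j)) = 0)"
  proof (rule homogeneous_relation[OF _ _ assms(1-3)])
    show "homogeneous_of_degree 1 (Var j)" for j :: 'n by (rule homogeneous_of_degree_Var)
  qed (use no assms(4) in auto)
  then obtain E c a where a: "a \<in> exponents (UNIV :: 'n set) E" "c a \<noteq> 0"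
    and rel: "\<And>z. (\<Sum>a\<in>exponents UNIV E. c a * (\<Prod>j\<in>UNIV. poly_fun (Var j) (z :: complex ^ 'n) ^ a j)) = 0"
    by auto
  have "c a = 0"
  proof (rule monomials_independent[OF _ _ a(1)])
    fix x :: "'n \<Rightarrow> complex"
    show "(\<Sum>a\<in>exponents UNIV E. c a * (\<Prod>j\<in>UNIV. x j ^ a j)) = 0"
      using rel[of "\<chi> j. x j"] by simp
  qed auto
  thus False using a(2) by simp
qed

section \<open>Zero sets near a point\<close>

text \<open>
  A form of the implicit function theorem: a displacement \<open>y\<close> can be corrected to order \<open>o(y)\<close> so that
  the \<open>g i\<close> change exactly by their differentials. With \<open>v\<close> dual to the differentials, the map \<open>\<Phi>\<close> below
  has the identity as its derivative at \<open>z\<close>, hence is open there, and \<open>\<Phi> x = y\<close> encodes the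
  conclusion.
\<close>

lemma points_near_tangent_vectors:
  fixes g :: "'i \<Rightarrow> complex ^ 'n::finite \<Rightarrow> complex"
  assumes A: "finite A" and U: "open U" "z \<in> U"
    and cont: "\<And>i. i \<in> A \<Longrightarrow> continuous_on U (g i)"
    and der: "\<And>i. i \<in> A \<Longrightarrow> (g i has_derivative g' i) (at z)"
    and lin: "\<And>i. i \<in> A \<Longrightarrow> complex_linear (g' i)"
    and dual: "dual_vectors A g' v" and e: "0 < e"
  shows "\<exists>\<delta>>0. \<forall>y. norm y < \<delta> \<longrightarrow>
    (\<exists>x\<in>U. norm (x - z - y) \<le> e * norm y \<and> (\<forall>i\<in>A. g i x = g i z + g' i y))"
proof -
  define \<Phi> where "\<Phi> x = x - z + (\<Sum>i\<in>A. (g i x - g i z - g' i (x - z)) *s v i)" for x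
  have bl: "bounded_linear (g' i)" if "i \<in> A" for i by (rule has_derivative_bounded_linear[OF der[OF that]])
  have rem: "((\<lambda>x. (g i x - g i z - g' i (x - z)) *s v i) has_derivative (\<lambda>h. 0)) (at z)" if i: "i \<in> A" for i
  proof -
    have "((\<lambda>x. g i x - g i z - g' i (x - z)) has_derivative (\<lambda>h. g' i h - 0 - g' i (h - 0))) (at z)"
      by (intro has_derivative_diff der i has_derivative_const bounded_linear.has_derivative[OF bl[OF i]] has_derivative_ident)
    hence "((\<lambda>x. g i x - g i z - g' i (x - z)) has_derivative (\<lambda>h. 0)) (at z)" by simp
    from bounded_linear.has_derivative[OF bounded_linear_smult this, of "v i"]
    show ?thesis by simp
  qed
  have der\<Phi>: "(\<Phi> has_derivative (\<lambda>h. h)) (at z)"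
  proof -
    have "((\<lambda>x. x - z + (\<Sum>i\<in>A. (g i x - g i z - g' i (x - z)) *s v i)) has_derivative
        (\<lambda>h. h - 0 + (\<Sum>i\<in>A. 0))) (at z)"
      by (intro has_derivative_add has_derivative_diff has_derivative_sum rem has_derivative_ident has_derivative_const)
    thus ?thesis unfolding \<Phi>_def[abs_def] by simp
  qed
  have cont\<Phi>: "continuous_on U \<Phi>"
    unfolding \<Phi>_def[abs_def]
    by (intro continuous_intros bounded_linear.continuous_on[OF bounded_linear_smult]
        bounded_linear.continuous_on[OF bl] cont)
  have \<Phi>z: "\<Phi> z = 0" by (simp add: \<Phi>_def complex_linear_simps[OF lin])
  \<comment> \<open>The bound \<open>1 / 2\<close> gives \<open>norm (x - z) \<le> 2 * norm y\<close>, and then \<open>e / 2\<close> gives the error \<open>e * norm y\<close>.\<close>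
  define e' where "e' = min (e / 2) (1 / 2)"
  have e': "0 < e'" "e' \<le> e / 2" "e' \<le> 1 / 2" using e by (auto simp: e'_def)
  obtain r where r: "0 < r" "\<And>x. norm (x - z) < r \<Longrightarrow> norm (\<Phi> x - \<Phi> z - (x - z)) \<le> e' * norm (x - z)"
    using der\<Phi> e'(1) unfolding has_derivative_at_alt by blast
  have "z \<in> interior (ball z r \<inter> U)" using r(1) U by (simp add: interior_open open_Int)
  hence "\<Phi> z \<in> interior (\<Phi> ` (ball z r \<inter> U))"
    by (intro sussmann_open_mapping[OF U(1) cont\<Phi> U(2) der\<Phi>, of "\<lambda>h. h"]) (auto simp: bounded_linear_ident)
  then obtain \<delta> where \<delta>: "0 < \<delta>" "ball 0 \<delta> \<subseteq> \<Phi> ` (ball z r \<inter> U)"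
    unfolding \<Phi>z mem_interior by blast
  have "\<exists>x\<in>U. norm (x - z - y) \<le> e * norm y \<and> (\<forall>i\<in>A. g i x = g i z + g' i y)" if y: "norm y < \<delta>" for y
  proof -
    have "y \<in> \<Phi> ` (ball z r \<inter> U)" using y \<delta>(2) by auto
    then obtain x where x: "x \<in> U" "norm (x - z) < r" "\<Phi> x = y"
      by (auto simp: dist_norm norm_minus_commute)
    have 1: "norm (y - (x - z)) \<le> e' * norm (x - z)" using r(2)[OF x(2)] by (simp add: x(3) \<Phi>z)
    have "norm (x - z) \<le> norm y + norm (y - (x - z))" by norm
    also have "\<dots> \<le> norm y + 1 / 2 * norm (x - z)"
      using 1 e'(3) mult_right_mono[OF e'(3), of "norm (x - z)"] by simp
    finally have 2: "norm (x - z) \<le> 2 * norm y" by simp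
    have "norm (x - z - y) \<le> e' * norm (x - z)" using 1 by (simp add: norm_minus_commute)
    also have "\<dots> \<le> (e / 2) * (2 * norm y)" using 2 e' e by (intro mult_mono) auto
    finally have "norm (x - z - y) \<le> e * norm y" by simp
    moreover have "g k x = g k z + g' k y" if k: "k \<in> A" for k
    proof -
      have "g' k y = g' k (x - z) + (\<Sum>i\<in>A. (g i x - g i z - g' i (x - z)) * g' k (v i))"
        unfolding x(3)[symmetric] \<Phi>_def by (simp only: complex_linear_simps[OF lin[OF k]])
      also have "(\<Sum>i\<in>A. (g i x - g i z - g' i (x - z)) * g' k (v i))
          = (\<Sum>i\<in>A. if k = i then g i x - g i z - g' i (x - z) else 0)"
        using dual k by (intro sum.cong) (auto simp: dual_vectors_def)
      also have "\<dots> = g k x - g k z - g' k (x - z)" using A k by simp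
      finally show ?thesis by simp
    qed
    ultimately show ?thesis using x(1) by blast
  qed
  thus ?thesis using \<delta>(1) by blast
qed

lemma continuous_on_poly_fun_compose:
  assumes "continuous_on S k"
  shows "continuous_on S (\<lambda>x. poly_fun P (k x :: complex ^ 'n::finite))"
proof -
  have "continuous_on UNIV (poly_fun P :: complex ^ 'n \<Rightarrow> complex)"
    by (simp add: continuous_at_imp_continuous_on isCont_cpoly_function cpoly_function_poly_fun)
  from continuous_on_compose2[OF this assms] show ?thesis by simp
qed

text \<open>
  If the zero were isolated on the plane, \<open>h\<close> would be bounded below in modulus on the product of a
  circle and a disc; by the maximum principle for the reciprocals on the discs with \<open>t \<noteq> 0\<close>, this
  bound would pass to the centres of these discs and to their limit, the zero.
\<close>

lemma nonisolated_zero: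
  fixes h :: "'n::finite cpoly"
  assumes h0: "poly_fun h z = 0" and e: "0 < e"
  shows "\<exists>s t. (s, t) \<noteq> (0, 0) \<and> cmod s \<le> e \<and> cmod t \<le> e \<and> poly_fun h (z + t *s b + s *s a) = 0"
proof (rule ccontr)
  assume no: "\<not> ?thesis"
  define F where "F = (\<lambda>(s, t). poly_fun h (z + t *s b + s *s a))"
  have F0: "F (s, t) \<noteq> 0" if "(s, t) \<noteq> (0, 0)" "cmod s \<le> e" "cmod t \<le> e" for s t
    using no that by (auto simp: F_def)
  have contF: "continuous_on UNIV F"
    unfolding F_def case_prod_unfold
    by (intro continuous_on_poly_fun_compose continuous_intros bounded_linear.continuous_on[OF bounded_linear_smult])
  define K where "K = sphere (0::complex) e \<times> cball (0::complex) e"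
  have compK: "compact K" unfolding K_def by (intro compact_Times) auto
  have neK: "K \<noteq> {}"
  proof -
    have "(of_real e, 0) \<in> K" using e by (simp add: K_def)
    thus ?thesis by blast
  qed
  have contK: "continuous_on K (\<lambda>x. cmod (F x))"
    by (intro continuous_intros continuous_on_subset[OF contF]) auto
  from continuous_attains_inf[OF compK neK contK]
  obtain x0 where x0: "x0 \<in> K" "\<forall>x\<in>K. cmod (F x0) \<le> cmod (F x)" by (rule bexE)
  define m where "m = cmod (F x0)"
  have m: "0 < m" using F0[of "fst x0" "snd x0"] x0(1) e by (auto simp: m_def K_def)
  have lower: "m \<le> cmod (F (0, t))" if t: "t \<noteq> 0" "cmod t \<le> e" for t
  proof -
    have ne: "F (s, t) \<noteq> 0" if "s \<in> cball 0 e" for s using F0[of s t] t that by auto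
    have hol: "(\<lambda>s. F (s, t)) holomorphic_on UNIV"
      unfolding holomorphic_on_def field_differentiable_def F_def
      by (auto intro!: exI[of _ "differential (poly_fun h) (z + t *s b + _ *s a) a"]
            has_derivative_along_line)
    have "cmod (inverse (F (0, t))) \<le> 1 / m"
    proof (rule maximum_modulus_frontier[of "\<lambda>s. inverse (F (s, t))" "cball 0 e"])
      show "(\<lambda>s. inverse (F (s, t))) holomorphic_on interior (cball 0 e)"
        using ne by (intro holomorphic_on_inverse holomorphic_on_subset[OF hol]) auto
      have "(\<lambda>s. inverse (F (s, t))) holomorphic_on cball 0 e"
        using ne by (intro holomorphic_on_inverse holomorphic_on_subset[OF hol]) auto
      thus "continuous_on (closure (cball 0 e)) (\<lambda>s. inverse (F (s, t)))"
        by (simp add: holomorphic_on_imp_continuous_on)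
      fix s :: complex assume "s \<in> frontier (cball 0 e)"
      hence "(s, t) \<in> K" using t e by (auto simp: K_def)
      hence "m \<le> cmod (F (s, t))" using x0(2) by (simp add: m_def)
      thus "cmod (inverse (F (s, t))) \<le> 1 / m"
        using m by (simp add: norm_divide inverse_eq_divide frac_le)
    qed (use e in auto)
    thus ?thesis using m F0[of 0 t] t e by (simp add: norm_divide inverse_eq_divide field_simps)
  qed
  have "isCont (\<lambda>t. F (0, t)) 0"
    using continuous_on_compose2[OF contF, of UNIV "\<lambda>t. (0, t)"] by (simp add: continuous_on_eq_continuous_at continuous_on_Pair)
  moreover have "F (0, 0) = 0" using h0 by (simp add: F_def)
  ultimately have "((\<lambda>t. F (0, t)) \<longlongrightarrow> 0) (at 0)" by (simp add: isCont_def)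
  hence "eventually (\<lambda>t. cmod (F (0, t)) < m) (at 0)" using m by (auto simp: tendsto_iff dist_norm)
  moreover have "eventually (\<lambda>t::complex. t \<noteq> 0 \<and> cmod t < e) (at 0)"
    using e by (auto simp: eventually_at dist_norm)
  ultimately have "eventually (\<lambda>t::complex. False) (at 0)"
    by eventually_elim (use lower in force)
  thus False by simp
qed

text \<open>
  A polynomial without any zero is a unit by the Nullstellensatz. At a zero of \<open>h\<close> both \<open>P\<close> and \<open>Q\<close>
  vanish, and if it is not the origin, \<open>P\<close> and \<open>Q\<close> have no other common zero nearby on the plane spanned
  by vectors dual to their differentials. Then the zero of \<open>h\<close> would be isolated on this plane. A zero at the
  origin is no exception, because there are zeros outside the origin next to it.
\<close>

lemma common_divisor_is_unit:
  fixes h P Q :: "'n::finite cpoly"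
  assumes dvd: "h dvd P ^ k" "h dvd Q ^ l" and card: "2 \<le> CARD('n)"
    and trans: "\<And>z. z \<noteq> 0 \<Longrightarrow> poly_fun P z = 0 \<Longrightarrow> poly_fun Q z = 0 \<Longrightarrow>
      \<exists>a b. differential (poly_fun P) z a = 1 \<and> differential (poly_fun P) z b = 0 \<and>
            differential (poly_fun Q) z a = 0 \<and> differential (poly_fun Q) z b = 1"
  shows "h dvd 1"
proof (cases "\<exists>z. poly_fun h z = 0")
  case False
  have "\<exists>k. 1 ^ k \<in> range (\<lambda>r. h * r)"
  proof (rule nullstellensatz)
    show "ring_ideal (range (\<lambda>r. h * r))"
      unfolding ring_ideal_def
    proof (intro conjI ballI allI)
      show "0 \<in> range ((*) h)" by (rule range_eqI[of _ _ 0]) simp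
      fix x assume "x \<in> range ((*) h)"
      then obtain r where x: "x = h * r" by auto
      show "q * x \<in> range ((*) h)" for q by (rule range_eqI[of _ _ "q * r"]) (simp add: x mult.left_commute)
      fix y assume "y \<in> range ((*) h)"
      then obtain r' where y: "y = h * r'" by auto
      show "x + y \<in> range ((*) h)" by (rule range_eqI[of _ _ "r + r'"]) (simp add: x y distrib_left)
    qed
    fix z :: "complex ^ 'n" assume "\<And>P. P \<in> range ((*) h) \<Longrightarrow> poly_fun P z = 0"
    from this[of h] have "poly_fun h z = 0" using range_eqI[of h "(*) h" 1] by simp
    thus "poly_fun 1 z = 0" using False by blast
  qed
  then obtain r where "1 = h * r" by auto
  thus ?thesis by (rule dvdI)
next
  case True
  then obtain z0 where z0: "poly_fun h z0 = 0" by blast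
  have "\<exists>z. z \<noteq> 0 \<and> poly_fun h z = 0"
  proof (cases "z0 = 0")
    case True
    have "\<exists>i j :: 'n. i \<noteq> j"
    proof (rule ccontr)
      assume "\<not> ?thesis"
      hence "card (UNIV :: 'n set) \<le> card {undefined :: 'n}" by (intro card_mono) auto
      thus False using card by simp
    qed
    then obtain i j :: 'n where ij: "i \<noteq> j" by blast
    obtain s t where st: "(s, t) \<noteq> (0, 0)" "poly_fun h (z0 + t *s axis j 1 + s *s axis i 1) = 0"
      using nonisolated_zero[OF z0 zero_less_one, of "axis j 1" "axis i 1"] by blast
    have "(z0 + t *s axis j 1 + s *s axis i 1) $ i = s" "(z0 + t *s axis j 1 + s *s axis i 1) $ j = t"
      using True ij by (auto simp: axis_def)
    hence "z0 + t *s axis j 1 + s *s axis i 1 \<noteq> 0" using st(1) by (metis zero_index)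
    thus ?thesis using st(2) by blast
  qed (use z0 in blast)
  then obtain z where z: "z \<noteq> 0" "poly_fun h z = 0" by blast
  have hPQ: "poly_fun P x = 0 \<and> poly_fun Q x = 0" if "poly_fun h x = 0" for x
  proof -
    from dvd obtain r r' where "P ^ k = h * r" "Q ^ l = h * r'" by (auto elim!: dvdE)
    hence "poly_fun P x ^ k = 0" "poly_fun Q x ^ l = 0"
      using that by (simp_all flip: poly_fun_power)
    thus ?thesis by simp
  qed
  obtain a b where ab: "differential (poly_fun P) z a = 1" "differential (poly_fun P) z b = 0"
      "differential (poly_fun Q) z a = 0" "differential (poly_fun Q) z b = 1"
    using trans[of z] z hPQ by blast
  \<comment> \<open>With errors of relative size \<open>c\<close>, a common zero of \<open>P\<close> and \<open>Q\<close> at \<open>z + t b + s a\<close> forces both \<open>cmod s\<close>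
    and \<open>cmod t\<close> to be at most a quarter of their sum.\<close>
  define M where "M = norm a + norm b + 1"
  have M: "0 < M" by (simp add: M_def add_nonneg_pos)
  define c where "c = 1 / (4 * M)"
  have c: "0 < c" using M by (simp add: c_def)
  obtain r1 where r1: "0 < r1" "\<And>x. norm (x - z) < r1 \<Longrightarrow>
      cmod (poly_fun P x - poly_fun P z - differential (poly_fun P) z (x - z)) \<le> c * norm (x - z)"
    using poly_fun_derivative(1)[of P z] c unfolding has_derivative_at_alt by blast
  obtain r2 where r2: "0 < r2" "\<And>x. norm (x - z) < r2 \<Longrightarrow>
      cmod (poly_fun Q x - poly_fun Q z - differential (poly_fun Q) z (x - z)) \<le> c * norm (x - z)"
    using poly_fun_derivative(1)[of Q z] c unfolding has_derivative_at_alt by blast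
  define e where "e = min r1 r2 / (4 * M)"
  have e: "0 < e" using r1 r2 M by (simp add: e_def)
  obtain s t where st: "(s, t) \<noteq> (0, 0)" "cmod s \<le> e" "cmod t \<le> e" "poly_fun h (z + t *s b + s *s a) = 0"
    using nonisolated_zero[OF z(2) e, of b a] by blast
  define x where "x = z + t *s b + s *s a"
  have xz: "x - z = t *s b + s *s a" by (simp add: x_def)
  have "norm (x - z) \<le> cmod t * norm b + cmod s * norm a"
    unfolding xz by (metis norm_triangle_ineq norm_smult)
  also have "\<dots> \<le> cmod t * M + cmod s * M"
    by (intro add_mono mult_left_mono) (auto simp: M_def)
  finally have n: "norm (x - z) \<le> (cmod s + cmod t) * M" by (simp add: algebra_simps)
  also have "\<dots> \<le> (e + e) * M" using st M by (intro mult_right_mono add_mono) auto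
  also have "\<dots> = min r1 r2 / 2" using M by (simp add: e_def)
  also have "\<dots> < min r1 r2" using r1(1) r2(1) by linarith
  finally have "norm (x - z) < r1" "norm (x - z) < r2" by auto
  note R = r1(2)[OF this(1)] r2(2)[OF this(2)]
  have "poly_fun P x = 0 \<and> poly_fun Q x = 0" "poly_fun P z = 0 \<and> poly_fun Q z = 0"
    using hPQ st(4) z(2) by (auto simp: x_def)
  hence "cmod s \<le> c * norm (x - z)" "cmod t \<le> c * norm (x - z)"
    using R by (auto simp: xz complex_linear_simps[OF poly_fun_derivative(2)] ab)
  moreover have le: "c * norm (x - z) \<le> (cmod s + cmod t) / 4"
    using mult_left_mono[OF n, of c] c M by (simp add: c_def)
  ultimately have "cmod s \<le> (cmod s + cmod t) / 4" "cmod t \<le> (cmod s + cmod t) / 4"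
    by (blast intro: order_trans)+
  moreover have "a \<le> 0 \<and> b \<le> 0" if "a \<le> (a + b) / 4" "b \<le> (a + b) / 4" "0 \<le> a" "0 \<le> b" for a b :: real
  proof -
    have "3 * a \<le> b" "3 * b \<le> a" using that by (simp_all add: field_simps)
    with that(3,4) have "a \<le> 0" "b \<le> 0" by auto
    thus ?thesis ..
  qed
  ultimately have "cmod s \<le> 0 \<and> cmod t \<le> 0" using norm_ge_zero by blast
  thus ?thesis using st(1) by simp
qed

section \<open>Ordinary families of homogeneous polynomials\<close>

lemma ordinary_dual_vectors:
  fixes f :: "nat \<Rightarrow> 'n::finite cpoly"
  assumes so: "strictly_ordinary r f" and I: "I \<subseteq> {1..r}" "I \<noteq> {}" "card I < CARD('n)"
    and z: "z \<noteq> 0" "\<forall>i\<in>I. poly_fun (f i) z = 0"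
  shows "\<exists>v. dual_vectors I (\<lambda>i. differential (poly_fun (f i)) z) v"
proof -
  let ?l = "sorted_list_of_set I"
  have fin: "finite I" using I(1) finite_subset by blast
  have bij: "bij_betw ((!) ?l) {..<card I} I"
    using bij_betw_nth[of ?l "{..<card I}" I] fin by simp
  have "wedge_covectors (card I) (\<lambda>j. differential (poly_fun (f (?l ! j))) z) \<noteq> (\<lambda>v. 0)"
    using so I z unfolding strictly_ordinary_def by auto
  hence "\<exists>v. dual_vectors {..<card I} (\<lambda>j. differential (poly_fun (f (?l ! j))) z) v"
    by (intro dual_vectors_of_wedge poly_fun_derivative(2))
  then obtain v where v: "dual_vectors {..<card I} (\<lambda>j. differential (poly_fun (f (?l ! j))) z) v" ..
  define v' where "v' i = v (inv_into {..<card I} ((!) ?l) i)" for i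
  have "differential (poly_fun (f i)) z (v' j) = (if i = j then 1 else 0)" if "i \<in> I" "j \<in> I" for i j
  proof -
    let ?h = "inv_into {..<card I} ((!) ?l)"
    have "?h i < card I" "?h j < card I" "?l ! ?h i = i" "?l ! ?h j = j"
      using bij that by (metis bij_betw_def f_inv_into_f inv_into_into lessThan_iff)+
    moreover from this have "?h i = ?h j \<longleftrightarrow> i = j" by metis
    ultimately show ?thesis using v unfolding dual_vectors_def v'_def by (metis lessThan_iff)
  qed
  thus ?thesis by (auto simp: dual_vectors_def intro!: exI[of _ v'])
qed

text \<open>
  A polynomial of degree zero that vanishes at the origin is zero everywhere, but the differential of
  \<open>f i\<close> does not vanish at the zeros of \<open>f i\<close> outside the origin.
\<close>

lemma ordinary_degree_pos:
  fixes f :: "nat \<Rightarrow> 'n::finite cpoly"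
  assumes so: "strictly_ordinary r f" and i: "i \<in> {1..r}"
    and hom: "homogeneous_of_degree d (f i)" and card: "1 < CARD('n)"
  shows "0 < d" "f i \<noteq> 0"
proof -
  have nz: False if zero: "\<And>z. poly_fun (f i) z = 0"
  proof -
    have "(1 :: complex ^ 'n) \<noteq> 0" by (metis one_index zero_index zero_neq_one)
    then obtain v where v: "dual_vectors {i} (\<lambda>i. differential (poly_fun (f i)) 1) v"
      using ordinary_dual_vectors[OF so, of "{i}" 1] i card zero by auto
    have "poly_fun (f i) = (\<lambda>z. 0)" using zero by auto
    hence "differential (poly_fun (f i)) 1 (v i) = 0" by simp
    thus False using v by (simp add: dual_vectors_def)
  qed
  show "f i \<noteq> 0" using nz by (metis poly_fun_simps(1))
  show "0 < d"
  proof (rule ccontr)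
    assume "\<not> 0 < d"
    hence "poly_fun (f i) z = poly_fun (f i) 0" for z
      using poly_fun_scale[OF hom, of 0 z] by simp
    moreover have "poly_fun (f i) 0 = 0" using so i unfolding strictly_ordinary_def by blast
    ultimately show False using nz by simp
  qed
qed

locale ordinary_family =
  fixes p :: nat and f :: "nat \<Rightarrow> 'n::finite cpoly" and d k :: "nat \<Rightarrow> nat" and \<delta> :: nat
  assumes p1: "1 \<le> p" and card: "p + 2 < CARD('n)"
    and hom: "i \<in> {1..p + 1} \<Longrightarrow> homogeneous_of_degree (d i) (f i)"
    and d_pos: "i \<in> {1..p + 1} \<Longrightarrow> 0 < d i"
    and k_pos: "i \<in> {1..p + 1} \<Longrightarrow> 0 < k i"
    and kd: "i \<in> {1..p + 1} \<Longrightarrow> k i * d i = \<delta>"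
    and ordinary: "strictly_ordinary (p + 1) f"
begin

abbreviation "J \<equiv> {1..p + 1}"
abbreviation "u i \<equiv> f i ^ k i"
abbreviation "df i z \<equiv> differential (poly_fun (f i)) z"
abbreviation "D \<equiv> divisor (p + 1) f"

lemma df_linear: "complex_linear (df i z)"
  by (rule poly_fun_derivative(2))

lemma hom_u: "i \<in> J \<Longrightarrow> homogeneous_of_degree \<delta> (u i)"
  using homogeneous_of_degree_power[OF hom, of i "k i"] kd[of i] by simp

lemma \<delta>_pos: "0 < \<delta>"
proof -
  have "0 < k 1 * d 1" by (intro mult_pos_pos k_pos d_pos) auto
  also have "k 1 * d 1 = \<delta>" by (rule kd) auto
  finally show ?thesis .
qed

lemma u_eq_0_iff: "i \<in> J \<Longrightarrow> poly_fun (u i) z = 0 \<longleftrightarrow> poly_fun (f i) z = 0"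
  using k_pos[of i] by simp

lemma mem_D_iff: "z \<in> D \<longleftrightarrow> (\<exists>i\<in>J. poly_fun (f i) z = 0)"
  by (simp only: divisor_def mem_Collect_eq poly_fun_prod prod_zero_iff[OF finite_atLeastAtMost])

lemma f_nonzero: "z \<notin> D \<Longrightarrow> i \<in> J \<Longrightarrow> poly_fun (f i) z \<noteq> 0"
  using mem_D_iff by blast

lemma euler: "i \<in> J \<Longrightarrow> df i z z = of_nat (d i) * poly_fun (f i) z"
  by (rule differential_radial[OF hom])

lemma f_0: "i \<in> J \<Longrightarrow> poly_fun (f i) 0 = 0"
  using ordinary unfolding strictly_ordinary_def by blast

lemma dual_at:
  assumes "I \<subseteq> J" "I \<noteq> {}" "z \<noteq> 0" "\<forall>i\<in>I. poly_fun (f i) z = 0"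
  shows "\<exists>v. dual_vectors I (\<lambda>i. df i z) v"
proof (rule ordinary_dual_vectors[OF ordinary assms(1,2) _ assms(3,4)])
  have "card I \<le> card J" by (rule card_mono) (use assms(1) in auto)
  thus "card I < CARD('n)" using card by simp
qed

lemma base_point_exists:
  "\<exists>z. z \<noteq> 0 \<and> (\<forall>i\<in>J. poly_fun (f i) z = 0)"
proof -
  have "\<exists>z. z \<noteq> 0 \<and> (\<forall>i\<in>J. poly_fun (u i) z = 0)"
    by (rule common_zero_exists[OF _ hom_u \<delta>_pos]) (use card in auto)
  thus ?thesis using u_eq_0_iff by blast
qed

section \<open>Tangent vectors of the foliation\<close>

text \<open>
  Up to a factor \<open>\<tau> i j\<close> is the differential of \<open>u i / u j\<close>, freed of denominators so that it is
  also defined on the divisor.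
\<close>

definition \<tau> :: "nat \<Rightarrow> nat \<Rightarrow> complex ^ 'n \<Rightarrow> complex ^ 'n \<Rightarrow> complex" where
  "\<tau> i j z x = of_nat (d j) * poly_fun (f j) z * df i z x - of_nat (d i) * poly_fun (f i) z * df j z x"

lemma log_form_alternating:
  "alternating_form p (log_form p (p + 1) f lam z)"
proof -
  define S where "S = {I. I \<subseteq> J \<and> card I = p}"
  define w where "w I = wedge_covectors p (\<lambda>j u. df (sorted_list_of_set I ! j) z u / poly_fun (f (sorted_list_of_set I ! j)) z)" for I
  have w: "alternating_form p (w I)" for I
    unfolding w_def
  proof (rule alternating_wedge_covectors)
    fix j
    show "complex_linear (\<lambda>u. df (sorted_list_of_set I ! j) z u / poly_fun (f (sorted_list_of_set I ! j)) z)"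
      unfolding complex_linear_iff by (simp add: complex_linear_simps[OF df_linear] add_divide_distrib)
  qed
  have eq: "log_form p (p + 1) f lam z v = (\<Sum>I\<in>S. lam I * w I v)" for v
    unfolding log_form_def S_def w_def by (rule refl)
  show ?thesis
    unfolding alternating_form_def eq
  proof (intro conjI allI impI)
    fix v v' :: "nat \<Rightarrow> complex ^ 'n" assume "\<forall>i<p. v i = v' i"
    hence "w I v = w I v'" for I by (rule alternating_form_cong[OF w])
    thus "(\<Sum>I\<in>S. lam I * w I v) = (\<Sum>I\<in>S. lam I * w I v')" by simp
  next
    fix v :: "nat \<Rightarrow> complex ^ 'n" and i assume "i < p"
    thus "complex_linear (\<lambda>x. \<Sum>I\<in>S. lam I * w I (v(i := x)))"
      by (intro complex_linear_sum alternating_form_linear[OF w])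
  next
    fix v :: "nat \<Rightarrow> complex ^ 'n" and i j assume "i < p" "j < p" "i \<noteq> j" "v i = v j"
    hence "w I v = 0" for I by (rule alternating_form_zero[OF w])
    thus "(\<Sum>I\<in>S. lam I * w I v) = 0" by simp
  qed
qed

text \<open>
  The form is a pullback under \<open>(f 1, \<dots>, f (p + 1))\<close>.
\<close>

lemma log_form_kernel:
  assumes x: "\<forall>i\<in>J. df i z x = 0" and l: "l < p"
  shows "log_form p (p + 1) f lam z (v(l := x)) = 0"
  unfolding log_form_def
proof (intro sum.neutral ballI)
  fix I assume "I \<in> {I. I \<subseteq> J \<and> card I = p}"
  hence I: "I \<subseteq> J" "card I = p" by auto
  hence fin: "finite I" using finite_subset by blast
  let ?\<beta> = "\<lambda>j u. df (sorted_list_of_set I ! j) z u / poly_fun (f (sorted_list_of_set I ! j)) z"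
  have zero: "?\<beta> j x = 0" if "j < p" for j
  proof -
    have "sorted_list_of_set I ! j \<in> I" using that I fin by (metis nth_mem length_sorted_list_of_set set_sorted_list_of_set)
    thus ?thesis using x I by auto
  qed
  have "wedge_covectors p ?\<beta> (v(l := x)) = 0"
    unfolding wedge_covectors_def
  proof (intro sum.neutral ballI)
    fix \<sigma> assume "\<sigma> \<in> {\<sigma>. \<sigma> permutes {..<p}}"
    hence s: "\<sigma> permutes {..<p}" by simp
    have "inv \<sigma> l < p" using s l by (metis lessThan_iff permutes_in_image permutes_inv)
    moreover have "?\<beta> (inv \<sigma> l) ((v(l := x)) (\<sigma> (inv \<sigma> l))) = 0"
      unfolding permutes_inverses(1)[OF s] fun_upd_same by (rule zero[OF calculation])
    ultimately have "(\<Prod>j<p. ?\<beta> j ((v(l := x)) (\<sigma> j))) = 0"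
      by (intro prod_zero[OF finite_lessThan] bexI[of _ "inv \<sigma> l"] lessThan_iff[THEN iffD2])
    thus "of_int (sign \<sigma>) * (\<Prod>j<p. ?\<beta> j ((v(l := x)) (\<sigma> j))) = 0" by simp
  qed
  thus "lam I * wedge_covectors p ?\<beta> (v(l := x)) = 0" by simp
qed

lemma \<tau>_linear: "complex_linear (\<tau> i j z)"
  unfolding complex_linear_iff \<tau>_def
  by (simp add: complex_linear_simps[OF df_linear] algebra_simps)

lemma \<tau>_radial: "i \<in> J \<Longrightarrow> j \<in> J \<Longrightarrow> \<tau> i j z z = 0"
  by (simp add: \<tau>_def euler)

text \<open>
  The relation \<open>\<tau> i j \<and> \<eta> = 0\<close>, in a form like Cramer's rule that needs no signs. The \<open>p + 2\<close> vectors
  \<open>v 0, \<dots>, v (p - 1), z, x\<close> have \<open>p + 1\<close> coordinates each under the differentials of the \<open>f i\<close>, so some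
  combination \<open>X\<close> of them is killed by all these differentials, hence by both \<open>\<eta>\<close> and \<open>\<tau> i j\<close>. Since also
  \<open>z\<close> is killed by both, comparing coefficients gives the identity.
\<close>

lemma \<tau>_wedge_log_form:
  assumes \<eta>: "\<eta> = log_form p (p + 1) f lam z" and z: "z \<notin> D" and rad: "contract z \<eta> = (\<lambda>v. 0)"
    and v: "\<eta> v \<noteq> 0" and ij: "i \<in> J" "j \<in> J"
  shows "\<tau> i j z x * \<eta> v = (\<Sum>l<p. \<tau> i j z (v l) * \<eta> (v(l := x)))"
proof -
  have alt: "alternating_form p \<eta>" unfolding \<eta> by (rule log_form_alternating)
  define w where "w l = (if l < p then v l else if l = p then z else x)" for l
  obtain y where y: "\<exists>l\<in>{..<p + 2}. y l \<noteq> 0" "\<forall>i\<in>J. (\<Sum>l<p + 2. df i z (w l) * y l) = 0"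
    using underdetermined_system[of "J" "{..<p + 2}" "\<lambda>i l. df i z (w l)"] by auto
  define X where "X = (\<Sum>l<p + 2. y l *s w l)"
  have X: "df i z X = 0" if "i \<in> J" for i
    using y(2) that by (simp add: X_def complex_linear_simps[OF df_linear] mult.commute)
  have eq: "y l * \<eta> v + y (Suc p) * \<eta> (v(l := x)) = 0" if l: "l < p" for l
  proof -
    have "0 = \<eta> (v(l := X))" using log_form_kernel[of z X l lam v] X l by (simp add: \<eta>)
    also have "\<dots> = (\<Sum>m<p + 2. y m * \<eta> (v(l := w m)))"
      unfolding X_def by (rule complex_linear_simps(6)[OF alternating_form_linear[OF alt l]])
    also have "\<dots> = (\<Sum>m<p. y m * \<eta> (v(l := w m))) + y p * \<eta> (v(l := z)) + y (Suc p) * \<eta> (v(l := x))"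
      by (simp add: w_def)
    also have "\<eta> (v(l := z)) = 0" by (rule alternating_form_contract_slot[OF alt rad l])
    also have "(\<Sum>m<p. y m * \<eta> (v(l := w m))) = (\<Sum>m<p. if m = l then y l * \<eta> v else 0)"
    proof (intro sum.cong refl)
      fix m assume m: "m \<in> {..<p}"
      show "y m * \<eta> (v(l := w m)) = (if m = l then y l * \<eta> v else 0)"
      proof (cases "m = l")
        case False
        hence "\<eta> (v(l := w m)) = 0"
          using m l by (intro alternating_form_zero[OF alt, of l m]) (auto simp: w_def)
        thus ?thesis using False by simp
      qed (use l in \<open>simp add: w_def\<close>)
    qed
    also have "\<dots> = y l * \<eta> v" using l by simp
    finally have "0 = y l * \<eta> v + y p * 0 + y (Suc p) * \<eta> (v(l := x))" .
    thus ?thesis unfolding mult_zero_right add_0_right by (rule sym)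
  qed
  \<comment> \<open>The other vectors are mapped to independent vectors: \<open>\<eta> v \<noteq> 0\<close>, and off the divisor the \<open>df i\<close> do not kill \<open>z\<close>.\<close>
  have ne: "y (Suc p) \<noteq> 0"
  proof
    assume 0: "y (Suc p) = 0"
    hence yl: "y l = 0" if "l < p" for l using eq[OF that] v by simp
    have "df 1 z X = y p * df 1 z z"
      using yl 0 by (simp add: X_def complex_linear_simps[OF df_linear] w_def)
    hence "y p * (of_nat (d 1) * poly_fun (f 1) z) = 0" using X[of 1] euler[of 1 z] by simp
    moreover have "poly_fun (f 1) z \<noteq> 0" "d 1 \<noteq> 0" using f_nonzero[OF z, of 1] d_pos[of 1] by simp_all
    ultimately have "y p = 0" by simp
    moreover obtain l where "l < p + 2" "y l \<noteq> 0" using y(1) by auto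
    ultimately show False using yl 0 by (metis add_2_eq_Suc' less_antisym not_less_eq)
  qed
  have "\<tau> i j z X = 0" using X ij by (simp add: \<tau>_def)
  hence "(\<Sum>l<p. y l * \<tau> i j z (v l)) + y (Suc p) * \<tau> i j z x = 0"
    using \<tau>_radial[OF ij, of z] by (simp add: X_def complex_linear_simps[OF \<tau>_linear] w_def)
  hence "y (Suc p) * \<tau> i j z x = - (\<Sum>l<p. y l * \<tau> i j z (v l))"
    by (simp add: eq_neg_iff_add_eq_0 add.commute)
  hence "y (Suc p) * (\<tau> i j z x * \<eta> v) = - ((\<Sum>l<p. y l * \<tau> i j z (v l)) * \<eta> v)"
    by (simp flip: mult.assoc)
  also have "\<dots> = (\<Sum>l<p. \<tau> i j z (v l) * - (y l * \<eta> v))"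
    by (simp add: sum_distrib_left sum_negf mult_ac)
  also have "\<dots> = (\<Sum>l<p. \<tau> i j z (v l) * (y (Suc p) * \<eta> (v(l := x))))"
  proof (intro sum.cong refl arg_cong2[where f = "(*)"])
    fix l assume "l \<in> {..<p}"
    thus "- (y l * \<eta> v) = y (Suc p) * \<eta> (v(l := x))"
      using eq[of l] by (simp only: neg_eq_iff_add_eq_0 lessThan_iff)
  qed
  also have "\<dots> = y (Suc p) * (\<Sum>l<p. \<tau> i j z (v l) * \<eta> (v(l := x)))"
    by (simp add: sum_distrib_left mult_ac)
  finally show ?thesis using ne by simp
qed

end

context ordinary_family begin

lemma quotient_limit_at_zero:
  assumes "poly_fun (f i) z = 0"
  shows "((\<lambda>s. poly_fun (f i) (z + s *s a) / s) \<longlongrightarrow> df i z a) (at 0)"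
  using DERIV_D[OF has_derivative_along_line[of "f i" z a 0]] assms by simp

lemma off_divisor_near_base_point:
  assumes "\<And>i. i \<in> J \<Longrightarrow> poly_fun (f i) z = 0" "\<And>i. i \<in> J \<Longrightarrow> df i z a \<noteq> 0"
  shows "eventually (\<lambda>s. z + s *s a \<notin> D) (at 0)"
proof -
  have "eventually (\<lambda>s. \<forall>i\<in>J. poly_fun (f i) (z + s *s a) / s \<noteq> 0) (at 0)"
  proof (intro eventually_ball_finite ballI)
    fix i assume "i \<in> J"
    thus "eventually (\<lambda>s. poly_fun (f i) (z + s *s a) / s \<noteq> 0) (at 0)"
      by (intro tendsto_imp_eventually_ne[OF quotient_limit_at_zero] assms)
  qed simp
  thus ?thesis
  proof eventually_elim
    case (elim s)
    show ?case
    proof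
      assume "z + s *s a \<in> D"
      then obtain i where "i \<in> J" "poly_fun (f i) (z + s *s a) = 0" unfolding mem_D_iff ..
      thus False using elim by force
    qed
  qed
qed

lemma base_point_with_dual_vectors:
  "\<exists>z v. z \<noteq> 0 \<and> (\<forall>i\<in>J. poly_fun (f i) z = 0) \<and> dual_vectors J (\<lambda>i. df i z) v"
proof -
  from base_point_exists obtain z where z: "z \<noteq> 0" "\<forall>i\<in>J. poly_fun (f i) z = 0" by blast
  have "\<exists>v. dual_vectors J (\<lambda>i. df i z) v" by (rule dual_at) (use z in auto)
  thus ?thesis using z by blast
qed

lemma dual_vectors_combination:
  assumes "dual_vectors J (\<lambda>i. df i z) v" "i \<in> J"
  shows "df i z (\<Sum>j\<in>J. c j *s v j) = c i"
proof -
  have "df i z (\<Sum>j\<in>J. c j *s v j) = (\<Sum>j\<in>J. c j * df i z (v j))"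
    by (rule complex_linear_simps(6)[OF df_linear])
  also have "\<dots> = (\<Sum>j\<in>J. if i = j then c j else 0)"
    using assms unfolding dual_vectors_def by (intro sum.cong) auto
  also have "\<dots> = c i" using assms(2) by (subst sum.delta') auto
  finally show ?thesis .
qed

lemma divisor_complement_nonempty: "\<exists>z. z \<notin> D"
proof -
  obtain z v where zv: "z \<noteq> 0" "\<forall>i\<in>J. poly_fun (f i) z = 0"
    "dual_vectors J (\<lambda>i. df i z) v"
    using base_point_with_dual_vectors by blast
  have "eventually (\<lambda>s. z + s *s (\<Sum>j\<in>J. 1 *s v j) \<notin> D) (at (0::complex))"
    by (rule off_divisor_near_base_point) (use zv(2) dual_vectors_combination[OF zv(3), of _ "\<lambda>_. 1"] in auto)
  from eventually_happens[OF this] show ?thesis by auto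
qed

text \<open>
  On the line from \<open>z\<close> to a point off the divisor, the equation of the divisor is a non-zero
  polynomial in one variable, with finitely many zeros. So the complement of the divisor is dense.
\<close>

lemma off_divisor_along_line: "\<exists>a. eventually (\<lambda>s. z + s *s a \<notin> D) (at (0::complex))"
proof -
  obtain z1 where z1: "z1 \<notin> D" using divisor_complement_nonempty by blast
  obtain q where q: "\<And>s. poly_fun (\<Prod>i\<in>J. f i) (z + s *s (z1 - z)) = poly q s"
    using cpoly_function_on_line by metis
  have mem: "z + s *s (z1 - z) \<in> D \<longleftrightarrow> poly q s = 0" for s
    unfolding divisor_def mem_Collect_eq q ..
  have "z + 1 *s (z1 - z) = z1" by simp
  hence "poly q 1 \<noteq> 0" using mem[of 1] z1 by metis
  hence "q \<noteq> 0" by auto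
  hence "finite {s. poly q s = 0}" by (rule poly_roots_finite)
  hence "\<not> 0 islimpt {s. poly q s = 0}" by (rule islimpt_finite)
  hence "eventually (\<lambda>s. z + s *s (z1 - z) \<notin> D) (at 0)"
    by (simp only: islimpt_iff_eventually mem mem_Collect_eq not_not)
  thus ?thesis ..
qed

lemma tendsto_line: "((\<lambda>s::complex. z + s *s a) \<longlongrightarrow> (z :: complex ^ 'n)) (at 0)"
proof -
  have "((\<lambda>s::complex. z + s *s a) \<longlongrightarrow> z + 0 *s a) (at 0)"
    by (intro tendsto_add tendsto_const bounded_linear.tendsto[OF bounded_linear_smult] tendsto_ident_at)
  thus ?thesis by simp
qed

lemma \<tau>_tendsto: "((\<lambda>s. \<tau> i j (z + s *s a) x) \<longlongrightarrow> \<tau> i j z x) (at 0)"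
proof -
  have "isCont (\<lambda>z. df i z x) z" "isCont (\<lambda>z. df j z x) z" "isCont (poly_fun (f i)) z" "isCont (poly_fun (f j)) z"
    by (intro isCont_cpoly_function poly_fun_derivative(3) cpoly_function_poly_fun)+
  hence "isCont (\<lambda>z. \<tau> i j z x) z" unfolding \<tau>_def by (intro continuous_intros)
  thus ?thesis by (rule isCont_tendsto_compose[OF _ tendsto_line])
qed

text \<open>
  The coefficients of \<open>\<tau> i j\<close> vanish at the points where all the \<open>f i\<close> vanish; this is the first
  order term there in the direction \<open>a\<close>.
\<close>

lemma \<tau>_quotient_tendsto:
  assumes "poly_fun (f i) z = 0" "poly_fun (f j) z = 0"
  shows "((\<lambda>s. \<tau> i j (z + s *s a) x / s) \<longlongrightarrow>
    of_nat (d j) * df j z a * df i z x - of_nat (d i) * df i z a * df j z x) (at 0)"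
proof -
  have df: "((\<lambda>s. df i (z + s *s a) x) \<longlongrightarrow> df i z x) (at 0)" for i
    by (rule isCont_tendsto_compose[OF _ tendsto_line])
       (intro isCont_cpoly_function poly_fun_derivative(3))
  have "((\<lambda>s. of_nat (d j) * (poly_fun (f j) (z + s *s a) / s) * df i (z + s *s a) x
       - of_nat (d i) * (poly_fun (f i) (z + s *s a) / s) * df j (z + s *s a) x) \<longlongrightarrow>
    of_nat (d j) * df j z a * df i z x - of_nat (d i) * df i z a * df j z x) (at 0)"
    by (intro tendsto_intros df quotient_limit_at_zero assms)
  thus ?thesis by (simp add: \<tau>_def diff_divide_distrib)
qed

end

locale log_foliation = ordinary_family p f d k \<delta>
  for p and f :: "nat \<Rightarrow> 'n::finite cpoly" and d k \<delta> +
  fixes \<eta> :: "complex ^ 'n \<Rightarrow> 'n form" and lam :: "nat set \<Rightarrow> complex"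
  assumes \<eta>_def: "\<eta> = log_form p (p + 1) f lam"
    and radial: "z \<notin> divisor (p + 1) f \<Longrightarrow> contract z (\<eta> z) = (\<lambda>v. 0)"
begin

lemma generator_wedge_off_divisor:
  assumes gen: "local_generator p D \<eta> U \<theta>" and z: "z \<in> U" "z \<notin> D" and v: "\<theta> z v \<noteq> 0"
    and ij: "i \<in> J" "j \<in> J"
  shows "\<tau> i j z x * \<theta> z v = (\<Sum>l<p. \<tau> i j z (v l) * \<theta> z (v(l := x)))"
proof -
  from gen z have "\<exists>c. \<forall>v. \<theta> z v = c * \<eta> z v" unfolding local_generator_def by blast
  then obtain c where c: "\<And>v. \<theta> z v = c * \<eta> z v" by blast
  have "\<eta> z v \<noteq> 0" using v c by auto
  hence "\<tau> i j z x * \<eta> z v = (\<Sum>l<p. \<tau> i j z (v l) * \<eta> z (v(l := x)))"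
    by (intro \<tau>_wedge_log_form z(2) radial[OF z(2)] ij) (simp add: \<eta>_def)
  hence "c * (\<tau> i j z x * \<eta> z v) = c * (\<Sum>l<p. \<tau> i j z (v l) * \<eta> z (v(l := x)))" by (rule arg_cong)
  thus ?thesis unfolding c by (simp only: sum_distrib_left mult.left_commute)
qed

lemma generator_tendsto:
  assumes gen: "local_generator p D \<eta> U \<theta>" and z: "z \<in> U"
  shows "((\<lambda>s. \<theta> (z + s *s a) v) \<longlongrightarrow> \<theta> z v) (at 0)"
proof -
  from gen z obtain g' where "((\<lambda>z. \<theta> z v) has_derivative g') (at z)"
    unfolding local_generator_def holomorphic_form_def holomorphic_fun_def by blast
  hence "isCont (\<lambda>z. \<theta> z v) z" by (rule has_derivative_continuous)
  thus ?thesis by (rule isCont_tendsto_compose[OF _ tendsto_line])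
qed

lemma generator_wedge_along_line:
  assumes gen: "local_generator p D \<eta> U \<theta>" and z: "z \<in> U" and v: "\<theta> z v \<noteq> 0"
    and ij: "i \<in> J" "j \<in> J" and a: "eventually (\<lambda>s. z + s *s a \<notin> D) (at 0)"
  shows "eventually (\<lambda>s. \<tau> i j (z + s *s a) x * \<theta> (z + s *s a) v =
    (\<Sum>l<p. \<tau> i j (z + s *s a) (v l) * \<theta> (z + s *s a) (v(l := x)))) (at 0)"
proof -
  have "open U" using gen unfolding local_generator_def by blast
  hence "eventually (\<lambda>s. z + s *s a \<in> U) (at 0)"
    using topological_tendstoD[OF tendsto_line] z by blast
  moreover have "eventually (\<lambda>s. \<theta> (z + s *s a) v \<noteq> 0) (at 0)"
    by (rule tendsto_imp_eventually_ne[OF generator_tendsto[OF gen z] v])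
  ultimately show ?thesis using a
    by eventually_elim (rule generator_wedge_off_divisor[OF gen _ _ _ ij])
qed

text \<open>
  Limit of the identity off the divisor along a line through \<open>z\<close>.
\<close>

lemma generator_wedge:
  assumes gen: "local_generator p D \<eta> U \<theta>" and z: "z \<in> U" and v: "\<theta> z v \<noteq> 0"
    and ij: "i \<in> J" "j \<in> J"
  shows "\<tau> i j z x * \<theta> z v = (\<Sum>l<p. \<tau> i j z (v l) * \<theta> z (v(l := x)))"
proof -
  obtain a where a: "eventually (\<lambda>s. z + s *s a \<notin> D) (at 0)" using off_divisor_along_line by blast
  have 1: "((\<lambda>s. \<tau> i j (z + s *s a) x * \<theta> (z + s *s a) v) \<longlongrightarrow> \<tau> i j z x * \<theta> z v) (at 0)"
    by (intro tendsto_mult \<tau>_tendsto generator_tendsto[OF gen z])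
  have "((\<lambda>s. \<Sum>l<p. \<tau> i j (z + s *s a) (v l) * \<theta> (z + s *s a) (v(l := x)))
      \<longlongrightarrow> (\<Sum>l<p. \<tau> i j z (v l) * \<theta> z (v(l := x)))) (at 0)"
    by (intro tendsto_sum tendsto_mult \<tau>_tendsto generator_tendsto[OF gen z])
  hence 2: "((\<lambda>s. \<tau> i j (z + s *s a) x * \<theta> (z + s *s a) v)
      \<longlongrightarrow> (\<Sum>l<p. \<tau> i j z (v l) * \<theta> z (v(l := x)))) (at 0)"
    by (rule Lim_transform_eventually)
       (rule eventually_mono[OF generator_wedge_along_line[OF gen z v ij a, of x]], simp only:)
  show ?thesis by (rule tendsto_unique[OF _ 1 2]) simp
qed

text \<open>
  Let \<open>z\<close> be a base point with a local generator \<open>\<theta>\<close>. Dividing the relation \<open>\<tau> i j \<and> \<theta> = 0\<close> at \<open>z + s a\<close> by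
  \<open>s\<close> and letting \<open>s\<close> tend to zero gives a relation at \<open>z\<close> for every direction \<open>a\<close> transversal to the
  divisor. Two choices of \<open>a\<close> differing in one coordinate yield \<open>df i \<and> \<theta> = 0\<close> for each \<open>i\<close>, but a non-zero
  \<open>p\<close>-form cannot be divisible by \<open>p + 1\<close> independent covectors.
\<close>

lemma regular_point_not_base:
  assumes z: "z \<in> regular_points p D \<eta>"
  shows "\<exists>i\<in>J. poly_fun (f i) z \<noteq> 0"
proof (rule ccontr)
  assume "\<not> ?thesis"
  hence base: "poly_fun (f i) z = 0" if "i \<in> J" for i using that by blast
  from z obtain U \<theta> where z0: "z \<noteq> 0" and gen: "local_generator p D \<eta> U \<theta>" and zU: "z \<in> U"
    unfolding regular_points_def by blast
  from gen zU have "\<theta> z \<noteq> (\<lambda>v. 0)" unfolding local_generator_def by blast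
  then obtain v where v: "\<theta> z v \<noteq> 0" by auto
  have "\<exists>e. dual_vectors J (\<lambda>i. df i z) e" by (rule dual_at) (use z0 base in auto)
  then obtain e where e: "dual_vectors J (\<lambda>i. df i z) e" by blast
  have lim: "(of_nat (d j) * df j z a * df i z x - of_nat (d i) * df i z a * df j z x) * \<theta> z v =
      (\<Sum>l<p. (of_nat (d j) * df j z a * df i z (v l) - of_nat (d i) * df i z a * df j z (v l)) * \<theta> z (v(l := x)))"
    if ij: "i \<in> J" "j \<in> J" and a: "\<And>i. i \<in> J \<Longrightarrow> df i z a \<noteq> 0" for i j a x
  proof -
    let ?T = "\<lambda>x. of_nat (d j) * df j z a * df i z x - of_nat (d i) * df i z a * df j z x"
    have off: "eventually (\<lambda>s. z + s *s a \<notin> D) (at 0)"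
      by (rule off_divisor_near_base_point[OF base a])
    have T: "((\<lambda>s. \<tau> i j (z + s *s a) y / s) \<longlongrightarrow> ?T y) (at 0)" for y
      by (rule \<tau>_quotient_tendsto[OF base[OF ij(1)] base[OF ij(2)]])
    have 1: "((\<lambda>s. \<tau> i j (z + s *s a) x / s * \<theta> (z + s *s a) v) \<longlongrightarrow> ?T x * \<theta> z v) (at 0)"
      by (intro tendsto_mult T generator_tendsto[OF gen zU])
    have "((\<lambda>s. \<Sum>l<p. \<tau> i j (z + s *s a) (v l) / s * \<theta> (z + s *s a) (v(l := x)))
        \<longlongrightarrow> (\<Sum>l<p. ?T (v l) * \<theta> z (v(l := x)))) (at 0)"
      by (intro tendsto_sum tendsto_mult T generator_tendsto[OF gen zU])
    moreover have "eventually (\<lambda>s. (\<Sum>l<p. \<tau> i j (z + s *s a) (v l) / s * \<theta> (z + s *s a) (v(l := x)))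
        = \<tau> i j (z + s *s a) x / s * \<theta> (z + s *s a) v) (at 0)"
      using generator_wedge_along_line[OF gen zU v ij off, of x]
    proof eventually_elim
      case (elim s)
      show ?case by (simp only: times_divide_eq_left elim sum_divide_distrib)
    qed
    ultimately have 2: "((\<lambda>s. \<tau> i j (z + s *s a) x / s * \<theta> (z + s *s a) v)
        \<longlongrightarrow> (\<Sum>l<p. ?T (v l) * \<theta> z (v(l := x)))) (at 0)"
      by (rule Lim_transform_eventually)
    show ?thesis by (rule tendsto_unique[OF _ 1 2]) simp
  qed
  have single: "df i z x * \<theta> z v = (\<Sum>l<p. df i z (v l) * \<theta> z (v(l := x)))" if i: "i \<in> J" for i x
  proof -
    have "\<exists>j\<in>J. j \<noteq> i"
      by (rule bexI[of _ "if i = 1 then 2 else 1"]) (use p1 in auto)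
    then obtain j where j: "j \<in> J" "j \<noteq> i" by blast
    \<comment> \<open>Only the coefficient of \<open>df i\<close> in the limit relation depends on \<open>c\<close>; comparing \<open>c = 1\<close> with \<open>c = 2\<close>
      isolates it.\<close>
    define a where "a c = (\<Sum>m\<in>J. (if m = j then c else 1) *s e m)" for c
    have da: "df m z (a c) = (if m = j then c else 1)" if "m \<in> J" for m c
      unfolding a_def by (rule dual_vectors_combination[OF e that])
    define S where "S m = (\<Sum>l<p. df m z (v l) * \<theta> z (v(l := x)))" for m
    have *: "of_nat (d j) * c * (df i z x * \<theta> z v) - of_nat (d i) * (df j z x * \<theta> z v)
        = of_nat (d j) * c * S i - of_nat (d i) * S j" if "c \<noteq> 0" for c
    proof -
      have "df m z (a c) \<noteq> 0" if "m \<in> J" for m using da[OF that] \<open>c \<noteq> 0\<close> by simp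
      from lim[OF i j(1) this, of x]
      have "(of_nat (d j) * c * df i z x - of_nat (d i) * df j z x) * \<theta> z v =
        (\<Sum>l<p. (of_nat (d j) * c * df i z (v l) - of_nat (d i) * df j z (v l)) * \<theta> z (v(l := x)))"
        using j by (simp add: da[OF i] da[OF j(1)] del: fun_upd_apply)
      thus ?thesis
        unfolding S_def sum_distrib_left sum_subtractf[symmetric] left_diff_distrib mult.assoc .
    qed
    have cancel: "A * X = A * T" if "A * 2 * X - B = A * 2 * T - C" "A * 1 * X - B = A * 1 * T - C"
      for A X B T C :: complex
      using that by algebra
    have "of_nat (d j) * (df i z x * \<theta> z v) = of_nat (d j) * S i"
      by (rule cancel[OF *[of 2] *[of 1]]) simp_all
    thus ?thesis using d_pos[OF j(1)] by (simp add: S_def)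
  qed
  obtain y where y: "\<exists>i\<in>J. y i \<noteq> 0" "\<forall>l\<in>{..<p}. (\<Sum>i\<in>J. df i z (v l) * y i) = 0"
    using underdetermined_system[of "{..<p}" "J" "\<lambda>l i. df i z (v l)"] by auto
  obtain i where i: "i \<in> J" "y i \<noteq> 0" using y(1) by blast
  have "(\<Sum>m\<in>J. y m * df m z x) = 0" for x
  proof -
    have "(\<Sum>m\<in>J. y m * df m z x) * \<theta> z v = (\<Sum>m\<in>J. y m * (\<Sum>l<p. df m z (v l) * \<theta> z (v(l := x))))"
      unfolding sum_distrib_right mult.assoc by (intro sum.cong refl) (simp only: single)
    also have "\<dots> = (\<Sum>l<p. (\<Sum>m\<in>J. df m z (v l) * y m) * \<theta> z (v(l := x)))"
      unfolding sum_distrib_left sum_distrib_right by (subst sum.swap) (simp only: mult_ac)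
    also have "\<dots> = 0" using y(2) by (intro sum.neutral) auto
    finally show ?thesis using v by simp
  qed
  hence "y i = 0" by (intro independent_of_dual_vectors[OF e _ _ i(1)]) auto
  thus False using i(2) by simp
qed

text \<open>
  On the right-hand side of \<open>generator_wedge\<close> every term contains \<open>\<theta>\<close> with \<open>x\<close> inserted.
\<close>

lemma \<tau>_tangent:
  assumes x: "x \<in> foliation_tangent p D \<eta> z" and ij: "i \<in> J" "j \<in> J"
  shows "\<tau> i j z x = 0"
proof -
  from x obtain U \<theta> where gen: "local_generator p D \<eta> U \<theta>" and z: "z \<in> U"
    and c: "contract x (\<theta> z) = (\<lambda>v. 0)" unfolding foliation_tangent_def by blast
  from gen z have alt: "alternating_form p (\<theta> z)" and "\<theta> z \<noteq> (\<lambda>v. 0)"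
    unfolding local_generator_def holomorphic_form_def by blast+
  then obtain v where v: "\<theta> z v \<noteq> 0" by auto
  have "\<tau> i j z x * \<theta> z v = (\<Sum>l<p. \<tau> i j z (v l) * \<theta> z (v(l := x)))"
    by (rule generator_wedge[OF gen z v ij])
  also have "\<dots> = 0"
    by (intro sum.neutral ballI) (simp only: alternating_form_contract_slot[OF alt c] lessThan_iff mult_zero_right)
  finally show ?thesis using v by simp
qed

end

section \<open>The map is constant along the leaves\<close>

lemma same_point_sym: "same_point m a b \<Longrightarrow> same_point m b a"
proof -
  assume "same_point m a b"
  then obtain c where "c \<noteq> 0" "\<forall>i\<in>{1..m + 1}. a i = c * b i" unfolding same_point_def by blast
  thus ?thesis unfolding same_point_def by (intro exI[of _ "1 / c"]) auto
qed

lemma same_point_trans: "same_point m a b \<Longrightarrow> same_point m b c \<Longrightarrow> same_point m a c"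
proof -
  assume "same_point m a b" "same_point m b c"
  then obtain s t where "s \<noteq> 0" "\<forall>i\<in>{1..m + 1}. a i = s * b i" "t \<noteq> 0" "\<forall>i\<in>{1..m + 1}. b i = t * c i"
    unfolding same_point_def by blast
  thus ?thesis unfolding same_point_def by (intro exI[of _ "s * t"]) auto
qed

context log_foliation begin

text \<open>
  The derivative of \<open>u i / u j\<close> in the direction \<open>x\<close> is a multiple of \<open>\<tau> i j x\<close>, because the exponents
  satisfy \<open>k i deg (f i) = k j deg (f j)\<close>.
\<close>

lemma quotient_stationary_along_path:
  assumes \<gamma>: "(\<gamma> has_vector_derivative x) (at t)" and x: "x \<in> foliation_tangent p D \<eta> (\<gamma> t)"
    and ij: "i \<in> J" "j \<in> J" and j0: "poly_fun (f j) (\<gamma> t) \<noteq> 0"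
  shows "((\<lambda>t. poly_fun (u i) (\<gamma> t) / poly_fun (u j) (\<gamma> t)) has_derivative (\<lambda>h. 0)) (at t)"
proof -
  define F where "F i = poly_fun (f i) (\<gamma> t)" for i
  define G where "G i = df i (\<gamma> t) x" for i
  have der: "((\<lambda>t. poly_fun (f i) (\<gamma> t)) has_derivative (\<lambda>h. h *\<^sub>R G i)) (at t)" for i
  proof -
    have "((\<lambda>t. poly_fun (f i) (\<gamma> t)) has_derivative (\<lambda>h. df i (\<gamma> t) (h *\<^sub>R x))) (at t)"
      using \<gamma> unfolding has_vector_derivative_def
      by (rule has_derivative_compose) (rule poly_fun_derivative(1))
    thus ?thesis
      unfolding G_def by (simp add: linear_cmul[OF has_derivative_linear[OF poly_fun_derivative(1)]])
  qed
  have \<tau>: "of_nat (d j) * F j * G i = of_nat (d i) * F i * G j"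
    using \<tau>_tangent[OF x ij] by (simp add: \<tau>_def F_def G_def)
  have kd': "of_nat (k i) * of_nat (d i) = of_nat (k j) * (of_nat (d j) :: complex)"
    using kd[OF ij(1)] kd[OF ij(2)] by (metis of_nat_mult)
  have "of_nat (d j) * (of_nat (k i) * F j * G i) = of_nat (k i) * (of_nat (d j) * F j * G i)" by simp
  also have "\<dots> = (of_nat (k i) * of_nat (d i)) * (F i * G j)" by (simp add: \<tau>)
  also have "\<dots> = of_nat (d j) * (of_nat (k j) * F i * G j)" by (simp add: kd')
  finally have eq: "of_nat (k i) * F j * G i = of_nat (k j) * F i * G j"
    using d_pos[OF ij(2)] by simp
  have pow: "F i ^ k i = F i * F i ^ (k i - 1)" if "i \<in> J" for i
    using k_pos[OF that] by (simp add: power_eq_if)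
  have zero: "of_nat (k i) * (h *\<^sub>R G i) * F i ^ (k i - 1) * F j ^ k j
      - F i ^ k i * (of_nat (k j) * (h *\<^sub>R G j) * F j ^ (k j - 1)) = 0" for h
  proof -
    have "of_nat (k i) * (h *\<^sub>R G i) * F i ^ (k i - 1) * F j ^ k j
      - F i ^ k i * (of_nat (k j) * (h *\<^sub>R G j) * F j ^ (k j - 1))
      = of_real h * F i ^ (k i - 1) * F j ^ (k j - 1) * (of_nat (k i) * F j * G i - of_nat (k j) * F i * G j)"
      unfolding pow[OF ij(1)] pow[OF ij(2)] scaleR_conv_of_real by (simp only: algebra_simps)
    thus ?thesis by (simp add: eq)
  qed
  have "((\<lambda>t. poly_fun (f i) (\<gamma> t) ^ k i / poly_fun (f j) (\<gamma> t) ^ k j) has_derivative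
      (\<lambda>h. (of_nat (k i) * (h *\<^sub>R G i) * F i ^ (k i - 1) * F j ^ k j
        - F i ^ k i * (of_nat (k j) * (h *\<^sub>R G j) * F j ^ (k j - 1))) / (F j ^ k j * F j ^ k j))) (at t)"
    unfolding F_def
    by (intro has_derivative_divide' has_derivative_power der) (use j0 in simp)
  thus ?thesis unfolding zero by simp
qed

text \<open>
  The finite exceptional set of the path is harmless because the quotients are continuous across it.
  Near each time some coordinate is non-zero, so that locally all quotients by it are defined.
\<close>

lemma same_point_along_path:
  assumes "tangent_path p D \<eta> \<gamma>"
  shows "same_point p (\<lambda>i. poly_fun (u i) (\<gamma> 0)) (\<lambda>i. poly_fun (u i) (\<gamma> 1))"
proof -
  from assms obtain S where cont: "continuous_on {0..1} \<gamma>" and reg: "\<gamma> ` {0..1} \<subseteq> regular_points p D \<eta>"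
    and S: "finite S" "\<gamma> C1_differentiable_on ({0..1} - S)"
      "\<forall>t\<in>{0..1} - S. vector_derivative \<gamma> (at t) \<in> foliation_tangent p D \<eta> (\<gamma> t)"
    unfolding tangent_path_def path_def path_image_def by blast
  define w where "w i t = poly_fun (u i) (\<gamma> t)" for i t
  have contw: "continuous_on {0..1} (w i)" for i
    unfolding w_def by (rule continuous_on_poly_fun_compose[OF cont])
  have der: "((\<lambda>t. w i t / w j t) has_derivative (\<lambda>h. 0)) (at t within T)"
    if "t \<in> {0..1} - S" "i \<in> J" "j \<in> J" "w j t \<noteq> 0" for i j t T
  proof -
    have "\<gamma> differentiable at t" using S(2) that(1) by (simp add: C1_differentiable_on_eq)
    hence "(\<gamma> has_vector_derivative vector_derivative \<gamma> (at t)) (at t)" by (simp add: vector_derivative_works)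
    from quotient_stationary_along_path[OF this S(3)[rule_format, OF that(1)] that(2,3)]
    have "((\<lambda>t. w i t / w j t) has_derivative (\<lambda>h. 0)) (at t)"
      using that(4) u_eq_0_iff[OF that(3)] unfolding w_def by blast
    thus ?thesis by (rule has_derivative_at_withinI)
  qed
  define R where "R s t \<longleftrightarrow> same_point p (\<lambda>i. w i s) (\<lambda>i. w i t)" for s t
  have "R 0 1"
  proof (rule connected_equivalence_relation[of "{0..1::real}"])
    show "R y x" if "R x y" for x y using that unfolding R_def by (rule same_point_sym)
    show "R x z" if "R x y" "R y z" for x y z using that unfolding R_def by (rule same_point_trans)
    fix t0 :: real assume t0: "t0 \<in> {0..1}"
    obtain j where j: "j \<in> J" "w j t0 \<noteq> 0"
      using regular_point_not_base[of "\<gamma> t0"] reg t0 u_eq_0_iff unfolding w_def by blast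
    then obtain \<epsilon> where \<epsilon>: "0 < \<epsilon>" "\<And>s. s \<in> {0..1} \<Longrightarrow> dist s t0 < \<epsilon> \<Longrightarrow> dist (w j s) (w j t0) < cmod (w j t0)"
      using contw[of j] t0 unfolding continuous_on_iff by (metis zero_less_norm_iff)
    have nz: "w j s \<noteq> 0" if "s \<in> {0..1}" "dist s t0 < \<epsilon>" for s
      using \<epsilon>(2)[OF that] by (auto simp: dist_norm)
    have "R t0 s" if s: "s \<in> {0..1}" "dist s t0 < \<epsilon>" for s
    proof -
      define a b where "a = min s t0" and "b = max s t0"
      have sub: "t \<in> {0..1} \<and> dist t t0 < \<epsilon>" if "t \<in> {a..b}" for t
        using that s t0 by (auto simp: a_def b_def dist_real_def)
      have nz': "w j t \<noteq> 0" if "t \<in> {a..b}" for t using nz sub[OF that] by blast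
      have "w i s / w j s = w i t0 / w j t0" if i: "i \<in> J" for i
      proof -
        have const: "w i t / w j t = w i a / w j a" if "t \<in> {a..b}" for t
        proof (rule has_derivative_zero_unique_strong_interval[OF S(1) _ refl _ that])
          show "continuous_on {a..b} (\<lambda>t. w i t / w j t)"
            using nz' sub by (intro continuous_on_divide continuous_on_subset[OF contw]) auto
          fix t assume "t \<in> {a..b} - S"
          thus "((\<lambda>t. w i t / w j t) has_derivative (\<lambda>h. 0)) (at t within {a..b})"
            using sub nz' by (intro der i j(1)) auto
        qed
        show ?thesis using const[of s] const[of t0] by (simp add: a_def b_def)
      qed
      hence "\<forall>i\<in>J. w i t0 = w j t0 / w j s * w i s"
        using nz[OF s] j(2) by (simp add: field_simps)
      thus ?thesis unfolding R_def same_point_def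
        using nz[OF s] j(2) by (intro exI[of _ "w j t0 / w j s"]) simp
    qed
    thus "\<exists>T. openin (top_of_set {0..1}) T \<and> t0 \<in> T \<and> (\<forall>x\<in>T. R t0 x)"
      using \<epsilon>(1) t0 by (intro exI[of _ "{0..1} \<inter> ball t0 \<epsilon>"]) (auto simp: openin_open_Int dist_commute)
  qed auto
  thus ?thesis by (simp add: R_def w_def)
qed

lemma same_point_on_leaf:
  assumes "z \<in> leaf p D \<eta> x" "w \<in> leaf p D \<eta> x"
  shows "same_point p (\<lambda>i. poly_fun (u i) z) (\<lambda>i. poly_fun (u i) w)"
proof -
  have "same_point p (\<lambda>i. poly_fun (u i) x) (\<lambda>i. poly_fun (u i) y)" if "y \<in> leaf p D \<eta> x" for y
    using that same_point_along_path unfolding leaf_def pathstart_def pathfinish_def by blast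
  from this[OF assms(1)] this[OF assms(2)] show ?thesis
    by (blast intro: same_point_sym same_point_trans)
qed

end

section \<open>Critical points and generic fibres\<close>

text \<open>
  A vector killed by the independent differentials of the \<open>g i\<close> is a limit direction of points in their
  common level set, along which \<open>h\<close> is constant.
\<close>

lemma tangent_vector_of_zero_set:
  fixes g :: "'i \<Rightarrow> complex ^ 'n::finite \<Rightarrow> complex"
  assumes A: "finite A" and U: "open U" "z \<in> U"
    and cont: "\<And>i. i \<in> A \<Longrightarrow> continuous_on U (g i)"
    and der: "\<And>i. i \<in> A \<Longrightarrow> (g i has_derivative g' i) (at z)"
    and lin: "\<And>i. i \<in> A \<Longrightarrow> complex_linear (g' i)"
    and dual: "dual_vectors A g' v"
    and X: "\<And>i. i \<in> A \<Longrightarrow> g' i X = 0"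
    and h: "(h has_derivative h') (at z)"
    and sub: "\<And>x. x \<in> U \<Longrightarrow> (\<forall>i\<in>A. g i x = g i z) \<Longrightarrow> h x = (h z :: complex)"
  shows "h' X = 0"
proof (rule ccontr)
  assume ne: "h' X \<noteq> 0"
  note bl = has_derivative_bounded_linear[OF h]
  interpret h': bounded_linear h' by (rule bl)
  obtain K where K: "0 < K" "\<And>x. norm (h' x) \<le> norm x * K" using h'.pos_bounded by blast
  have X0: "X \<noteq> 0" using ne h'.zero by auto
  define M where "M = (2 + K) * norm X"
  have M: "0 < M" using K(1) X0 by (simp add: M_def)
  \<comment> \<open>An approximation of order \<open>e\<close> bounds \<open>norm (h' X)\<close> by \<open>e * M\<close>; this \<open>e\<close> makes the bound too small.\<close>
  define e where "e = min 1 (norm (h' X) / (2 * M))"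
  have e: "0 < e" "e \<le> 1" using ne M by (auto simp: e_def)
  have "e * M \<le> norm (h' X) / (2 * M) * M"
    using M by (intro mult_right_mono) (auto simp: e_def)
  also have "\<dots> = norm (h' X) / 2" using M by simp
  also have "\<dots> < norm (h' X)" using ne by simp
  finally have small: "e * M < norm (h' X)" .
  obtain r where r: "0 < r" "\<And>x. norm (x - z) < r \<Longrightarrow> norm (h x - h z - h' (x - z)) \<le> e * norm (x - z)"
    using h e(1) unfolding has_derivative_at_alt by blast
  obtain \<delta> where \<delta>: "0 < \<delta>" "\<forall>y. norm y < \<delta> \<longrightarrow>
      (\<exists>x\<in>U. norm (x - z - y) \<le> e * norm y \<and> (\<forall>i\<in>A. g i x = g i z + g' i y))"
    using points_near_tangent_vectors[OF A U cont der lin dual e(1)] by blast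
  define t where "t = min \<delta> (r / 2) / (2 * norm X)"
  have t: "0 < t" using \<delta>(1) r(1) X0 by (simp add: t_def)
  define y where "y = t *\<^sub>R X"
  have ny: "norm y = t * norm X" using t by (simp add: y_def)
  have "norm y = min \<delta> (r / 2) / 2" using X0 unfolding ny by (simp add: t_def)
  hence y: "norm y < \<delta>" "2 * norm y < r" using \<delta>(1) r(1) by auto
  obtain x where x: "x \<in> U" "norm (x - z - y) \<le> e * norm y" "\<forall>i\<in>A. g i x = g i z + g' i y"
    using \<delta>(2) y(1) by blast
  have "g' i y = 0" if "i \<in> A" for i
    using linear_cmul[OF has_derivative_linear[OF der[OF that]], of t X] X[OF that] by (simp add: y_def)
  hence hx: "h x = h z" using x(3) by (intro sub x(1)) auto
  have e1: "e * norm y \<le> norm y" using e(2) mult_right_mono[of e 1 "norm y"] by simp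
  have xz: "norm (x - z) \<le> 2 * norm y"
  proof -
    have "norm (x - z) \<le> norm (x - z - y) + norm y" by norm
    thus ?thesis using x(2) e1 by simp
  qed
  hence "norm (h' (x - z)) \<le> e * norm (x - z)" using r(2)[of x] y(2) hx by simp
  also have "\<dots> \<le> e * (2 * norm y)" using xz e(1) by (intro mult_left_mono) auto
  finally have 1: "norm (h' (x - z)) \<le> e * (2 * norm y)" .
  have "norm (h' (x - z - y)) \<le> norm (x - z - y) * K" by (rule K(2))
  also have "\<dots> \<le> e * norm y * K" using x(2) K(1) by (intro mult_right_mono) auto
  finally have 2: "norm (h' (x - z - y)) \<le> e * norm y * K" .
  have "h' y = h' (x - z) - h' (x - z - y)" by (simp flip: h'.diff)
  hence "norm (h' y) \<le> norm (h' (x - z)) + norm (h' (x - z - y))" by (simp only: norm_triangle_ineq4)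
  also have "\<dots> \<le> e * (2 * norm y) + e * norm y * K" using 1 2 by simp
  finally have "t * norm (h' X) \<le> t * (e * M)"
    using t by (simp add: y_def h'.scaleR M_def algebra_simps)
  hence "norm (h' X) \<le> e * M" using t by simp
  thus False using small by simp
qed

lemma cpoly_function_wedge:
  assumes "\<And>j x. j < k \<Longrightarrow> cpoly_function (\<lambda>z. \<beta> j z x)"
  shows "cpoly_function (\<lambda>z. wedge_covectors k (\<lambda>j. \<beta> j z) v)"
  unfolding wedge_covectors_def
  by (intro cpoly_function_sum cpoly_function_mult cpoly_function_const cpoly_function_prod assms) auto

lemma open_cpoly_function_nonzero:
  assumes "cpoly_function (g :: complex ^ 'n::finite \<Rightarrow> complex)"
  shows "open {x. g x \<noteq> 0}"
  by (intro open_Collect_neq continuous_at_imp_continuous_on ballI isCont_cpoly_function assms continuous_on_const)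

context ordinary_family begin

definition critical :: "(complex ^ 'n) set" where
  "critical = {z. \<nexists>v. dual_vectors J (\<lambda>i. df i z) v}"

lemma critical_iff_wedge:
  "z \<in> critical \<longleftrightarrow> wedge_covectors (p + 1) (\<lambda>j. df (Suc j) z) = (\<lambda>v. 0)"
proof
  assume z: "z \<in> critical"
  show "wedge_covectors (p + 1) (\<lambda>j. df (Suc j) z) = (\<lambda>v. 0)"
  proof (rule ccontr)
    assume "wedge_covectors (p + 1) (\<lambda>j. df (Suc j) z) \<noteq> (\<lambda>v. 0)"
    hence "\<exists>v. dual_vectors {..<p + 1} (\<lambda>j. df (Suc j) z) v"
      by (intro dual_vectors_of_wedge df_linear)
    then obtain v where v: "dual_vectors {..<p + 1} (\<lambda>j. df (Suc j) z) v" ..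
    have "df i z (v (j - 1)) = (if i = j then 1 else 0)" if ij: "i \<in> J" "j \<in> J" for i j
    proof -
      have "i - 1 \<in> {..<p + 1}" "j - 1 \<in> {..<p + 1}" "Suc (i - 1) = i" "i - 1 = j - 1 \<longleftrightarrow> i = j"
        using ij by auto
      thus ?thesis using v unfolding dual_vectors_def by metis
    qed
    hence "dual_vectors J (\<lambda>i. df i z) (\<lambda>j. v (j - 1))" unfolding dual_vectors_def by blast
    thus False using z unfolding critical_def by blast
  qed
next
  assume w: "wedge_covectors (p + 1) (\<lambda>j. df (Suc j) z) = (\<lambda>v. 0)"
  show "z \<in> critical"
    unfolding critical_def
  proof (rule CollectI, rule notI)
    assume "\<exists>v. dual_vectors J (\<lambda>i. df i z) v"
    then obtain v where v: "dual_vectors J (\<lambda>i. df i z) v" ..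
    have "dual_vectors {..<p + 1} (\<lambda>j. df (Suc j) z) (\<lambda>j. v (Suc j))"
      using v unfolding dual_vectors_def by auto
    from wedge_of_dual_vectors[OF this] show False unfolding w by simp
  qed
qed

lemma critical_cone:
  assumes z: "z \<in> critical" and t: "t \<noteq> 0"
  shows "t *s z \<in> critical"
  unfolding critical_def
proof (rule CollectI, rule notI)
  assume "\<exists>v. dual_vectors J (\<lambda>i. df i (t *s z)) v"
  then obtain v where v: "dual_vectors J (\<lambda>i. df i (t *s z)) v" ..
  have "df i z ((t ^ d j / t) *s v j) = (if i = j then 1 else 0)" if ij: "i \<in> J" "j \<in> J" for i j
  proof -
    have "t ^ d i * df i z (v j) = t * df i (t *s z) (v j)"
      using differential_scale[OF hom[OF ij(1)] t] by simp
    also have "\<dots> = (if i = j then t else 0)" using v ij unfolding dual_vectors_def by auto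
    finally have "df i z (v j) = (if i = j then t / t ^ d i else 0)" using t by (auto simp: field_simps)
    thus ?thesis using t by (simp add: complex_linear_simps[OF df_linear])
  qed
  hence "dual_vectors J (\<lambda>i. df i z) (\<lambda>j. (t ^ d j / t) *s v j)" unfolding dual_vectors_def by blast
  thus False using z unfolding critical_def by blast
qed

text \<open>
  The critical points are the common zeros of the maximal minors of the Jacobian matrix.
\<close>

lemma critical_closed:
  assumes "z \<notin> critical"
  shows "\<exists>Q. (\<forall>w\<in>critical. poly_fun Q w = 0) \<and> poly_fun Q z \<noteq> 0"
proof -
  obtain v where v: "wedge_covectors (p + 1) (\<lambda>j. df (Suc j) z) v \<noteq> 0"
    using assms unfolding critical_iff_wedge by auto
  have "cpoly_function (\<lambda>z. wedge_covectors (p + 1) (\<lambda>j. df (Suc j) z) v)"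
    by (intro cpoly_function_wedge poly_fun_derivative(3))
  then obtain Q where Q: "\<And>z. wedge_covectors (p + 1) (\<lambda>j. df (Suc j) z) v = poly_fun Q z"
    unfolding cpoly_function_def by (auto simp: fun_eq_iff)
  have "poly_fun Q w = 0" if "w \<in> critical" for w
    using that unfolding critical_iff_wedge Q[symmetric] by simp
  thus ?thesis using v unfolding Q by blast
qed

text \<open>
  If \<open>f (p + 1)\<close> vanishes as well, \<open>z\<close> is a base point and the differentials are independent. If not, the
  differentials of \<open>f 1, \<dots>, f p\<close> are independent and kill the radial vector \<open>z\<close>, on which the last
  differential is non-zero by Euler's identity. This is the step where strictly ordinary
  singularities force the critical set to be small.
\<close>

lemma critical_zeros:
  assumes z: "z \<in> critical" and zero: "\<forall>i\<in>{1..p}. poly_fun (f i) z = 0"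
  shows "z = 0"
proof (rule ccontr)
  assume z0: "z \<noteq> 0"
  have "\<exists>v. dual_vectors J (\<lambda>i. df i z) v"
  proof (cases "poly_fun (f (p + 1)) z = 0")
    case True
    have "poly_fun (f i) z = 0" if "i \<in> J" for i
      using that zero True by (cases "i = p + 1") auto
    thus ?thesis by (intro dual_at z0) auto
  next
    case False
    have "\<exists>v. dual_vectors {1..p} (\<lambda>i. df i z) v"
      using p1 zero by (intro dual_at z0) auto
    then obtain v where v: "dual_vectors {1..p} (\<lambda>i. df i z) v" ..
    define m where "m = of_nat (d (p + 1)) * poly_fun (f (p + 1)) z"
    have m: "m \<noteq> 0" using False d_pos[of "p + 1"] by (simp add: m_def)
    define e where "e = (1 / m) *s z"
    have e: "df i z e = (if i = p + 1 then 1 else 0)" if "i \<in> J" for i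
    proof (cases "i = p + 1")
      case True
      thus ?thesis using m euler[of "p + 1" z] by (simp add: e_def complex_linear_simps[OF df_linear] m_def)
    next
      case i: False
      hence "poly_fun (f i) z = 0" using zero that by auto
      thus ?thesis using i euler[OF that, of z] by (simp add: e_def complex_linear_simps[OF df_linear])
    qed
    define v' where "v' j = (if j = p + 1 then e else v j - df (p + 1) z (v j) *s e)" for j
    have "df i z (v' j) = (if i = j then 1 else 0)" if ij: "i \<in> J" "j \<in> J" for i j
    proof (cases "j = p + 1")
      case True
      thus ?thesis using e[OF ij(1)] by (simp add: v'_def)
    next
      case j: False
      have "df i z (v' j) = df i z (v j) - df (p + 1) z (v j) * df i z e"
        using j by (simp add: v'_def complex_linear_simps[OF df_linear])
      also have "\<dots> = (if i = j then 1 else 0)"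
      proof (cases "i = p + 1")
        case True
        thus ?thesis using j e[OF ij(1)] by simp
      next
        case False
        hence "i \<in> {1..p}" "j \<in> {1..p}" using ij j by auto
        thus ?thesis using v False e[OF ij(1)] unfolding dual_vectors_def by simp
      qed
      finally show ?thesis .
    qed
    thus ?thesis unfolding dual_vectors_def by blast
  qed
  thus False using z unfolding critical_def by blast
qed

text \<open>
  The relation between the \<open>u i\<close> on the critical cone is an equation for the critical values. It is
  multiplied by all the variables, so that its non-vanishing also excludes zero coordinates.
\<close>

lemma hypersurface_of_critical_values:
  "\<exists>H :: nat cpoly. H \<noteq> 0 \<and> homogeneous H \<and> poly_vars H \<subseteq> J \<and>
    (\<forall>q. poly_eval H q \<noteq> 0 \<longrightarrow> (\<forall>i\<in>J. q i \<noteq> 0) \<and>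
      (\<forall>z c. c \<noteq> 0 \<and> (\<forall>i\<in>J. poly_fun (u i) z = c * q i) \<longrightarrow> z \<notin> critical))"
proof -
  have "\<exists>E c e. (\<exists>a\<in>exponents J E. c a \<noteq> 0) \<and>
    (\<forall>a\<in>exponents J E. c a \<noteq> 0 \<longrightarrow> (\<Sum>j\<in>J. a j) = e) \<and>
    (\<forall>z\<in>critical. (\<Sum>a\<in>exponents J E. c a * (\<Prod>j\<in>J. poly_fun (u j) z ^ a j)) = 0)"
  proof (rule homogeneous_relation[where A = "{1..p}" and \<delta> = \<delta> and \<epsilon> = \<delta> and u = "\<lambda>i. u i"])
    show "z = 0" if "z \<in> critical" "\<forall>i\<in>{1..p}. poly_fun (u i) z = 0" for z
    proof (rule critical_zeros[OF that(1)], rule ballI)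
      fix i assume i: "i \<in> {1..p}"
      hence "poly_fun (u i) z = 0" using that(2) by blast
      thus "poly_fun (f i) z = 0" using i u_eq_0_iff[of i z] by simp
    qed
    show "homogeneous_of_degree \<delta> (u i)" if "i \<in> {1..p}" for i using that by (intro hom_u) auto
  qed (auto intro: critical_cone critical_closed hom_u \<delta>_pos simp del: One_nat_def)
  then obtain E c e a0 where a0: "a0 \<in> exponents J E" "c a0 \<noteq> 0"
    and ce: "\<And>a. a \<in> exponents J E \<Longrightarrow> c a \<noteq> 0 \<Longrightarrow> (\<Sum>j\<in>J. a j) = e"
    and rel: "\<And>z. z \<in> critical \<Longrightarrow> (\<Sum>a\<in>exponents J E. c a * (\<Prod>j\<in>J. poly_fun (u j) z ^ a j)) = 0"
    by blast
  let ?S = "exponents J E"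
  have fS: "finite ?S" by (intro finite_PiE) auto
  define ex :: "(nat \<Rightarrow> nat) \<Rightarrow> (nat \<Rightarrow>\<^sub>0 nat)" where
    "ex a = (\<Sum>j\<in>J. single j (Suc (a j)))" for a
  have lookup_ex: "lookup (ex a) j = (if j \<in> J then Suc (a j) else 0)" for a j
    unfolding ex_def lookup_sum lookup_single when_def by (subst sum.delta) auto
  have keys_ex: "keys (ex a) = J" for a
    by (auto simp: in_keys_iff lookup_ex simp del: One_nat_def split: if_splits)
  have inj: "a = b" if "a \<in> ?S" "b \<in> ?S" "ex a = ex b" for a b
  proof (rule PiE_ext[OF that(1,2)])
    fix j assume j: "j \<in> J"
    have "lookup (ex a) j = lookup (ex b) j" using that(3) by simp
    thus "a j = b j" using j by (simp only: lookup_ex if_True nat.inject)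
  qed
  define H :: "nat cpoly" where "H = (\<Sum>a\<in>?S. single (ex a) (c a))"
  have keys_H: "\<exists>a\<in>?S. c a \<noteq> 0 \<and> m = ex a" if "m \<in> keys H" for m
  proof -
    have "keys H \<subseteq> (\<Union>a\<in>?S. keys (single (ex a) (c a)))"
      unfolding H_def by (rule keys_sum)
    thus ?thesis using that by (auto split: if_splits)
  qed
  have "lookup H (ex a0) = (\<Sum>a\<in>?S. if a = a0 then c a0 else 0)"
    unfolding H_def lookup_sum lookup_single when_def
    by (intro sum.cong refl) (use inj a0(1) in auto)
  hence "lookup H (ex a0) \<noteq> 0" using a0 fS by simp
  hence H0: "H \<noteq> 0" by auto
  have "monom_degree m = e + (p + 1)" if m: "m \<in> keys H" for m
  proof -
    obtain a where a: "a \<in> ?S" "c a \<noteq> 0" "m = ex a" using keys_H[OF m] by blast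
    have "monom_degree m = (\<Sum>j\<in>J. a j + 1)" 
      unfolding a(3) ex_def by (simp only: monom_degree_sum monom_degree_single Suc_eq_plus1)
    also have "\<dots> = e + (p + 1)" unfolding sum.distrib using ce[OF a(1,2)] by simp
    finally show ?thesis .
  qed
  hence homH: "homogeneous H" unfolding homogeneous_def homogeneous_of_degree_def by blast
  have vars: "poly_vars H \<subseteq> J"
  proof
    fix j assume "j \<in> poly_vars H"
    then obtain m where "m \<in> keys H" "j \<in> keys m" unfolding poly_vars_def by blast
    thus "j \<in> J" using keys_H keys_ex by metis
  qed
  have eval: "poly_eval H q = (\<Prod>j\<in>J. q j) * (\<Sum>a\<in>?S. c a * (\<Prod>j\<in>J. q j ^ a j))" for q
  proof -
    have "poly_eval H q = (\<Sum>a\<in>?S. c a * (\<Prod>j\<in>J. q j * q j ^ a j))"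
      unfolding H_def ex_def by (simp only: poly_eval_sum poly_eval_single mon_eval_sum mon_eval_single power_Suc)
    thus ?thesis by (simp only: prod.distrib sum_distrib_left mult.left_commute)
  qed
  have "(\<forall>i\<in>J. q i \<noteq> 0) \<and>
      (\<forall>z c. c \<noteq> 0 \<and> (\<forall>i\<in>J. poly_fun (u i) z = c * q i) \<longrightarrow> z \<notin> critical)" if q: "poly_eval H q \<noteq> 0" for q
  proof (intro conjI allI impI ballI notI)
    fix i assume "i \<in> J" "q i = 0"
    hence "(\<Prod>j\<in>J. q j) = 0" by (intro prod_zero) auto
    thus False using q unfolding eval by simp
  next
    fix z s assume s: "s \<noteq> 0 \<and> (\<forall>i\<in>J. poly_fun (u i) z = s * q i)" and z: "z \<in> critical"
    have "0 = (\<Sum>a\<in>?S. c a * (\<Prod>j\<in>J. (s * q j) ^ a j))"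
      unfolding rel[OF z, symmetric] using s by (intro sum.cong refl arg_cong2[where f = "(*)"] prod.cong) auto
    also have "\<dots> = (\<Sum>a\<in>?S. s ^ e * (c a * (\<Prod>j\<in>J. q j ^ a j)))"
    proof (intro sum.cong refl)
      fix a assume a: "a \<in> ?S"
      have "(\<Prod>j\<in>J. (s * q j) ^ a j) = s ^ (\<Sum>j\<in>J. a j) * (\<Prod>j\<in>J. q j ^ a j)"
        by (simp only: power_mult_distrib prod.distrib power_sum)
      thus "c a * (\<Prod>j\<in>J. (s * q j) ^ a j) = s ^ e * (c a * (\<Prod>j\<in>J. q j ^ a j))"
        using ce[OF a] by (cases "c a = 0") simp_all
    qed
    also have "\<dots> = s ^ e * (\<Sum>a\<in>?S. c a * (\<Prod>j\<in>J. q j ^ a j))" by (simp only: sum_distrib_left)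
    finally show False using s q unfolding eval by simp
  qed
  thus ?thesis using H0 homH vars by blast
qed

end

context ordinary_family begin

text \<open>
  The equations of the fibre over \<open>q\<close> for \<open>q (p + 1) \<noteq> 0\<close>: the last coordinate serves as denominator.
\<close>

definition fibre_eq :: "(nat \<Rightarrow> complex) \<Rightarrow> nat \<Rightarrow> complex ^ 'n \<Rightarrow> complex" where
  "fibre_eq q i x = q (p + 1) * poly_fun (u i) x - q i * poly_fun (u (p + 1)) x"

lemma fibre_eq_poly: "\<exists>P. fibre_eq q i = poly_fun P"
proof (intro exI ext)
  fix x show "fibre_eq q i x = poly_fun (Const (q (p + 1)) * u i + Const (- q i) * u (p + 1)) x"
    by (simp add: fibre_eq_def)
qed

lemma fibre_eq_differential:
  "differential (fibre_eq q i) z x =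
    q (p + 1) * (of_nat (k i) * poly_fun (f i) z ^ (k i - 1) * df i z x)
    - q i * (of_nat (k (p + 1)) * poly_fun (f (p + 1)) z ^ (k (p + 1) - 1) * df (p + 1) z x)"
proof -
  have du: "((\<lambda>x. poly_fun (u i) x) has_derivative (\<lambda>x. of_nat (k i) * df i z x * poly_fun (f i) z ^ (k i - 1))) (at z)" for i
    unfolding poly_fun_power by (rule has_derivative_power[OF poly_fun_derivative(1)])
  have "(fibre_eq q i has_derivative (\<lambda>x. q (p + 1) * (of_nat (k i) * df i z x * poly_fun (f i) z ^ (k i - 1))
      - q i * (of_nat (k (p + 1)) * df (p + 1) z x * poly_fun (f (p + 1)) z ^ (k (p + 1) - 1)))) (at z)"
    unfolding fibre_eq_def[abs_def]
    by (intro has_derivative_diff has_derivative_mult_right du)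
  from frechet_derivative_at[OF this] show ?thesis by (simp add: mult_ac fun_eq_iff)
qed

lemma fibre_eq_derivative:
  "(fibre_eq q i has_derivative differential (fibre_eq q i) z) (at z)"
  "complex_linear (differential (fibre_eq q i) z)"
  "cpoly_function (\<lambda>z. differential (fibre_eq q i) z x)"
  "holomorphic_fun U (fibre_eq q i)"
  using fibre_eq_poly[of q i] poly_fun_derivative holomorphic_fun_poly_fun by metis+

text \<open>On vectors dual to the differentials of the \<open>f i\<close>, the Jacobian matrix of the equations is diagonal.\<close>

lemma fibre_eq_dual_vectors:
  assumes z: "z \<notin> critical" "\<And>i. i \<in> J \<Longrightarrow> poly_fun (f i) z \<noteq> 0" and q: "q (p + 1) \<noteq> 0"
  shows "\<exists>w. dual_vectors {1..p} (\<lambda>i. differential (fibre_eq q i) z) w"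
proof -
  obtain v where v: "dual_vectors J (\<lambda>i. df i z) v" using z(1) unfolding critical_def by blast
  define m where "m i = q (p + 1) * (of_nat (k i) * poly_fun (f i) z ^ (k i - 1))" for i
  have m: "m i \<noteq> 0" if "i \<in> {1..p}" for i
    using that z(2)[of i] q k_pos[of i] by (simp add: m_def)
  have "differential (fibre_eq q i) z ((1 / m j) *s v j) = (if i = j then 1 else 0)"
    if ij: "i \<in> {1..p}" "j \<in> {1..p}" for i j
  proof -
    have 1: "df i z (v j) = (if i = j then 1 else 0)" and 2: "df (p + 1) z (v j) = 0"
      using v ij unfolding dual_vectors_def by auto
    have "differential (fibre_eq q i) z (v j) = m i * (if i = j then 1 else 0)"
      unfolding fibre_eq_differential 1 2 m_def by simp
    thus ?thesis
      using m[OF ij(2)] by (simp add: complex_linear_simps(2)[OF fibre_eq_derivative(2)])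
  qed
  thus ?thesis unfolding dual_vectors_def by (intro exI[of _ "\<lambda>j. (1 / m j) *s v j"] ballI)
qed

lemma fibre_zero:
  assumes x: "x \<in> rational_map_fibre p (\<lambda>i. u i) q" and i: "i \<in> {1..p}"
  shows "fibre_eq q i x = 0"
proof -
  obtain c where c: "\<forall>i\<in>J. poly_fun (u i) x = c * q i"
    using x unfolding rational_map_fibre_def same_point_def by blast
  have "i \<in> J" "p + 1 \<in> J" using i by auto
  from this[THEN bspec[OF c]] show ?thesis unfolding fibre_eq_def by (simp only: mult_ac diff_self)
qed

lemma fibre_mem:
  assumes "\<forall>i\<in>{1..p}. fibre_eq q i x = 0" "poly_fun (u (p + 1)) x \<noteq> 0" "q (p + 1) \<noteq> 0"
  shows "x \<in> rational_map_fibre p (\<lambda>i. u i) q"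
proof -
  have eq: "poly_fun (u i) x = poly_fun (u (p + 1)) x / q (p + 1) * q i" if i: "i \<in> J" for i
  proof (cases "i = p + 1")
    case True
    thus ?thesis using assms(3) by simp
  next
    case False
    hence "fibre_eq q i x = 0" using assms(1) i by auto
    thus ?thesis using assms(3) unfolding fibre_eq_def by (simp add: field_simps)
  qed
  have "poly_fun (u (p + 1)) x / q (p + 1) \<noteq> 0" using assms(2,3) by (simp del: poly_fun_power)
  with eq have "same_point p (\<lambda>i. poly_fun (u i) x) q" unfolding same_point_def by blast
  moreover have "x \<noteq> 0"
    using assms(2) f_0[of "p + 1"] k_pos[of "p + 1"] by auto
  moreover have "\<exists>i\<in>J. poly_fun (u i) x \<noteq> 0"
    by (rule bexI[of _ "p + 1"]) (rule assms(2), simp)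
  ultimately show ?thesis
    unfolding rational_map_fibre_def rational_map_domain_def by blast
qed

text \<open>
  Near a base point the \<open>f i\<close> attain all small values; the values \<open>s ^ deg (f i) * r i\<close>, with
  \<open>r i\<close> a root of \<open>q i\<close> of order \<open>k i\<close>, tend to zero with \<open>s\<close> and have the powers \<open>s ^ \<delta> * q i\<close>.
\<close>

lemma fibre_point_near_base:
  assumes q: "\<And>i. i \<in> J \<Longrightarrow> q i \<noteq> 0"
  shows "\<exists>x c. c \<noteq> 0 \<and> x \<notin> critical \<and> (\<forall>i\<in>J. poly_fun (u i) x = c * q i)"
proof -
  obtain z v where z: "z \<noteq> 0" "\<forall>i\<in>J. poly_fun (f i) z = 0"
    and v: "dual_vectors J (\<lambda>i. df i z) v" using base_point_with_dual_vectors by blast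
  have "z \<notin> critical" using v unfolding critical_def by blast
  then obtain Q where Q: "\<forall>w\<in>critical. poly_fun Q w = 0" "poly_fun Q z \<noteq> 0"
    using critical_closed by blast
  define U where "U = {x. poly_fun Q x \<noteq> 0}"
  have U: "open U" "z \<in> U"
    using open_cpoly_function_nonzero[OF cpoly_function_poly_fun] Q(2) by (auto simp: U_def)
  have "\<exists>\<epsilon>>0. \<forall>y. norm y < \<epsilon> \<longrightarrow> (\<exists>x\<in>U. norm (x - z - y) \<le> 1 * norm y \<and>
      (\<forall>i\<in>J. poly_fun (f i) x = poly_fun (f i) z + df i z y))"
    by (rule points_near_tangent_vectors[OF _ U _ poly_fun_derivative(1) df_linear v])
       (auto intro: continuous_on_poly_fun_compose continuous_on_id)
  then obtain \<epsilon> where \<epsilon>: "0 < \<epsilon>" "\<And>y. norm y < \<epsilon> \<Longrightarrow>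
      \<exists>x\<in>U. \<forall>i\<in>J. poly_fun (f i) x = poly_fun (f i) z + df i z y" by blast
  have "\<forall>i\<in>J. \<exists>r. r ^ k i = q i" using nth_root_exists[OF k_pos] by blast
  then obtain r where r: "\<And>i. i \<in> J \<Longrightarrow> r i ^ k i = q i" by metis
  define y where "y s = (\<Sum>j\<in>J. (s ^ d j * r j) *s v j)" for s
  have "((\<lambda>s. y s) \<longlongrightarrow> y 0) (at 0)"
    unfolding y_def by (intro tendsto_intros bounded_linear.tendsto[OF bounded_linear_smult])
  moreover have "y 0 = 0"
    unfolding y_def
  proof (intro sum.neutral ballI)
    fix j assume "j \<in> J"
    from d_pos[OF this] show "(0 ^ d j * r j) *s v j = 0" by (simp add: power_0_left)
  qed
  ultimately have "eventually (\<lambda>s. norm (y s) < \<epsilon>) (at 0)" using \<epsilon>(1) by (auto simp: tendsto_iff dist_norm)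
  hence "eventually (\<lambda>s. norm (y s) < \<epsilon> \<and> s \<noteq> 0) (at 0)"
    by (intro eventually_conj eventually_neq_at_within)
  from eventually_happens[OF this] obtain s where s: "norm (y s) < \<epsilon>" "s \<noteq> 0" by auto
  obtain x where x: "x \<in> U" "\<forall>i\<in>J. poly_fun (f i) x = poly_fun (f i) z + df i z (y s)"
    using \<epsilon>(2)[OF s(1)] by blast
  have "poly_fun (u i) x = s ^ \<delta> * q i" if i: "i \<in> J" for i
  proof -
    have "poly_fun (f i) x = s ^ d i * r i"
      using x(2) i z(2) dual_vectors_combination[OF v i, of "\<lambda>j. s ^ d j * r j"] by (simp add: y_def)
    hence "poly_fun (u i) x = s ^ (k i * d i) * r i ^ k i"
      by (simp add: power_mult_distrib mult.commute flip: power_mult)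
    thus ?thesis using r[OF i] kd[OF i] by simp
  qed
  moreover have "x \<notin> critical" using x(1) Q(1) by (auto simp: U_def)
  moreover have "s ^ \<delta> \<noteq> 0" using s(2) by simp
  ultimately show ?thesis by blast
qed

text \<open>
  Only the neighbourhood of one non-critical point of the fibre is needed, where the equations
  \<open>fibre_eq\<close> have independent differentials.
\<close>

lemma submanifold_in_fibre:
  assumes q: "\<And>i. i \<in> J \<Longrightarrow> q i \<noteq> 0"
  shows "\<exists>M. M \<noteq> {} \<and> M \<subseteq> rational_map_fibre p (\<lambda>i. u i) q \<and> complex_submanifold p M"
proof -
  have qp: "q (p + 1) \<noteq> 0" by (rule q) auto
  have "\<exists>x c. c \<noteq> 0 \<and> x \<notin> critical \<and> (\<forall>i\<in>J. poly_fun (u i) x = c * q i)"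
    by (intro fibre_point_near_base q)
  then obtain x c where x: "c \<noteq> 0" "x \<notin> critical" "\<forall>i\<in>J. poly_fun (u i) x = c * q i"
    by blast
  have ux: "poly_fun (u i) x \<noteq> 0" if "i \<in> J" for i using x(1,3) q that by simp
  hence fx: "poly_fun (f i) x \<noteq> 0" if "i \<in> J" for i using that u_eq_0_iff by blast
  have "\<exists>w. dual_vectors {1..p} (\<lambda>i. differential (fibre_eq q i) x) w"
    by (intro fibre_eq_dual_vectors x(2) fx qp)
  then obtain w where w: "dual_vectors {1..p} (\<lambda>i. differential (fibre_eq q i) x) w" ..
  define W where "W y = wedge_covectors p (\<lambda>j. differential (fibre_eq q (Suc j)) y) (\<lambda>j. w (Suc j))" for y
  have "dual_vectors {..<p} (\<lambda>j. differential (fibre_eq q (Suc j)) x) (\<lambda>j. w (Suc j))"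
    using w unfolding dual_vectors_def by auto
  hence Wx: "W x \<noteq> 0" unfolding W_def by (simp add: wedge_of_dual_vectors)
  define U where "U = {y. poly_fun (u (p + 1)) y \<noteq> 0} \<inter> {y. W y \<noteq> 0}"
  have "cpoly_function W" unfolding W_def[abs_def] by (intro cpoly_function_wedge fibre_eq_derivative(3))
  hence U: "open U" unfolding U_def
    by (intro open_Int open_cpoly_function_nonzero cpoly_function_poly_fun)
  define M where "M = {y \<in> U. \<forall>i<p. fibre_eq q (Suc i) y = 0}"
  have M_iff: "(\<forall>i<p. fibre_eq q (Suc i) y = 0) \<longleftrightarrow> (\<forall>i\<in>{1..p}. fibre_eq q i y = 0)" for y
  proof
    assume *: "\<forall>i<p. fibre_eq q (Suc i) y = 0"
    show "\<forall>i\<in>{1..p}. fibre_eq q i y = 0"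
    proof
      fix i assume "i \<in> {1..p}"
      hence "i - 1 < p" "Suc (i - 1) = i" by auto
      thus "fibre_eq q i y = 0" using * by metis
    qed
  qed auto
  have "x \<in> U" using ux[of "p + 1"] Wx by (simp add: U_def)
  moreover have "fibre_eq q i x = 0" if "i \<in> {1..p}" for i
    using x(3) that unfolding fibre_eq_def by (simp del: poly_fun_power)
  ultimately have "x \<in> M" unfolding M_def M_iff by blast
  moreover have "M \<subseteq> rational_map_fibre p (\<lambda>i. u i) q"
    unfolding M_def M_iff U_def using fibre_mem qp by blast
  moreover have "complex_submanifold p M"
    unfolding complex_submanifold_def
  proof (intro ballI exI conjI allI impI)
    fix z assume z: "z \<in> M"
    show "open U" by (rule U)
    show "z \<in> U" using z by (simp add: M_def)
    show "holomorphic_fun U (fibre_eq q (Suc i))" for i by (rule fibre_eq_derivative(4))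
    show "wedge_covectors p (\<lambda>i. differential (fibre_eq q (Suc i)) y) \<noteq> (\<lambda>v. 0)" if "y \<in> U" for y
      using that unfolding U_def W_def by (auto dest: fun_cong)
    show "M \<inter> U = {y \<in> U. \<forall>i<p. fibre_eq q (Suc i) y = 0}" by (auto simp: M_def)
  qed
  ultimately show ?thesis by blast
qed

text \<open>
  The \<open>p\<close> independent differentials of the equations of the fibre cannot be combinations of the fewer
  differentials that define \<open>M\<close>, so some tangent vector \<open>X\<close> of \<open>M\<close> is not tangent to the fibre.
\<close>

lemma no_large_submanifold_in_fibre:
  assumes q: "\<And>i. i \<in> J \<Longrightarrow> q i \<noteq> 0"
    and reg: "\<And>z c. c \<noteq> 0 \<Longrightarrow> (\<forall>i\<in>J. poly_fun (u i) z = c * q i) \<Longrightarrow> z \<notin> critical"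
    and c': "c' < p" and M: "z \<in> M" "M \<subseteq> rational_map_fibre p (\<lambda>i. u i) q" "complex_submanifold c' M"
  shows False
proof -
  have qp: "q (p + 1) \<noteq> 0" by (rule q) auto
  obtain c where c: "c \<noteq> 0" "\<forall>i\<in>J. poly_fun (u i) z = c * q i"
    using M(1,2) unfolding rational_map_fibre_def same_point_def by blast
  have "poly_fun (u i) z \<noteq> 0" if "i \<in> J" for i using c q that by simp
  hence fz: "poly_fun (f i) z \<noteq> 0" if "i \<in> J" for i using that u_eq_0_iff by blast
  have "\<exists>w. dual_vectors {1..p} (\<lambda>i. differential (fibre_eq q i) z) w"
    by (intro fibre_eq_dual_vectors reg[OF c] fz qp)
  then obtain w where w: "dual_vectors {1..p} (\<lambda>i. differential (fibre_eq q i) z) w" ..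
  from bspec[OF M(3)[unfolded complex_submanifold_def] M(1)]
  obtain U g where U: "open U" "z \<in> U" and hol: "\<forall>i<c'. holomorphic_fun U (g i)"
    and wedge: "\<forall>x\<in>U. wedge_covectors c' (\<lambda>i. differential (g i) x) \<noteq> (\<lambda>v. 0)"
    and MU: "M \<inter> U = {x \<in> U. \<forall>i<c'. g i x = 0}"
    by (elim exE conjE) (rule that)
  have der: "(g i has_derivative differential (g i) x) (at x) \<and> complex_linear (differential (g i) x)"
    if ix: "i < c'" "x \<in> U" for i x
  proof -
    obtain g' where g': "(g i has_derivative g') (at x)" "complex_linear g'"
      using hol ix unfolding holomorphic_fun_def by blast
    thus ?thesis using frechet_derivative_at[OF g'(1)] by simp
  qed
  have "\<exists>e. dual_vectors {..<c'} (\<lambda>i. differential (g i) z) e"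
    using der[OF _ U(2)] wedge[rule_format, OF U(2)] by (intro dual_vectors_of_wedge) blast+
  then obtain e where e: "dual_vectors {..<c'} (\<lambda>i. differential (g i) z) e" ..
  obtain y where y: "\<exists>j\<in>{1..p}. y j \<noteq> 0" "\<forall>i\<in>{..<c'}. (\<Sum>j\<in>{1..p}. differential (g i) z (w j) * y j) = 0"
    using underdetermined_system[of "{..<c'}" "{1..p}" "\<lambda>i j. differential (g i) z (w j)"] c' by auto
  define X where "X = (\<Sum>j\<in>{1..p}. y j *s w j)"
  have gX: "differential (g i) z X = 0" if "i \<in> {..<c'}" for i
  proof -
    have "complex_linear (differential (g i) z)" using der that U(2) by auto
    hence "differential (g i) z X = (\<Sum>j\<in>{1..p}. y j * differential (g i) z (w j))"
      unfolding X_def by (rule complex_linear_simps(6))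
    thus ?thesis using bspec[OF y(2) that] by (simp only: mult.commute)
  qed
  obtain j where j: "j \<in> {1..p}" "y j \<noteq> 0" using y(1) by blast
  have "differential (fibre_eq q j) z X = 0"
  proof (rule tangent_vector_of_zero_set[of "{..<c'}" U z g "\<lambda>i. differential (g i) z" e X "fibre_eq q j"])
    show "continuous_on U (g i)" if "i \<in> {..<c'}" for i
      using der that has_derivative_continuous continuous_at_imp_continuous_on by (metis lessThan_iff)
    fix x assume x: "x \<in> U" "\<forall>i\<in>{..<c'}. g i x = g i z"
    have "g i z = 0" if "i < c'" for i using MU M(1) U(2) that by blast
    hence "x \<in> M" using MU x by auto
    thus "fibre_eq q j x = fibre_eq q j z" using fibre_zero[OF _ j(1)] M(1,2) by (metis subsetD)
  qed (use U e gX der fibre_eq_derivative(1) in auto)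
  moreover have "differential (fibre_eq q j) z X = y j"
  proof -
    have "differential (fibre_eq q j) z X = (\<Sum>i\<in>{1..p}. y i * differential (fibre_eq q j) z (w i))"
      unfolding X_def by (rule complex_linear_simps(6)[OF fibre_eq_derivative(2)])
    also have "\<dots> = (\<Sum>i\<in>{1..p}. if j = i then y i else 0)"
      using w j(1) unfolding dual_vectors_def by (intro sum.cong) auto
    also have "\<dots> = y j" using j(1) by simp
    finally show ?thesis .
  qed
  ultimately show False using j(2) by simp
qed

lemma rational_map_u: "rational_map p (\<lambda>i. u i)"
  unfolding rational_map_def
proof (intro conjI)
  show "\<exists>d. \<forall>i\<in>J. homogeneous_of_degree d (u i)" using hom_u by blast
  obtain z where z: "z \<notin> D" using divisor_complement_nonempty by blast
  have "poly_fun (u 1) z \<noteq> 0" using f_nonzero[OF z, of 1] by simp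
  hence "u 1 \<noteq> 0" by (metis poly_fun_simps(1))
  thus "\<exists>i\<in>J. u i \<noteq> 0" by (intro bexI[of _ 1]) auto
  show "\<forall>h. (\<forall>i\<in>J. h dvd u i) \<longrightarrow> h dvd 1"
  proof (intro allI impI)
    fix h assume h: "\<forall>i\<in>J. h dvd u i"
    show "h dvd 1"
    proof (rule common_divisor_is_unit)
      show "h dvd f 1 ^ k 1" "h dvd f 2 ^ k 2" using h p1 by auto
      show "2 \<le> CARD('n)" using card by simp
      fix z assume z: "z \<noteq> 0" "poly_fun (f 1) z = 0" "poly_fun (f 2) z = 0"
      have "\<exists>v. dual_vectors {1, 2} (\<lambda>i. df i z) v" by (rule dual_at) (use z p1 in auto)
      then obtain v where v: "dual_vectors {1, 2} (\<lambda>i. df i z) v" ..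
      show "\<exists>a b. df 1 z a = 1 \<and> df 1 z b = 0 \<and> df 2 z a = 0 \<and> df 2 z b = 1"
        using v unfolding dual_vectors_def by (intro exI[of _ "v 1"] exI[of _ "v 2"]) simp
    qed
  qed
qed

end

lemma (in log_foliation) first_integral:
  "rational_first_integral p D \<eta> (\<lambda>i. u i)"
proof -
  obtain H :: "nat cpoly" where H: "H \<noteq> 0" "homogeneous H" "poly_vars H \<subseteq> J"
    "\<And>q. poly_eval H q \<noteq> 0 \<Longrightarrow> (\<forall>i\<in>J. q i \<noteq> 0) \<and>
      (\<forall>z c. c \<noteq> 0 \<and> (\<forall>i\<in>J. poly_fun (u i) z = c * q i) \<longrightarrow> z \<notin> critical)"
    using hypersurface_of_critical_values by blast
  have "has_codimension p (rational_map_fibre p (\<lambda>i. u i) q)" if "poly_eval H q \<noteq> 0" for q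
  proof -
    have q: "q i \<noteq> 0" if "i \<in> J" for i using H(4)[OF \<open>poly_eval H q \<noteq> 0\<close>] that by blast
    have reg: "z \<notin> critical" if "c \<noteq> 0" "\<forall>i\<in>J. poly_fun (u i) z = c * q i" for z c
      using H(4)[OF \<open>poly_eval H q \<noteq> 0\<close>] that by blast
    show ?thesis
      unfolding has_codimension_def
    proof (intro conjI allI impI notI)
      show "\<exists>M. M \<noteq> {} \<and> M \<subseteq> rational_map_fibre p (\<lambda>i. u i) q \<and> complex_submanifold p M"
        by (intro submanifold_in_fibre q)
      fix c' assume c': "c' < p"
        and "\<exists>M. M \<noteq> {} \<and> M \<subseteq> rational_map_fibre p (\<lambda>i. u i) q \<and> complex_submanifold c' M"
      then obtain M z where M: "z \<in> M" "M \<subseteq> rational_map_fibre p (\<lambda>i. u i) q" "complex_submanifold c' M"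
        by blast
      show False by (rule no_large_submanifold_in_fibre[OF q reg c' M])
    qed
  qed
  thus ?thesis
    unfolding rational_first_integral_def using rational_map_u same_point_on_leaf H(1,2,3) by blast
qed

section \<open>The exponents\<close>

lemma Lcm_image_nonzero:
  fixes d :: "'i \<Rightarrow> nat"
  assumes "finite A" "\<And>i. i \<in> A \<Longrightarrow> 0 < d i"
  shows "Lcm (d ` A) \<noteq> 0"
proof
  assume "Lcm (d ` A) = 0"
  hence "0 \<in> d ` A" using assms(1) by (simp add: Lcm_0_iff)
  thus False using assms(2) by force
qed

text \<open>
  A common divisor of the cofactors could be removed from the least common multiple.
\<close>

lemma Gcd_of_cofactors:
  fixes d :: "'i \<Rightarrow> nat"
  assumes "finite A" "A \<noteq> {}" "\<And>i. i \<in> A \<Longrightarrow> 0 < d i"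
  shows "Gcd ((\<lambda>i. Lcm (d ` A) div d i) ` A) = 1"
proof -
  define L where "L = Lcm (d ` A)"
  define k where "k i = L div d i" for i
  define g where "g = Gcd (k ` A)"
  have L: "L \<noteq> 0" unfolding L_def by (rule Lcm_image_nonzero[OF assms(1,3)])
  have kd: "k i * d i = L" if "i \<in> A" for i using that by (simp add: k_def L_def dvd_Lcm)
  obtain i0 where i0: "i0 \<in> A" using assms(2) by blast
  have g: "g dvd k i" if "i \<in> A" for i using that unfolding g_def by (intro Gcd_dvd imageI)
  have "g dvd k i0 * d i0" using g[OF i0] by (rule dvd_mult2)
  then obtain L' where L': "L = g * L'" unfolding kd[OF i0] by (rule dvdE)
  hence pos: "0 < g" "0 < L'" using L by auto
  have "d i dvd L'" if i: "i \<in> A" for i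
  proof -
    obtain m where "k i = g * m" using g[OF i] by (rule dvdE)
    hence "g * (m * d i) = g * L'" using kd[OF i] L' by (simp add: mult.assoc)
    hence "m * d i = L'" using pos(1) by simp
    thus ?thesis by (metis dvd_triv_right)
  qed
  hence "L dvd L'" unfolding L_def by (auto intro: Lcm_least)
  hence "L \<le> L'" using pos(2) by (rule dvd_imp_le)
  hence "g * L' \<le> 1 * L'" using L' by simp
  hence "g \<le> 1" using pos(2) by simp
  hence "g = 1" using pos(1) by simp
  thus ?thesis unfolding g_def k_def L_def .
qed

lemma total_degree_homogeneous:
  assumes "homogeneous_of_degree d P" "P \<noteq> 0"
  shows "total_degree P = d"
proof -
  have "keys P \<noteq> {}" using assms(2) by simp
  hence "monom_degree ` keys P = {d}"
    using assms(1) unfolding homogeneous_of_degree_def by (metis image_cong image_constant_conv)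
  thus ?thesis by (simp add: total_degree_def)
qed

theorem corollary2:
  fixes n p :: nat
    and f :: "nat \<Rightarrow> 'n::finite cpoly"
    and \<eta> :: "complex ^ 'n \<Rightarrow> 'n form"
  assumes "CARD('n) = n + 1"
    and "1 \<le> p" and "p + 2 \<le> n"
    and "\<forall>i\<in>{1..p + 1}. homogeneous (f i)"
    and "strictly_ordinary (p + 1) f"
    and "\<eta> \<in> log_foliation_forms p (p + 1) f"
  shows "\<exists>k :: nat \<Rightarrow> nat.
           (\<forall>i\<in>{1..p + 1}. 0 < k i) \<and>
           (\<forall>i\<in>{1..p + 1}. \<forall>j\<in>{1..p + 1}. k i * total_degree (f i) = k j * total_degree (f j)) \<and>
           Gcd (k ` {1..p + 1}) = 1 \<and>
           rational_first_integral p (divisor (p + 1) f) \<eta> (\<lambda>i. f i ^ k i)"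
proof -
  define d where "d i = total_degree (f i)" for i
  have hom: "homogeneous_of_degree (d i) (f i)" and pos: "0 < d i" if i: "i \<in> {1..p + 1}" for i
  proof -
    obtain e where e: "homogeneous_of_degree e (f i)" using assms(4) i unfolding homogeneous_def by blast
    have "0 < e" "f i \<noteq> 0" using ordinary_degree_pos[OF assms(5) i e] assms(1,3) by auto
    moreover from this have "d i = e" unfolding d_def using total_degree_homogeneous e by blast
    ultimately show "homogeneous_of_degree (d i) (f i)" "0 < d i" using e by auto
  qed
  define L where "L = Lcm (d ` {1..p + 1})"
  define k where "k i = L div d i" for i
  have kd: "k i * d i = L" if "i \<in> {1..p + 1}" for i
    using that unfolding k_def L_def by (intro dvd_div_mult_self dvd_Lcm imageI)
  have L: "L \<noteq> 0" unfolding L_def by (rule Lcm_image_nonzero[OF _ pos]) auto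
  have k: "0 < k i" if "i \<in> {1..p + 1}" for i using kd[OF that] L by (cases "k i = 0") auto
  have "Gcd (k ` {1..p + 1}) = 1"
    unfolding k_def L_def by (rule Gcd_of_cofactors) (use pos in auto)
  moreover obtain lam where lam: "\<eta> = log_form p (p + 1) f lam"
    and rad: "\<forall>z. z \<notin> divisor (p + 1) f \<longrightarrow> contract z (\<eta> z) = (\<lambda>v. 0)"
    using assms(6) unfolding log_foliation_forms_def by blast
  interpret log_foliation p f d k L \<eta> lam
    by unfold_locales (use assms hom pos kd k lam rad in auto)
  have "rational_first_integral p (divisor (p + 1) f) \<eta> (\<lambda>i. f i ^ k i)" by (rule first_integral)
  ultimately show ?thesis using k kd unfolding d_def by (intro exI[of _ k]) auto
qed

end
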